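(* Let $M^2$ be a compact oriented Riemannian surface with connected totally umbilical boundary and fixed spin structure, and let $N$ be a Riemannian manifold. Assume $f\colon M^2\to N$ to be a harmonic map satisfying the Neumann boundary condition, and $\psi\in\Gamma(M,\Sigma M)$ to be an $\alpha$-Killing spinor on $M$, for some $\alpha\in i\mathbb{R}$, such that $2i\alpha$ is the principal curvature of the boundary and that $i\nu\cdot\psi=\psi$ holds at a point in $\partial M$. Then $\left(f,\ \phi:=\sum_{j=1}^2e_j\cdot\psi\otimes f_*(e_j)\right)$ is a Dirac-harmonic map with Neumann boundary condition $f_*(\nu)=0$ for $f$ and $\rm MIT$ boundary condition $i\nu\cdot\phi=-\phi$ on $\partial M$ for $\phi$.
   Context: $\Sigma M$ is the complex spinor bundle of $M$ with its Hermitian metric, spin connection $\nabla$ and Clifford multiplication "$\cdot$" (with $X\cdot X\cdot=-|X|^2$); $\nu$ is the inner unit normal along $\partial M$, and $\nu\cdot$ also denotes $\nu\cdot\otimes\mathrm{id}$; $(e_1,e_2)$ is any local orthonormal basis of $TM$; $f_*=df$. An $\alpha$-Killing spinor is a section $\psi$ of $\Sigma M$ with $\nabla_X\psi=\alpha X\cdot\psi$ for all tangent vectors $X$. The Weingarten endomorphism of $\partial M$ is $WX=-\nabla_X\nu$; the condition that $2i\alpha\in\mathbb{R}$ is the principal curvature means $W=2i\alpha\,\mathrm{id}_{T\partial M}$ (for $\alpha=0$: $\partial M$ totally geodesic). Let $h$ be the metric of $N$. The bundle $\Sigma M\otimes f^*TN$ carries the tensor product connection of the spin connection and the pull-back Levi-Civita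 connection, and $D^f\phi:=\sum_j(e_j\cdot\otimes\mathrm{id})\nabla_{e_j}\phi$. The section $V_\phi\in\Gamma(f^*TN)$ is defined by $h(V_\phi,Y)=\sum_j\langle(e_j\cdot\otimes R^N_{df(e_j),Y})\phi,\phi\rangle$ for all tangent vectors $Y$ to $N$, where $R^N$ is the curvature tensor of $N$. $f$ is harmonic if $\mathrm{tr}(\nabla df)=0$; the Neumann boundary condition is $df(\nu)=0$ on $\partial M$. A pair $(f,\phi)$ is a Dirac-harmonic map (with prescribed boundary conditions) if $D^f\phi=0$ and $\mathrm{tr}(\nabla df)=\frac12V_\phi$ on $M$ and $f,\phi$ satisfy the prescribed boundary conditions. *)

theory Defs
  imports "HOL-Analysis.Analysis"
begin

section \<open>Smooth functions on subsets of a normed space\<close>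

text \<open>Derivatives are taken within \<open>S\<close>. All sets used below are relatively open in a Euclidean
  space or in a half-space, where such derivatives are unique; on half-spaces this is smoothness
  up to the boundary.\<close>

primrec C_k_on :: "nat \<Rightarrow> 'a::real_normed_vector set \<Rightarrow> ('a \<Rightarrow> 'b::real_normed_vector) \<Rightarrow> bool" where
  "C_k_on 0 S F = continuous_on S F"
| "C_k_on (Suc k) S F =
     (\<exists>F'. (\<forall>x\<in>S. (F has_derivative F' x) (at x within S)) \<and> (\<forall>v. C_k_on k S (\<lambda>x. F' x v)))"

definition smooth_on :: "'a::real_normed_vector set \<Rightarrow> ('a \<Rightarrow> 'b::real_normed_vector) \<Rightarrow> bool" where
  "smooth_on S F \<longleftrightarrow> (\<forall>k. C_k_on k S F)"


section \<open>Riemannian manifolds, possibly with boundary\<close>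

text \<open>A Riemannian manifold on the type \<open>'m\<close>: an atlas indexed by \<open>'i\<close> with chart domains
  \<open>cdom\<close> and coordinate maps \<open>cmap\<close>, and the matrices \<open>gmat\<close> of the metric in these charts.

  Tensor calculus is done in charts. A tangent vector at \<open>p\<close> is represented by its component
  vectors in the charts around \<open>p\<close>; operators carry the chart \<open>i\<close> as an argument and act on
  components with respect to it, and equations are required in every chart around \<open>p\<close>.\<close>

record ('i, 'm, 'd) riem =
  cdom :: "'i \<Rightarrow> 'm set"
  cmap :: "'i \<Rightarrow> 'm \<Rightarrow> real ^ 'd"
  gmat :: "'i \<Rightarrow> 'm \<Rightarrow> real ^ 'd ^ 'd"

definition cpar :: "('i, 'm, 'd::finite) riem \<Rightarrow> 'i \<Rightarrow> real ^ 'd \<Rightarrow> 'm" where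
  "cpar M i = inv_into (cdom M i) (cmap M i)"

text \<open>Derivative at \<open>p\<close>, in the direction with components \<open>X\<close>, of a function \<open>F\<close> on \<open>A\<close>.
  Here \<open>A\<close> is \<open>UNIV\<close>, or the boundary of the manifold with \<open>X\<close> tangent to it. Only
  the germ of \<open>F\<close> at \<open>p\<close> matters.\<close>

definition dirder ::
    "('i, 'm, 'd::finite) riem \<Rightarrow> 'm set \<Rightarrow> 'i \<Rightarrow> ('m \<Rightarrow> 'b::real_normed_vector) \<Rightarrow> 'm \<Rightarrow> real ^ 'd \<Rightarrow> 'b" where
  "dirder M A i F p X =
     frechet_derivative (F \<circ> cpar M i) (at (cmap M i p) within cmap M i ` (cdom M i \<inter> A)) X"

definition jac :: "('i, 'm, 'd::finite) riem \<Rightarrow> 'i \<Rightarrow> 'i \<Rightarrow> 'm \<Rightarrow> real ^ 'd \<Rightarrow> real ^ 'd" where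
  "jac M i j p X = dirder M UNIV i (cmap M j) p X"

definition gip :: "('i, 'm, 'd::finite) riem \<Rightarrow> 'i \<Rightarrow> 'm \<Rightarrow> real ^ 'd \<Rightarrow> real ^ 'd \<Rightarrow> real" where
  "gip M i p X Y = X \<bullet> (gmat M i p *v Y)"

text \<open>\<open>H\<close> is the model space: \<open>UNIV\<close> for manifolds without boundary, a closed half-space otherwise.\<close>

definition smooth_atlas :: "(real ^ 'd::finite) set \<Rightarrow> ('i, 'm::topological_space, 'd) riem \<Rightarrow> bool" where
  "smooth_atlas H M \<longleftrightarrow>
     (\<Union>i. cdom M i) = UNIV \<and>
     (\<forall>i. open (cdom M i) \<and> openin (top_of_set H) (cmap M i ` cdom M i) \<and>
          homeomorphism (cdom M i) (cmap M i ` cdom M i) (cmap M i) (cpar M i)) \<and>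
     (\<forall>i j. smooth_on (cmap M i ` (cdom M i \<inter> cdom M j)) (cmap M j \<circ> cpar M i))"

definition riemannian_manifold :: "(real ^ 'd::finite) set \<Rightarrow> ('i, 'm::topological_space, 'd) riem \<Rightarrow> bool" where
  "riemannian_manifold H M \<longleftrightarrow>
     smooth_atlas H M \<and>
     (\<forall>i. smooth_on (cmap M i ` cdom M i) (gmat M i \<circ> cpar M i)) \<and>
     (\<forall>i. \<forall>p\<in>cdom M i. transpose (gmat M i p) = gmat M i p \<and> (\<forall>X. X \<noteq> 0 \<longrightarrow> gip M i p X X > 0)) \<and>
     (\<forall>i j. \<forall>p\<in>cdom M i \<inter> cdom M j. \<forall>X Y. gip M j p (jac M i j p X) (jac M i j p Y) = gip M i p X Y)"

definition oriented :: "('i, 'm, 'd::finite) riem \<Rightarrow> bool" where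
  "oriented M \<longleftrightarrow> (\<forall>i j. \<forall>p\<in>cdom M i \<inter> cdom M j. det (matrix (jac M i j p)) > 0)"

definition orthonormal :: "('i, 'm, 'd::finite) riem \<Rightarrow> 'i \<Rightarrow> 'm \<Rightarrow> ('d \<Rightarrow> real ^ 'd) \<Rightarrow> bool" where
  "orthonormal M i p e \<longleftrightarrow> (\<forall>a b. gip M i p (e a) (e b) = (if a = b then 1 else 0))"

text \<open>A basis of the tangent space at \<open>p\<close>: \<open>E a i\<close> are the components of the \<open>a\<close>-th basis vector
  in the chart \<open>i\<close>.\<close>

definition orthonormal_basis :: "('i, 'm, 'd::finite) riem \<Rightarrow> 'm \<Rightarrow> ('d \<Rightarrow> 'i \<Rightarrow> real ^ 'd) \<Rightarrow> bool" where
  "orthonormal_basis M p E \<longleftrightarrow>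
     (\<forall>i. p \<in> cdom M i \<longrightarrow> orthonormal M i p (\<lambda>a. E a i)) \<and>
     (\<forall>i j a. p \<in> cdom M i \<inter> cdom M j \<longrightarrow> E a j = jac M i j p (E a i))"

text \<open>The Levi-Civita connection. \<open>christoffel M i p X Y\<close> has the \<open>c\<close>-th component
  $\sum_{a,b} \Gamma^c_{ab} X^a Y^b$; in \<open>nabla\<close> the vector field \<open>Z\<close> on \<open>A\<close> is given by its
  components in the chart \<open>i\<close>.\<close>

definition christoffel ::
    "('i, 'm, 'd::finite) riem \<Rightarrow> 'i \<Rightarrow> 'm \<Rightarrow> real ^ 'd \<Rightarrow> real ^ 'd \<Rightarrow> real ^ 'd" where
  "christoffel M i p X Y =
     (let dg = (\<lambda>a b c. dirder M UNIV i (\<lambda>q. gmat M i q $ b $ c) p (axis a 1)) in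
      \<chi> c. \<Sum>a\<in>UNIV. \<Sum>b\<in>UNIV.
        (1/2) * (\<Sum>l\<in>UNIV. matrix_inv (gmat M i p) $ c $ l * (dg a b l + dg b a l - dg l a b)) * X $ a * Y $ b)"

definition nabla ::
    "('i, 'm, 'd::finite) riem \<Rightarrow> 'm set \<Rightarrow> 'i \<Rightarrow> ('m \<Rightarrow> real ^ 'd) \<Rightarrow> 'm \<Rightarrow> real ^ 'd \<Rightarrow> real ^ 'd" where
  "nabla M A i Z p X = dirder M A i Z p X + christoffel M i p X (Z p)"

text \<open>$R(X,Y)Z = \nabla_X\nabla_Y Z - \nabla_Y\nabla_X Z - \nabla_{[X,Y]}Z$, evaluated on the
  extensions of \<open>X\<close>, \<open>Y\<close>, \<open>Z\<close> with constant components in the chart \<open>i\<close>, so that $[X,Y] = 0$.\<close>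

definition curvature ::
    "('i, 'm, 'd::finite) riem \<Rightarrow> 'i \<Rightarrow> 'm \<Rightarrow> real ^ 'd \<Rightarrow> real ^ 'd \<Rightarrow> real ^ 'd \<Rightarrow> real ^ 'd" where
  "curvature M i p X Y Z =
     nabla M UNIV i (\<lambda>q. nabla M UNIV i (\<lambda>_. Z) q Y) p X -
     nabla M UNIV i (\<lambda>q. nabla M UNIV i (\<lambda>_. Z) q X) p Y"


section \<open>The boundary of a surface\<close>

definition half_plane :: "(real ^ 2) set" where
  "half_plane = {x. x $ 2 \<ge> 0}"

definition boundary :: "('i, 'm, 2) riem \<Rightarrow> 'm set" where
  "boundary M = {p. \<exists>i. p \<in> cdom M i \<and> cmap M i p $ 2 = 0}"

text \<open>At a boundary point, the vectors tangent to the boundary are those with vanishing second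
  component, and the inward pointing ones are those with positive second component.\<close>

definition inner_normal :: "('i, 'm, 2) riem \<Rightarrow> 'i \<Rightarrow> 'm \<Rightarrow> real ^ 2" where
  "inner_normal M i p =
     (THE n. gip M i p n n = 1 \<and> (\<forall>X. X $ 2 = 0 \<longrightarrow> gip M i p n X = 0) \<and> n $ 2 > 0)"

definition weingarten :: "('i, 'm, 2) riem \<Rightarrow> 'i \<Rightarrow> 'm \<Rightarrow> real ^ 2 \<Rightarrow> real ^ 2" where
  "weingarten M i p X = - nabla M (boundary M) i (inner_normal M i) p X"

definition totally_umbilical_boundary :: "('i, 'm, 2) riem \<Rightarrow> bool" where
  "totally_umbilical_boundary M \<longleftrightarrow>
     (\<exists>\<kappa> :: 'm \<Rightarrow> real. \<forall>i. \<forall>p\<in>boundary M \<inter> cdom M i. \<forall>X. X $ 2 = 0 \<longrightarrow> weingarten M i p X = \<kappa> p *\<^sub>R X)"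

definition principal_curvature :: "('i, 'm, 2) riem \<Rightarrow> real \<Rightarrow> bool" where
  "principal_curvature M \<kappa> \<longleftrightarrow>
     (\<forall>i. \<forall>p\<in>boundary M \<inter> cdom M i. \<forall>X. X $ 2 = 0 \<longrightarrow> weingarten M i p X = \<kappa> *\<^sub>R X)"


section \<open>Spin structures and spinors on a surface\<close>

text \<open>The irreducible complex representation of the Clifford algebra of the Euclidean plane with
  the convention \<open>v \<cdot> v = - |v|\<^sup>2\<close>; the two matrices are skew-Hermitian for \<open>cinner\<close>.\<close>

definition gamma :: "2 \<Rightarrow> complex ^ 2 ^ 2" where
  "gamma a = (if a = 1 then vector [vector [0, \<i>], vector [\<i>, 0]]
                       else vector [vector [0, -1], vector [1, 0]])"

definition cinner :: "complex ^ 2 \<Rightarrow> complex ^ 2 \<Rightarrow> complex" where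
  "cinner s t = (\<Sum>a\<in>UNIV. s $ a * cnj (t $ a))"

lemma gamma_clifford:
  "gamma a *v (gamma b *v s) + gamma b *v (gamma a *v s) = (if a = b then - 2 *\<^sub>R s else 0)"
  using exhaust_2[of a] exhaust_2[of b]
  by (auto simp: gamma_def vec_eq_iff forall_2 matrix_vector_mult_def sum_2 scaleR_conv_of_real)
lemma gamma_skew: "cinner (gamma a *v s) t = - cinner s (gamma a *v t)"
  using exhaust_2[of a]
  by (auto simp: gamma_def cinner_def forall_2 matrix_vector_mult_def sum_2 algebra_simps)

text \<open>Spin(2) is identified with the unit circle, \<open>cis \<theta>\<close> standing for
  $\cos\theta + \sin\theta\, e_1 e_2$. Its action on vectors is then rotation by \<open>cis \<theta> ^ 2\<close>.\<close>

definition spin_rep :: "complex \<Rightarrow> complex ^ 2 \<Rightarrow> complex ^ 2" where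
  "spin_rep z s = Re z *\<^sub>R s + Im z *\<^sub>R (gamma 1 *v (gamma 2 *v s))"

lemma spin_rep_rotation:
  assumes "cmod z = 1"
  shows "spin_rep z (gamma 1 *v (spin_rep (inverse z) s)) = Re (z^2) *\<^sub>R (gamma 1 *v s) + Im (z^2) *\<^sub>R (gamma 2 *v s)"
    "spin_rep z (gamma 2 *v (spin_rep (inverse z) s)) = - Im (z^2) *\<^sub>R (gamma 1 *v s) + Re (z^2) *\<^sub>R (gamma 2 *v s)"
proof -
  have *: "inverse z = cnj z" using assms by (metis inverse_unique complex_norm_square of_real_1 power_one)
  have n: "Re z * Re z + Im z * Im z = 1" using assms by (simp add: cmod_def power2_eq_square)
  show "spin_rep z (gamma 1 *v (spin_rep (inverse z) s)) = Re (z^2) *\<^sub>R (gamma 1 *v s) + Im (z^2) *\<^sub>R (gamma 2 *v s)"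
    unfolding * by (simp add: spin_rep_def gamma_def vec_eq_iff forall_2 matrix_vector_mult_def sum_2 complex_eq_iff power2_eq_square) (simp add: algebra_simps)
  show "spin_rep z (gamma 2 *v (spin_rep (inverse z) s)) = - Im (z^2) *\<^sub>R (gamma 1 *v s) + Re (z^2) *\<^sub>R (gamma 2 *v s)"
    unfolding * by (simp add: spin_rep_def gamma_def vec_eq_iff forall_2 matrix_vector_mult_def sum_2 complex_eq_iff power2_eq_square) (simp add: algebra_simps)
qed

text \<open>A principal Spin(2)-bundle on the type \<open>'p\<close> with its equivariant map to the bundle of
  orthonormal frames: \<open>sframe u a i\<close> are the components, in the chart \<open>i\<close>, of the \<open>a\<close>-th vector
  of the frame below \<open>u\<close>.\<close>

record ('i, 'm, 'p) spin =
  sproj :: "'p \<Rightarrow> 'm"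
  sact :: "'p \<Rightarrow> complex \<Rightarrow> 'p"
  sframe :: "'p \<Rightarrow> 2 \<Rightarrow> 'i \<Rightarrow> real ^ 2"

text \<open>A gauge is a continuous local section of the principal bundle whose frame is smooth.\<close>

definition spin_gauge ::
    "('i, 'm::topological_space, 2) riem \<Rightarrow> ('i, 'm, 'p::topological_space) spin \<Rightarrow> 'm set \<Rightarrow> ('m \<Rightarrow> 'p) \<Rightarrow> bool" where
  "spin_gauge M S U \<sigma> \<longleftrightarrow>
     open U \<and> continuous_on U \<sigma> \<and> (\<forall>p\<in>U. sproj S (\<sigma> p) = p) \<and>
     (\<forall>i a. smooth_on (cmap M i ` (cdom M i \<inter> U)) (\<lambda>x. sframe S (\<sigma> (cpar M i x)) a i))"

definition spin_structure ::
    "('i, 'm::topological_space, 2) riem \<Rightarrow> ('i, 'm, 'p::topological_space) spin \<Rightarrow> bool" where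
  "spin_structure M S \<longleftrightarrow>
     continuous_on UNIV (sproj S) \<and>
     continuous_on (UNIV \<times> sphere 0 1) (\<lambda>(u, z). sact S u z) \<and>
     (\<forall>u. sact S u 1 = u) \<and>
     (\<forall>u. \<forall>z\<in>sphere 0 1. \<forall>w\<in>sphere 0 1. sact S (sact S u z) w = sact S u (z * w)) \<and>
     (\<forall>u. \<forall>z\<in>sphere 0 1. sproj S (sact S u z) = sproj S u) \<and>
     (\<forall>u v. sproj S u = sproj S v \<longrightarrow> (\<exists>!z. z \<in> sphere 0 1 \<and> v = sact S u z)) \<and>
     (\<forall>p. \<exists>U \<sigma> \<tau>. p \<in> U \<and> spin_gauge M S U \<sigma> \<and>
        homeomorphism (U \<times> sphere 0 1) (sproj S -` U) (\<lambda>(q, z). sact S (\<sigma> q) z) \<tau>) \<and>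
     (\<forall>u. orthonormal_basis M (sproj S u) (sframe S u)) \<and>
     (\<forall>u i. sproj S u \<in> cdom M i \<longrightarrow> det (\<chi> a. sframe S u a i) > 0) \<and>
     (\<forall>i a. continuous_on (sproj S -` cdom M i) (\<lambda>u. sframe S u a i)) \<and>
     (\<forall>u i. \<forall>z\<in>sphere 0 1. sproj S u \<in> cdom M i \<longrightarrow>
        sframe S (sact S u z) 1 i = Re (z\<^sup>2) *\<^sub>R sframe S u 1 i + Im (z\<^sup>2) *\<^sub>R sframe S u 2 i \<and>
        sframe S (sact S u z) 2 i = - Im (z\<^sup>2) *\<^sub>R sframe S u 1 i + Re (z\<^sup>2) *\<^sub>R sframe S u 2 i)"

text \<open>Sections of the associated spinor bundle are smooth maps \<open>\<psi>\<close> on the principal bundle with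
  $\psi(uz) = \rho(z)^{-1}\psi(u)$.\<close>

definition spinor_field ::
    "('i, 'm::topological_space, 2) riem \<Rightarrow> ('i, 'm, 'p::topological_space) spin \<Rightarrow> ('p \<Rightarrow> complex ^ 2) \<Rightarrow> bool" where
  "spinor_field M S \<psi> \<longleftrightarrow>
     (\<forall>u. \<forall>z\<in>sphere 0 1. \<psi> (sact S u z) = spin_rep (inverse z) (\<psi> u)) \<and>
     (\<forall>U \<sigma> i. spin_gauge M S U \<sigma> \<longrightarrow> smooth_on (cmap M i ` (cdom M i \<inter> U)) (\<lambda>x. \<psi> (\<sigma> (cpar M i x))))"

definition clifford ::
    "('i, 'm, 2) riem \<Rightarrow> ('i, 'm, 'p) spin \<Rightarrow> 'i \<Rightarrow> 'p \<Rightarrow> real ^ 2 \<Rightarrow> complex ^ 2 \<Rightarrow> complex ^ 2" where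
  "clifford M S i u X s = (\<Sum>a\<in>UNIV. gip M i (sproj S u) X (sframe S u a i) *\<^sub>R (gamma a *v s))"

text \<open>The spin connection in a gauge \<open>\<sigma>\<close> with frame $(e_1,e_2)$:
  $\nabla_X\psi = X(\psi\circ\sigma) + \frac14\sum_{a,b} g(\nabla_X e_a, e_b)\, e_a\cdot e_b\cdot\psi$.\<close>

definition spin_nabla ::
    "('i, 'm, 2) riem \<Rightarrow> ('i, 'm, 'p) spin \<Rightarrow> 'i \<Rightarrow> ('m \<Rightarrow> 'p) \<Rightarrow> ('p \<Rightarrow> complex ^ 2) \<Rightarrow> 'm \<Rightarrow> real ^ 2 \<Rightarrow> complex ^ 2" where
  "spin_nabla M S i \<sigma> \<psi> p X =
     dirder M UNIV i (\<psi> \<circ> \<sigma>) p X +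
     (1/4) *\<^sub>R (\<Sum>a\<in>UNIV. \<Sum>b\<in>UNIV.
        gip M i p (nabla M UNIV i (\<lambda>q. sframe S (\<sigma> q) a i) p X) (sframe S (\<sigma> p) b i) *\<^sub>R
        (gamma a *v (gamma b *v \<psi> (\<sigma> p))))"

definition killing_spinor ::
    "('i, 'm::topological_space, 2) riem \<Rightarrow> ('i, 'm, 'p::topological_space) spin \<Rightarrow> complex \<Rightarrow> ('p \<Rightarrow> complex ^ 2) \<Rightarrow> bool" where
  "killing_spinor M S \<alpha> \<psi> \<longleftrightarrow>
     spinor_field M S \<psi> \<and>
     (\<forall>U \<sigma> i. spin_gauge M S U \<sigma> \<longrightarrow> (\<forall>p\<in>cdom M i \<inter> U. \<forall>X.
        spin_nabla M S i \<sigma> \<psi> p X = \<alpha> *s clifford M S i (\<sigma> p) X (\<psi> (\<sigma> p))))"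


section \<open>Maps\<close>

definition smooth_map ::
    "('i, 'm::topological_space, 'd::finite) riem \<Rightarrow> ('k, 'y::topological_space, 'n::finite) riem \<Rightarrow> ('m \<Rightarrow> 'y) \<Rightarrow> bool" where
  "smooth_map M N f \<longleftrightarrow>
     continuous_on UNIV f \<and>
     (\<forall>i k. smooth_on (cmap M i ` (cdom M i \<inter> f -` cdom N k)) (\<lambda>x. cmap N k (f (cpar M i x))))"

definition df ::
    "('i, 'm, 'd::finite) riem \<Rightarrow> ('k, 'y, 'n::finite) riem \<Rightarrow> ('m \<Rightarrow> 'y) \<Rightarrow> 'i \<Rightarrow> 'k \<Rightarrow> 'm \<Rightarrow> real ^ 'd \<Rightarrow> real ^ 'n" where
  "df M N f i k p X = dirder M UNIV i (\<lambda>q. cmap N k (f q)) p X"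

text \<open>$(\nabla_X df)(Y) = \nabla_X(df(Y)) - df(\nabla_X Y)$ with the pull-back connection in the first
  term, evaluated on the extension of \<open>Y\<close> with constant components in the chart \<open>i\<close>.\<close>

definition nabla_df ::
    "('i, 'm, 'd::finite) riem \<Rightarrow> ('k, 'y, 'n::finite) riem \<Rightarrow> ('m \<Rightarrow> 'y) \<Rightarrow> 'i \<Rightarrow> 'k \<Rightarrow> 'm \<Rightarrow> real ^ 'd \<Rightarrow> real ^ 'd \<Rightarrow> real ^ 'n" where
  "nabla_df M N f i k p X Y =
     (dirder M UNIV i (\<lambda>q. df M N f i k q Y) p X
        + christoffel N k (f p) (df M N f i k p X) (df M N f i k p Y))
     - df M N f i k p (nabla M UNIV i (\<lambda>_. Y) p X)"

text \<open>Trace with respect to an orthonormal basis \<open>e\<close>.\<close>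

definition tension ::
    "('i, 'm, 'd::finite) riem \<Rightarrow> ('k, 'y, 'n::finite) riem \<Rightarrow> ('m \<Rightarrow> 'y) \<Rightarrow> 'i \<Rightarrow> 'k \<Rightarrow> 'm \<Rightarrow> ('d \<Rightarrow> real ^ 'd) \<Rightarrow> real ^ 'n" where
  "tension M N f i k p e = (\<Sum>a\<in>UNIV. nabla_df M N f i k p (e a) (e a))"

definition harmonic_map ::
    "('i, 'm::topological_space, 'd::finite) riem \<Rightarrow> ('k, 'y::topological_space, 'n::finite) riem \<Rightarrow> ('m \<Rightarrow> 'y) \<Rightarrow> bool" where
  "harmonic_map M N f \<longleftrightarrow>
     smooth_map M N f \<and>
     (\<forall>i k. \<forall>p\<in>cdom M i \<inter> f -` cdom N k. \<forall>e. orthonormal M i p e \<longrightarrow> tension M N f i k p e = 0)"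

definition neumann_condition ::
    "('i, 'm, 2) riem \<Rightarrow> ('k, 'y, 'n::finite) riem \<Rightarrow> ('m \<Rightarrow> 'y) \<Rightarrow> bool" where
  "neumann_condition M N f \<longleftrightarrow>
     (\<forall>i k. \<forall>p\<in>boundary M \<inter> cdom M i \<inter> f -` cdom N k. df M N f i k p (inner_normal M i p) = 0)"


section \<open>Spinors along a map\<close>

text \<open>An element of the fibre of \<open>\<Sigma>M \<otimes> f\<^sup>*TN\<close> is, in a chart \<open>k\<close> of \<open>N\<close> with coordinate vector
  fields $\partial_a$, a sum $\sum_a s_a \otimes \partial_a$, represented by the vector of the
  $s_a$.\<close>

definition tens :: "complex ^ 2 \<Rightarrow> real ^ 'n::finite \<Rightarrow> complex ^ 2 ^ 'n" where
  "tens s Y = (\<chi> a. (Y $ a) *\<^sub>R s)"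

definition tens_map ::
    "(complex ^ 2 \<Rightarrow> complex ^ 2) \<Rightarrow> (real ^ 'n::finite \<Rightarrow> real ^ 'n) \<Rightarrow> complex ^ 2 ^ 'n \<Rightarrow> complex ^ 2 ^ 'n" where
  "tens_map A B \<phi> = (\<Sum>a\<in>UNIV. tens (A (\<phi> $ a)) (B (axis a 1)))"

definition tens_inner ::
    "('k, 'y, 'n::finite) riem \<Rightarrow> 'k \<Rightarrow> 'y \<Rightarrow> complex ^ 2 ^ 'n \<Rightarrow> complex ^ 2 ^ 'n \<Rightarrow> complex" where
  "tens_inner N k y \<phi> \<xi> = (\<Sum>a\<in>UNIV. \<Sum>b\<in>UNIV. of_real (gmat N k y $ a $ b) * cinner (\<phi> $ a) (\<xi> $ b))"

text \<open>Sections are smooth maps \<open>\<phi>\<close> equivariant on the principal bundle, with components \<open>\<phi> u k\<close>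
  in the chart \<open>k\<close> of \<open>N\<close>.\<close>

definition twisted_spinor_field ::
    "('i, 'm::topological_space, 2) riem \<Rightarrow> ('i, 'm, 'p::topological_space) spin \<Rightarrow>
     ('k, 'y::topological_space, 'n::finite) riem \<Rightarrow> ('m \<Rightarrow> 'y) \<Rightarrow> ('p \<Rightarrow> 'k \<Rightarrow> complex ^ 2 ^ 'n) \<Rightarrow> bool" where
  "twisted_spinor_field M S N f \<phi> \<longleftrightarrow>
     (\<forall>u k. \<forall>z\<in>sphere 0 1. f (sproj S u) \<in> cdom N k \<longrightarrow>
        \<phi> (sact S u z) k = tens_map (spin_rep (inverse z)) (\<lambda>Y. Y) (\<phi> u k)) \<and>
     (\<forall>u k l. f (sproj S u) \<in> cdom N k \<inter> cdom N l \<longrightarrow>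
        \<phi> u l = tens_map (\<lambda>s. s) (jac N k l (f (sproj S u))) (\<phi> u k)) \<and>
     (\<forall>U \<sigma> i k. spin_gauge M S U \<sigma> \<longrightarrow>
        smooth_on (cmap M i ` (cdom M i \<inter> U \<inter> f -` cdom N k)) (\<lambda>x. \<phi> (\<sigma> (cpar M i x)) k))"

text \<open>Tensor product of the spin connection and the pull-back of the Levi-Civita connection of \<open>N\<close>.\<close>

definition twisted_nabla ::
    "('i, 'm, 2) riem \<Rightarrow> ('i, 'm, 'p) spin \<Rightarrow> ('k, 'y, 'n::finite) riem \<Rightarrow> ('m \<Rightarrow> 'y) \<Rightarrow>
     'i \<Rightarrow> 'k \<Rightarrow> ('m \<Rightarrow> 'p) \<Rightarrow> ('p \<Rightarrow> 'k \<Rightarrow> complex ^ 2 ^ 'n) \<Rightarrow> 'm \<Rightarrow> real ^ 2 \<Rightarrow> complex ^ 2 ^ 'n" where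
  "twisted_nabla M S N f i k \<sigma> \<phi> p X =
     (\<chi> a. spin_nabla M S i \<sigma> (\<lambda>u. \<phi> u k $ a) p X) +
     tens_map (\<lambda>s. s) (christoffel N k (f p) (df M N f i k p X)) (\<phi> (\<sigma> p) k)"

definition twisted_dirac ::
    "('i, 'm, 2) riem \<Rightarrow> ('i, 'm, 'p) spin \<Rightarrow> ('k, 'y, 'n::finite) riem \<Rightarrow> ('m \<Rightarrow> 'y) \<Rightarrow>
     'i \<Rightarrow> 'k \<Rightarrow> ('m \<Rightarrow> 'p) \<Rightarrow> ('p \<Rightarrow> 'k \<Rightarrow> complex ^ 2 ^ 'n) \<Rightarrow> 'm \<Rightarrow> (2 \<Rightarrow> real ^ 2) \<Rightarrow> complex ^ 2 ^ 'n" where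
  "twisted_dirac M S N f i k \<sigma> \<phi> p e =
     (\<Sum>j\<in>UNIV. tens_map (clifford M S i (\<sigma> p) (e j)) (\<lambda>Y. Y) (twisted_nabla M S N f i k \<sigma> \<phi> p (e j)))"

text \<open>The vector $V_\phi$. The sum on the right is real, as Clifford multiplication and the
  curvature endomorphisms are both skew.\<close>

definition V_field ::
    "('i, 'm, 2) riem \<Rightarrow> ('i, 'm, 'p) spin \<Rightarrow> ('k, 'y, 'n::finite) riem \<Rightarrow> ('m \<Rightarrow> 'y) \<Rightarrow>
     'i \<Rightarrow> 'k \<Rightarrow> ('p \<Rightarrow> 'k \<Rightarrow> complex ^ 2 ^ 'n) \<Rightarrow> 'p \<Rightarrow> (2 \<Rightarrow> real ^ 2) \<Rightarrow> real ^ 'n" where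
  "V_field M S N f i k \<phi> u e =
     (let p = sproj S u in
      THE V. \<forall>Y. of_real (gip N k (f p) V Y) =
        (\<Sum>j\<in>UNIV. tens_inner N k (f p)
           (tens_map (clifford M S i u (e j)) (curvature N k (f p) (df M N f i k p (e j)) Y) (\<phi> u k)) (\<phi> u k)))"

definition dirac_harmonic_map ::
    "('i, 'm::topological_space, 2) riem \<Rightarrow> ('i, 'm, 'p::topological_space) spin \<Rightarrow>
     ('k, 'y::topological_space, 'n::finite) riem \<Rightarrow> ('m \<Rightarrow> 'y) \<Rightarrow> ('p \<Rightarrow> 'k \<Rightarrow> complex ^ 2 ^ 'n) \<Rightarrow> bool" where
  "dirac_harmonic_map M S N f \<phi> \<longleftrightarrow>
     smooth_map M N f \<and> twisted_spinor_field M S N f \<phi> \<and>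
     (\<forall>U \<sigma> i k. spin_gauge M S U \<sigma> \<longrightarrow> (\<forall>p\<in>cdom M i \<inter> U \<inter> f -` cdom N k. \<forall>e.
        orthonormal M i p e \<longrightarrow> twisted_dirac M S N f i k \<sigma> \<phi> p e = 0)) \<and>
     (\<forall>u i k e. sproj S u \<in> cdom M i \<and> f (sproj S u) \<in> cdom N k \<and> orthonormal M i (sproj S u) e \<longrightarrow>
        tension M N f i k (sproj S u) e = (1/2) *\<^sub>R V_field M S N f i k \<phi> u e)"

text \<open>$i\nu\cdot\psi = c\,\psi$ at the boundary point \<open>p\<close>, respectively $i\nu\cdot\phi = c\,\phi$ on the
  boundary.\<close>

definition mit_spinor_at ::
    "('i, 'm, 2) riem \<Rightarrow> ('i, 'm, 'p) spin \<Rightarrow> complex \<Rightarrow> ('p \<Rightarrow> complex ^ 2) \<Rightarrow> 'm \<Rightarrow> bool" where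
  "mit_spinor_at M S c \<psi> p \<longleftrightarrow>
     (\<forall>u i. sproj S u = p \<and> p \<in> cdom M i \<longrightarrow>
        \<i> *s clifford M S i u (inner_normal M i p) (\<psi> u) = c *s \<psi> u)"

definition mit_condition ::
    "('i, 'm, 2) riem \<Rightarrow> ('i, 'm, 'p) spin \<Rightarrow> ('k, 'y, 'n::finite) riem \<Rightarrow> ('m \<Rightarrow> 'y) \<Rightarrow> complex \<Rightarrow>
     ('p \<Rightarrow> 'k \<Rightarrow> complex ^ 2 ^ 'n) \<Rightarrow> bool" where
  "mit_condition M S N f c \<phi> \<longleftrightarrow>
     (\<forall>u i k. sproj S u \<in> boundary M \<inter> cdom M i \<and> f (sproj S u) \<in> cdom N k \<longrightarrow>
        tens_map (\<lambda>s. \<i> *s clifford M S i u (inner_normal M i (sproj S u)) s) (\<lambda>Y. Y) (\<phi> u k)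
          = (\<chi> a. c *s (\<phi> u k $ a)))"

text \<open>$\sum_j e_j\cdot\psi\otimes f_*(e_j)$ for an orthonormal basis \<open>E p\<close> of the tangent space at
  each point \<open>p\<close>, evaluated in some chart around \<open>p\<close>.\<close>

definition spinor_along_map ::
    "('i, 'm, 2) riem \<Rightarrow> ('i, 'm, 'p) spin \<Rightarrow> ('k, 'y, 'n::finite) riem \<Rightarrow> ('m \<Rightarrow> 'y) \<Rightarrow>
     ('p \<Rightarrow> complex ^ 2) \<Rightarrow> ('m \<Rightarrow> 2 \<Rightarrow> 'i \<Rightarrow> real ^ 2) \<Rightarrow> 'p \<Rightarrow> 'k \<Rightarrow> complex ^ 2 ^ 'n" where
  "spinor_along_map M S N f \<psi> E u k =
     (let p = sproj S u; i = (SOME i. p \<in> cdom M i) in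
      \<Sum>j\<in>UNIV. tens (clifford M S i u (E p j i) (\<psi> u)) (df M N f i k p (E p j i)))"

end

theory Submission
  imports Defs
begin

text \<open>
Write \<open>e\<^sub>1, e\<^sub>2\<close> for a local orthonormal frame and \<open>\<phi> = \<Sum>\<^sub>j e\<^sub>j \<cdot> \<psi> \<otimes> df(e\<^sub>j)\<close>. Three
independent facts make up the statement.

The Dirac equation. The connection form of the frame is skew (\<open>connection_skew\<close>), so the
derivatives of the frame in the two factors of \<open>e\<^sub>j \<cdot> \<psi> \<otimes> df(e\<^sub>j)\<close> cancel and
\<open>\<nabla>\<^sub>X \<phi> = \<Sum>\<^sub>a e\<^sub>a \<cdot> \<nabla>\<^sub>X \<psi> \<otimes> df(e\<^sub>a) + e\<^sub>a \<cdot> \<psi> \<otimes> (\<nabla>\<^sub>X df)(e\<^sub>a)\<close>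
(\<open>twisted_nabla_spinor_along_map\<close>). After Clifford multiplication with \<open>X = e\<^sub>j\<close> and summation,
the first part is \<open>\<alpha> \<Sum>\<^sub>j e\<^sub>j \<cdot> e\<^sub>a \<cdot> e\<^sub>j \<cdot> \<psi>\<close> in the spinor factor, which is zero in
dimension two. In the second part the Hessian \<open>\<nabla>df\<close> is symmetric, so only its trace survives,
and that is zero because \<open>f\<close> is harmonic (\<open>gamma_contraction\<close>).

The equation for \<open>f\<close>. As the tension field vanishes, \<open>V\<^sub>\<phi> = 0\<close> has to be shown. The curvature
endomorphisms of \<open>N\<close> are skew (\<open>curvature_skew\<close>), so only the part of
\<open>\<langle>e\<^sub>j \<cdot> e\<^sub>a \<cdot> \<psi>, e\<^sub>b \<cdot> \<psi>\<rangle>\<close> antisymmetric in \<open>a, b\<close> enters, and by the Clifford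
relations there is none in dimension two (\<open>V_field_spinor_along_map\<close>).

The boundary condition. The function \<open>|\<psi>|\<^sup>2 - \<langle>i \<nu> \<cdot> \<psi>, \<psi>\<rangle>\<close> on the boundary is half the
squared norm of \<open>i \<nu> \<cdot> \<psi> - \<psi>\<close>. The Killing equation and \<open>\<nabla>\<^sub>X \<nu> = - 2i\<alpha> X\<close> make its
derivative along the boundary vanish (\<open>has_chart_derivative_mit_defect\<close>), so on a connected
boundary it is zero everywhere once it is zero somewhere (\<open>mit_spinor_boundary\<close>). With the
Neumann condition, \<open>\<phi> = \<tau> \<cdot> \<psi> \<otimes> df(\<tau>)\<close> for a unit tangent vector \<open>\<tau>\<close> of the boundary,
and \<open>\<nu>\<close> anticommutes with \<open>\<tau>\<close>, which turns the eigenvalue 1 into -1.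

All tensor calculus is carried out in charts. At the boundary this needs derivatives within
relatively open subsets of a half-plane to be unique and second derivatives there to be symmetric;
both hold because such a set contains, at each of its points and for all directions \<open>u, v\<close>, a
small parallelogram spanned by multiples of \<open>\<plusminus>u\<close> and \<open>\<plusminus>v\<close>. The boundary and its normal do not
depend on the chart, because the Jacobians of the transition maps are isometries and the charts
take values in the half-plane (\<open>boundary_cmap\<close>, \<open>inner_normal_jac\<close>).
\<close>

section \<open>Calculus on relatively open subsets of half-spaces\<close>

text \<open>The common property of Euclidean spaces and closed half-spaces that makes derivatives within
  relatively open subsets unique and second derivatives symmetric, also at boundary points: up to
  sign, every direction leads into the set.\<close>

definition model_space :: "'a::real_normed_vector set \<Rightarrow> bool" where
  "model_space H \<longleftrightarrow>
     (\<forall>v. (\<forall>x\<in>H. \<forall>t\<ge>0. x + t *\<^sub>R v \<in> H) \<or> (\<forall>x\<in>H. \<forall>t\<ge>0. x + t *\<^sub>R (- v) \<in> H))"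

lemma model_space_UNIV: "model_space UNIV"
  by (simp add: model_space_def)

lemma model_space_half_plane: "model_space half_plane"
proof -
  have "(\<forall>x\<in>half_plane. \<forall>t\<ge>0. x + t *\<^sub>R v \<in> half_plane) \<or>
      (\<forall>x\<in>half_plane. \<forall>t\<ge>0. x + t *\<^sub>R (- v) \<in> half_plane)" for v :: "real ^ 2"
    by (cases "v $ 2 \<ge> 0") (auto simp: half_plane_def mult_nonneg_nonpos algebra_simps intro: order_trans[of _ 0])
  then show ?thesis
    by (simp add: model_space_def)
qed

lemma openin_ball_subset:
  assumes "openin (top_of_set H) S" "x \<in> S"
  obtains e where "e > 0" "\<And>y. y \<in> H \<Longrightarrow> dist y x < e \<Longrightarrow> y \<in> S"
  using assms by (metis openin_euclidean_subtopology_iff dist_commute)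

lemma has_derivative_unique_model:
  fixes F :: "'a::euclidean_space \<Rightarrow> 'b::real_normed_vector"
  assumes "model_space H" "openin (top_of_set H) S" "x \<in> S"
    and "(F has_derivative D) (at x within S)" "(F has_derivative D') (at x within S)"
  shows "D = D'"
proof (rule frechet_derivative_unique_within[OF assms(4,5)])
  fix i :: 'a and e :: real
  assume i: "i \<in> Basis" and e: "e > 0"
  obtain r where r: "r > 0" "\<And>y. y \<in> H \<Longrightarrow> dist y x < r \<Longrightarrow> y \<in> S"
    using openin_ball_subset[OF assms(2,3)] by metis
  have x: "x \<in> H"
    using assms(2,3) openin_imp_subset by blast
  define t where "t = min e r / 2"
  have t: "t > 0" "t < e" "t < r"
    using e r(1) by (auto simp: t_def)
  have "x + t *\<^sub>R i \<in> H \<or> x + (- t) *\<^sub>R i \<in> H"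
    using assms(1) x t(1) unfolding model_space_def by (metis less_imp_le scaleR_minus_left scaleR_minus_right)
  then have "x + t *\<^sub>R i \<in> S \<or> x + (- t) *\<^sub>R i \<in> S"
    using r(2) t i by (auto simp: dist_norm)
  then show "\<exists>d. 0 < \<bar>d\<bar> \<and> \<bar>d\<bar> < e \<and> x + d *\<^sub>R i \<in> S"
    using t by (metis abs_minus_cancel abs_of_pos)
qed

lemma frechet_derivative_eq_model:
  fixes F :: "'a::euclidean_space \<Rightarrow> 'b::real_normed_vector"
  assumes "model_space H" "openin (top_of_set H) S" "x \<in> S" "(F has_derivative D) (at x within S)"
  shows "frechet_derivative F (at x within S) = D"
  using assms has_derivative_unique_model
  by (metis differentiableI frechet_derivative_works)

text \<open>Differentiability is local.\<close>

lemma has_derivative_within_openin: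
  assumes "openin (top_of_set S) T" "x \<in> T" "(F has_derivative D) (at x within T)"
  shows "(F has_derivative D) (at x within S)"
proof -
  obtain U where "open U" "T = S \<inter> U"
    using assms(1) by (auto simp: openin_open)
  then have "at x within T = at x within S"
    using assms(2) by (metis IntE at_within_nhd Int_assoc Int_absorb)
  then show ?thesis
    using assms(3) by simp
qed


subsection \<open>Smooth functions\<close>

lemma C_k_on_cong:
  assumes "C_k_on k S F" "\<And>x. x \<in> S \<Longrightarrow> F x = G x"
  shows "C_k_on k S G"
  using assms
proof (induction k arbitrary: F G)
  case 0
  then show ?case
    by (metis C_k_on.simps(1) continuous_on_cong)
next
  case (Suc k)
  then obtain F' where F': "\<And>x. x \<in> S \<Longrightarrow> (F has_derivative F' x) (at x within S)"
      "\<And>v. C_k_on k S (\<lambda>x. F' x v)"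
    unfolding C_k_on.simps(2) by blast
  have "(G has_derivative F' x) (at x within S)" if "x \<in> S" for x
    by (rule has_derivative_transform[OF that _ F'(1)[OF that]]) (simp add: Suc.prems)
  then show ?case
    using F'(2) by auto
qed

lemma C_k_on_subset:
  assumes "C_k_on k S F" "T \<subseteq> S"
  shows "C_k_on k T F"
  using assms
proof (induction k arbitrary: F)
  case 0
  then show ?case
    by (auto intro: continuous_on_subset)
next
  case (Suc k)
  then obtain F' where F': "\<forall>x\<in>S. (F has_derivative F' x) (at x within S)"
      "\<And>v. C_k_on k S (\<lambda>x. F' x v)"
    unfolding C_k_on.simps(2) by blast
  have "\<forall>x\<in>T. (F has_derivative F' x) (at x within T)"
    using F'(1) Suc.prems(2) has_derivative_subset by blast
  then show ?case
    using Suc.IH[OF F'(2) Suc.prems(2)] unfolding C_k_on.simps(2) by blast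
qed

lemma C_k_on_Suc_imp: "C_k_on (Suc k) S F \<Longrightarrow> C_k_on k S F"
proof (induction k arbitrary: F)
  case 0
  then show ?case
    by (auto simp: continuous_on_eq_continuous_within intro: has_derivative_continuous)
next
  case (Suc k)
  then obtain F' where F': "\<forall>x\<in>S. (F has_derivative F' x) (at x within S)"
      "\<And>v. C_k_on (Suc k) S (\<lambda>x. F' x v)"
    using C_k_on.simps(2) by metis
  have "C_k_on k S (\<lambda>x. F' x v)" for v
    using F'(2) by (rule Suc.IH)
  then show ?case
    using F'(1) unfolding C_k_on.simps(2) by blast
qed

lemma C_k_on_linear:
  assumes "bounded_linear L" "C_k_on k S F"
  shows "C_k_on k S (\<lambda>x. L (F x))"
  using assms(2)
proof (induction k arbitrary: F)
  case 0
  then show ?case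
    by (auto intro: bounded_linear.continuous_on[OF assms(1)])
next
  case (Suc k)
  then obtain F' where F': "\<forall>x\<in>S. (F has_derivative F' x) (at x within S)"
      "\<And>v. C_k_on k S (\<lambda>x. F' x v)"
    by auto
  have "\<forall>x\<in>S. ((\<lambda>x. L (F x)) has_derivative (\<lambda>v. L (F' x v))) (at x within S)"
    using F'(1) bounded_linear.has_derivative[OF assms(1)] by blast
  then show ?case
    using Suc.IH[OF F'(2)] unfolding C_k_on.simps(2) by (intro exI[of _ "\<lambda>x v. L (F' x v)"]) simp
qed

lemma C_k_on_add:
  assumes "C_k_on k S F" "C_k_on k S G"
  shows "C_k_on k S (\<lambda>x. F x + G x)"
  using assms
proof (induction k arbitrary: F G)
  case 0
  then show ?case
    by (auto intro: continuous_on_add)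
next
  case (Suc k)
  obtain F' where F': "\<forall>x\<in>S. (F has_derivative F' x) (at x within S)" "\<And>v. C_k_on k S (\<lambda>x. F' x v)"
    using Suc.prems(1) by auto
  obtain G' where G': "\<forall>x\<in>S. (G has_derivative G' x) (at x within S)" "\<And>v. C_k_on k S (\<lambda>x. G' x v)"
    using Suc.prems(2) by auto
  have "\<forall>x\<in>S. ((\<lambda>x. F x + G x) has_derivative (\<lambda>v. F' x v + G' x v)) (at x within S)"
    using F'(1) G'(1) by (auto intro: has_derivative_add)
  then show ?case
    using Suc.IH[OF F'(2) G'(2)] unfolding C_k_on.simps(2)
    by (intro exI[of _ "\<lambda>x v. F' x v + G' x v"]) simp
qed

lemma C_k_on_bilinear:
  assumes "bounded_bilinear B" "C_k_on k S F" "C_k_on k S G"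
  shows "C_k_on k S (\<lambda>x. B (F x) (G x))"
  using assms(2,3)
proof (induction k arbitrary: F G)
  case 0
  then show ?case
    by (auto intro: bounded_bilinear.continuous_on[OF assms(1)])
next
  case (Suc k)
  obtain F' where F': "\<forall>x\<in>S. (F has_derivative F' x) (at x within S)" "\<And>v. C_k_on k S (\<lambda>x. F' x v)"
    using Suc.prems(1) by auto
  obtain G' where G': "\<forall>x\<in>S. (G has_derivative G' x) (at x within S)" "\<And>v. C_k_on k S (\<lambda>x. G' x v)"
    using Suc.prems(2) by auto
  have "\<forall>x\<in>S. ((\<lambda>x. B (F x) (G x)) has_derivative (\<lambda>v. B (F x) (G' x v) + B (F' x v) (G x))) (at x within S)"
    using F'(1) G'(1) bounded_bilinear.FDERIV[OF assms(1)] by blast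
  moreover have "C_k_on k S (\<lambda>x. B (F x) (G' x v) + B (F' x v) (G x))" for v
    using Suc.IH[OF C_k_on_Suc_imp[OF Suc.prems(1)] G'(2)] Suc.IH[OF F'(2) C_k_on_Suc_imp[OF Suc.prems(2)]]
    by (rule C_k_on_add)
  ultimately show ?case
    unfolding C_k_on.simps(2) by (intro exI[of _ "\<lambda>x v. B (F x) (G' x v) + B (F' x v) (G x)"]) simp
qed

lemma C_k_on_const: "C_k_on k S (\<lambda>_. c)"
proof (induction k arbitrary: c)
  case (Suc k)
  then show ?case
    by (auto intro!: exI[of _ "\<lambda>_ _. 0"])
qed simp

lemma smooth_on_cong: "smooth_on S F \<Longrightarrow> (\<And>x. x \<in> S \<Longrightarrow> F x = G x) \<Longrightarrow> smooth_on S G"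
  unfolding smooth_on_def by (metis C_k_on_cong)

lemma smooth_on_subset: "smooth_on S F \<Longrightarrow> T \<subseteq> S \<Longrightarrow> smooth_on T F"
  unfolding smooth_on_def by (metis C_k_on_subset)

lemma smooth_on_linear: "bounded_linear L \<Longrightarrow> smooth_on S F \<Longrightarrow> smooth_on S (\<lambda>x. L (F x))"
  unfolding smooth_on_def by (metis C_k_on_linear)

lemma smooth_on_bilinear:
  "bounded_bilinear B \<Longrightarrow> smooth_on S F \<Longrightarrow> smooth_on S G \<Longrightarrow> smooth_on S (\<lambda>x. B (F x) (G x))"
  unfolding smooth_on_def by (metis C_k_on_bilinear)

lemma smooth_on_sum: "(\<And>a. a \<in> A \<Longrightarrow> smooth_on S (F a)) \<Longrightarrow> smooth_on S (\<lambda>x. \<Sum>a\<in>A. F a x)"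
  unfolding smooth_on_def
  by (induction A rule: infinite_finite_induct) (auto intro: C_k_on_const C_k_on_add)

lemma smooth_on_imp_continuous_on: "smooth_on S F \<Longrightarrow> continuous_on S F"
  unfolding smooth_on_def by (metis C_k_on.simps(1))

text \<open>The witnesses for the derivative in the definition of \<open>C_k_on\<close> may depend on the order; where
  derivatives are unique, they all agree with the Frechet derivative.\<close>

lemma smooth_on_frechet_derivative:
  fixes F :: "'a::euclidean_space \<Rightarrow> 'b::real_normed_vector"
  assumes "model_space H" "openin (top_of_set H) S" "smooth_on S F"
  shows "x \<in> S \<Longrightarrow> (F has_derivative frechet_derivative F (at x within S)) (at x within S)"
    and "smooth_on S (\<lambda>x. frechet_derivative F (at x within S) v)"
proof -
  have F': "\<exists>F'. (\<forall>x\<in>S. (F has_derivative F' x) (at x within S)) \<and> (\<forall>v. C_k_on k S (\<lambda>x. F' x v))" for k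
    using assms(3) unfolding smooth_on_def by (metis C_k_on.simps(2))
  show "(F has_derivative frechet_derivative F (at x within S)) (at x within S)" if "x \<in> S" for x
    using F'[of 0] that by (metis differentiableI frechet_derivative_works)
  show "smooth_on S (\<lambda>x. frechet_derivative F (at x within S) v)"
    unfolding smooth_on_def
  proof
    fix k
    obtain F' where *: "\<forall>x\<in>S. (F has_derivative F' x) (at x within S)" "\<forall>v. C_k_on k S (\<lambda>x. F' x v)"
      using F' by blast
    show "C_k_on k S (\<lambda>x. frechet_derivative F (at x within S) v)"
    proof (rule C_k_on_cong[OF *(2)[rule_format, of v]])
      show "F' x v = frechet_derivative F (at x within S) v" if "x \<in> S" for x
        using frechet_derivative_eq_model[OF assms(1,2) that] *(1) that by metis
    qed
  qed
qed


subsection \<open>Symmetry of second derivatives\<close>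

text \<open>The mean value theorem, used in the direction \<open>u\<close> and then in the direction \<open>v\<close>, expresses
  the second difference of \<open>F\<close> over a small parallelogram through the second derivative.\<close>

lemma second_difference_mean_value:
  fixes F :: "'a::real_normed_vector \<Rightarrow> real"
  assumes t: "t > 0"
    and S: "\<And>a b. 0 \<le> a \<Longrightarrow> a \<le> t \<Longrightarrow> 0 \<le> b \<Longrightarrow> b \<le> t \<Longrightarrow> x + a *\<^sub>R u + b *\<^sub>R v \<in> S"
    and F': "\<And>y. y \<in> S \<Longrightarrow> (F has_derivative F' y) (at y within S)"
    and Fu: "\<And>y. y \<in> S \<Longrightarrow> ((\<lambda>y. F' y u) has_derivative Fu y) (at y within S)"
  shows "\<exists>y\<in>S. dist y x \<le> t * (norm u + norm v) \<and>
    F (x + t *\<^sub>R u + t *\<^sub>R v) - F (x + t *\<^sub>R u) - F (x + t *\<^sub>R v) + F x = t\<^sup>2 * Fu y v"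
proof -
  define h where "h = (\<lambda>a. F (x + a *\<^sub>R u + t *\<^sub>R v) - F (x + a *\<^sub>R u + 0 *\<^sub>R v))"
  have lin: "linear (F' y)" "linear (Fu y)" if "y \<in> S" for y
    using F'[OF that] Fu[OF that] by (auto intro: has_derivative_linear)
  have h: "(h has_derivative (\<lambda>s. s * (F' (x + a *\<^sub>R u + t *\<^sub>R v) u - F' (x + a *\<^sub>R u + 0 *\<^sub>R v) u)))
      (at a within {0..t})" if a: "0 \<le> a" "a \<le> t" for a
  proof -
    have 1: "((\<lambda>a. F (x + a *\<^sub>R u + b *\<^sub>R v)) has_derivative (\<lambda>s. F' (x + a *\<^sub>R u + b *\<^sub>R v) (s *\<^sub>R u)))
        (at a within {0..t})" if b: "0 \<le> b" "b \<le> t" for b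
    proof (rule has_derivative_in_compose2[where g' = F' and t = S])
      show "((\<lambda>a. x + a *\<^sub>R u + b *\<^sub>R v) has_derivative (\<lambda>s. s *\<^sub>R u)) (at a within {0..t})"
        by (auto intro!: derivative_eq_intros)
    qed (use F' S a b in auto)
    have "(h has_derivative (\<lambda>s. F' (x + a *\<^sub>R u + t *\<^sub>R v) (s *\<^sub>R u) - F' (x + a *\<^sub>R u + 0 *\<^sub>R v) (s *\<^sub>R u)))
        (at a within {0..t})"
      unfolding h_def by (rule has_derivative_diff[OF 1 1]) (use t in auto)
    moreover have "x + a *\<^sub>R u + t *\<^sub>R v \<in> S" "x + a *\<^sub>R u + 0 *\<^sub>R v \<in> S"
      using S[of a t] S[of a 0] a t by auto
    ultimately show ?thesis
      by (simp add: linear_cmul[OF lin(1)] right_diff_distrib)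
  qed
  obtain a where a: "a \<in> {0<..<t}"
      "h t - h 0 = (t - 0) * (F' (x + a *\<^sub>R u + t *\<^sub>R v) u - F' (x + a *\<^sub>R u + 0 *\<^sub>R v) u)"
    using mvt_simple[OF t, of h, OF h] by auto
  have "((\<lambda>b. F' (x + a *\<^sub>R u + b *\<^sub>R v) u) has_derivative (\<lambda>s. s * Fu (x + a *\<^sub>R u + b *\<^sub>R v) v))
      (at b within {0..t})" if b: "0 \<le> b" "b \<le> t" for b
  proof -
    have "((\<lambda>b. F' (x + a *\<^sub>R u + b *\<^sub>R v) u) has_derivative (\<lambda>s. Fu (x + a *\<^sub>R u + b *\<^sub>R v) (s *\<^sub>R v)))
        (at b within {0..t})"
    proof (rule has_derivative_in_compose2[where g' = Fu and t = S])
      show "((\<lambda>b. x + a *\<^sub>R u + b *\<^sub>R v) has_derivative (\<lambda>s. s *\<^sub>R v)) (at b within {0..t})"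
        by (auto intro!: derivative_eq_intros)
    qed (use Fu S a b in auto)
    moreover have "x + a *\<^sub>R u + b *\<^sub>R v \<in> S"
      using S[of a b] a b by auto
    ultimately show ?thesis
      by (simp add: linear_cmul[OF lin(2)])
  qed
  from mvt_simple[OF t this] obtain b where b: "b \<in> {0<..<t}"
      "F' (x + a *\<^sub>R u + t *\<^sub>R v) u - F' (x + a *\<^sub>R u + 0 *\<^sub>R v) u = (t - 0) * Fu (x + a *\<^sub>R u + b *\<^sub>R v) v"
    by auto
  have "dist (x + a *\<^sub>R u + b *\<^sub>R v) x \<le> a * norm u + b * norm v"
    using a(1) b(1) norm_triangle_ineq[of "a *\<^sub>R u" "b *\<^sub>R v"] by (simp add: dist_norm)
  also have "\<dots> \<le> t * norm u + t * norm v"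
    using a(1) b(1) by (intro add_mono mult_right_mono) auto
  finally have "dist (x + a *\<^sub>R u + b *\<^sub>R v) x \<le> t * (norm u + norm v)"
    by (simp add: distrib_left)
  moreover have "F (x + t *\<^sub>R u + t *\<^sub>R v) - F (x + t *\<^sub>R u) - F (x + t *\<^sub>R v) + F x = h t - h 0"
    by (simp add: h_def)
  ultimately show ?thesis
    using a b S[of a b] by (intro bexI[of _ "x + a *\<^sub>R u + b *\<^sub>R v"]) (auto simp: power2_eq_square)
qed

lemma second_derivative_symmetric_parallelogram:
  fixes F :: "'a::real_normed_vector \<Rightarrow> real"
  assumes r: "r > 0"
    and S: "\<And>a b. 0 \<le> a \<Longrightarrow> a < r \<Longrightarrow> 0 \<le> b \<Longrightarrow> b < r \<Longrightarrow> x + a *\<^sub>R u + b *\<^sub>R v \<in> S"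
    and F': "\<And>y. y \<in> S \<Longrightarrow> (F has_derivative F' y) (at y within S)"
    and Fu: "\<And>y. y \<in> S \<Longrightarrow> ((\<lambda>y. F' y u) has_derivative Fu y) (at y within S)"
    and Fv: "\<And>y. y \<in> S \<Longrightarrow> ((\<lambda>y. F' y v) has_derivative Fv y) (at y within S)"
    and cont: "continuous_on S (\<lambda>y. Fu y v)" "continuous_on S (\<lambda>y. Fv y u)"
  shows "Fu x v = Fv x u"
proof (rule ccontr)
  assume "Fu x v \<noteq> Fv x u"
  define e where "e = \<bar>Fu x v - Fv x u\<bar> / 2"
  have e: "e > 0"
    using \<open>Fu x v \<noteq> Fv x u\<close> by (simp add: e_def)
  have x: "x \<in> S"
    using S[of 0 0] r by simp
  obtain d1 where d1: "d1 > 0" "\<And>y. y \<in> S \<Longrightarrow> dist y x < d1 \<Longrightarrow> \<bar>Fu y v - Fu x v\<bar> < e"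
    using cont(1) x e unfolding continuous_on_iff dist_real_def by metis
  obtain d2 where d2: "d2 > 0" "\<And>y. y \<in> S \<Longrightarrow> dist y x < d2 \<Longrightarrow> \<bar>Fv y u - Fv x u\<bar> < e"
    using cont(2) x e unfolding continuous_on_iff dist_real_def by metis
  define K where "K = norm u + norm v + 1"
  define t where "t = min (r / 2) (min d1 d2 / (2 * K))"
  have K: "K > 0"
    unfolding K_def by (smt (verit) norm_ge_zero)
  have t: "t > 0" "t < r"
    using r d1(1) d2(1) K by (auto simp: t_def)
  have "t * (norm u + norm v) < t * K"
    using t(1) by (simp add: K_def)
  also have "\<dots> \<le> min d1 d2 / 2"
    using K mult_right_mono[of t "min d1 d2 / (2 * K)" K] by (simp add: t_def field_simps)
  finally have tK: "t * (norm u + norm v) < d1" "t * (norm u + norm v) < d2"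
    using d1(1) d2(1) by auto
  obtain y where y: "y \<in> S" "dist y x \<le> t * (norm u + norm v)"
      "F (x + t *\<^sub>R u + t *\<^sub>R v) - F (x + t *\<^sub>R u) - F (x + t *\<^sub>R v) + F x = t\<^sup>2 * Fu y v"
    using second_difference_mean_value[OF t(1) _ F' Fu, of x v] S t(2) by (meson le_less_trans)
  have S': "x + a *\<^sub>R v + b *\<^sub>R u \<in> S" if "0 \<le> a" "a \<le> t" "0 \<le> b" "b \<le> t" for a b
    using S[of b a] that t(2) by (simp add: ac_simps)
  obtain z where z: "z \<in> S" "dist z x \<le> t * (norm v + norm u)"
      "F (x + t *\<^sub>R v + t *\<^sub>R u) - F (x + t *\<^sub>R v) - F (x + t *\<^sub>R u) + F x = t\<^sup>2 * Fv z u"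
    using second_difference_mean_value[OF t(1) S' F' Fv] by blast
  have "t\<^sup>2 * Fu y v = t\<^sup>2 * Fv z u"
    using y(3) z(3) by (simp add: add.commute add.left_commute algebra_simps)
  then have "Fu y v = Fv z u"
    using t(1) by simp
  moreover have "\<bar>Fu y v - Fu x v\<bar> < e" "\<bar>Fv z u - Fv x u\<bar> < e"
    using d1(2)[OF y(1)] d2(2)[OF z(1)] y(2) z(2) tK by (auto simp: add.commute)
  ultimately show False
    unfolding e_def by argo
qed

lemma smooth_on_second_derivative_symmetric:
  fixes F :: "'a::euclidean_space \<Rightarrow> 'b::euclidean_space"
  assumes H: "model_space H" and S: "openin (top_of_set H) S" and F: "smooth_on S F" and x: "x \<in> S"
  shows "frechet_derivative (\<lambda>y. frechet_derivative F (at y within S) u) (at x within S) v =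
    frechet_derivative (\<lambda>y. frechet_derivative F (at y within S) v) (at x within S) u"
proof -
  define F' where "F' = (\<lambda>y. frechet_derivative F (at y within S))"
  define F2 where "F2 = (\<lambda>u y. frechet_derivative (\<lambda>y. F' y u) (at y within S))"
  have F': "(F has_derivative F' y) (at y within S)" if "y \<in> S" for y
    unfolding F'_def using smooth_on_frechet_derivative(1)[OF H S F that] .
  have F's: "smooth_on S (\<lambda>y. F' y u)" for u
    unfolding F'_def using smooth_on_frechet_derivative(2)[OF H S F] .
  have F2: "((\<lambda>y. F' y u) has_derivative F2 u y) (at y within S)" if "y \<in> S" for y u
    unfolding F2_def using smooth_on_frechet_derivative(1)[OF H S F's that] .
  have F2c: "continuous_on S (\<lambda>y. F2 u y v)" for u v
    unfolding F2_def using smooth_on_frechet_derivative(2)[OF H S F's] by (rule smooth_on_imp_continuous_on)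
  have lin: "linear (F' y)" "linear (F2 u y)" if "y \<in> S" for y u
    using F'[OF that] F2[OF that] by (auto intro: has_derivative_linear)
  have neg1: "F2 u x (- v) = - F2 u x v" for u v
    using lin(2)[OF x] by (rule linear_neg)
  have neg2: "F2 (- u) x v = - F2 u x v" for u v
  proof -
    have "((\<lambda>y. F' y (- u)) has_derivative (\<lambda>v. - F2 u x v)) (at x within S)"
      by (rule has_derivative_transform[OF x _ has_derivative_minus[OF F2[OF x]]]) (simp add: linear_neg[OF lin(1)])
    then have "F2 (- u) x = (\<lambda>v. - F2 u x v)"
      by (rule has_derivative_unique_model[OF H S x F2[OF x]])
    then show ?thesis
      by simp
  qed
  \<comment> \<open>If \<open>u\<close> and \<open>v\<close> do not leave \<open>H\<close>, small parallelograms at \<open>x\<close> lie in \<open>S\<close>.\<close>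
  have sym: "F2 u x v = F2 v x u"
    if u: "\<And>y t. y \<in> H \<Longrightarrow> t \<ge> 0 \<Longrightarrow> y + t *\<^sub>R u \<in> H" and v: "\<And>y t. y \<in> H \<Longrightarrow> t \<ge> 0 \<Longrightarrow> y + t *\<^sub>R v \<in> H"
    for u v
  proof -
    obtain r where r: "r > 0" "\<And>y. y \<in> H \<Longrightarrow> dist y x < r \<Longrightarrow> y \<in> S"
      using openin_ball_subset[OF S x] by metis
    define K where "K = norm u + norm v + 1"
    have K: "K > 0"
      unfolding K_def by (smt (verit) norm_ge_zero)
    have inS: "x + a *\<^sub>R u + b *\<^sub>R v \<in> S" if ab: "0 \<le> a" "a < r / K" "0 \<le> b" "b < r / K" for a b
    proof (rule r(2))
      show "x + a *\<^sub>R u + b *\<^sub>R v \<in> H"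
        using u v ab S x openin_imp_subset by blast
      have "dist (x + a *\<^sub>R u + b *\<^sub>R v) x \<le> a * norm u + b * norm v"
        using ab norm_triangle_ineq[of "a *\<^sub>R u" "b *\<^sub>R v"] by (simp add: dist_norm)
      also have "\<dots> \<le> r / K * norm u + r / K * norm v"
        using ab by (intro add_mono mult_right_mono) auto
      also have "\<dots> < r / K * K"
        using r(1) K by (simp add: K_def distrib_left)
      finally show "dist (x + a *\<^sub>R u + b *\<^sub>R v) x < r"
        using K by simp
    qed
    show ?thesis
    proof (rule euclidean_eqI)
      fix c :: 'b
      show "F2 u x v \<bullet> c = F2 v x u \<bullet> c"
      proof (rule second_derivative_symmetric_parallelogram[where F = "\<lambda>y. F y \<bullet> c" and F' = "\<lambda>y w. F' y w \<bullet> c"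
            and r = "r / K" and S = S and Fu = "\<lambda>y w. F2 u y w \<bullet> c" and Fv = "\<lambda>y w. F2 v y w \<bullet> c"])
        show "continuous_on S (\<lambda>y. F2 u y v \<bullet> c)" "continuous_on S (\<lambda>y. F2 v y u \<bullet> c)"
          by (rule continuous_on_inner[OF F2c continuous_on_const])+
        show "0 < r / K"
          using r(1) K by simp
        show "((\<lambda>y. F y \<bullet> c) has_derivative (\<lambda>w. F' y w \<bullet> c)) (at y within S)" if "y \<in> S" for y
          by (rule bounded_linear.has_derivative[OF bounded_linear_inner_left F'[OF that]])
        show "((\<lambda>y. F' y u \<bullet> c) has_derivative (\<lambda>w. F2 u y w \<bullet> c)) (at y within S)"
            "((\<lambda>y. F' y v \<bullet> c) has_derivative (\<lambda>w. F2 v y w \<bullet> c)) (at y within S)" if "y \<in> S" for y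
          by (rule bounded_linear.has_derivative[OF bounded_linear_inner_left F2[OF that]])+
      qed (rule inS)
    qed
  qed
  have "F2 u x v = F2 v x u"
  proof -
    obtain a where a: "a = 1 \<or> a = -(1::real)" "\<And>y t. y \<in> H \<Longrightarrow> t \<ge> 0 \<Longrightarrow> y + t *\<^sub>R (a *\<^sub>R u) \<in> H"
      using H unfolding model_space_def by (metis scaleR_one scaleR_minus1_left)
    obtain b where b: "b = 1 \<or> b = -(1::real)" "\<And>y t. y \<in> H \<Longrightarrow> t \<ge> 0 \<Longrightarrow> y + t *\<^sub>R (b *\<^sub>R v) \<in> H"
      using H unfolding model_space_def by (metis scaleR_one scaleR_minus1_left)
    have "F2 (a *\<^sub>R u) x (b *\<^sub>R v) = F2 (b *\<^sub>R v) x (a *\<^sub>R u)"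
      using a(2) b(2) by (rule sym)
    then show ?thesis
      using a(1) b(1) by (auto simp: neg1 neg2)
  qed
  then show ?thesis
    by (simp add: F2_def F'_def)
qed

section \<open>Riemannian geometry in charts\<close>

text \<open>\<open>D\<close> is the derivative at \<open>p\<close> of the coordinate expression of \<open>F\<close>, restricted to \<open>A\<close>. Unlike
  \<open>dirder\<close>, which picks a derivative, this asserts differentiability and is stable under the rules
  for \<open>has_derivative\<close>.\<close>

definition has_chart_derivative ::
    "('i, 'm, 'd::finite) riem \<Rightarrow> 'm set \<Rightarrow> 'i \<Rightarrow> ('m \<Rightarrow> 'b::real_normed_vector) \<Rightarrow> (real ^ 'd \<Rightarrow> 'b) \<Rightarrow> 'm \<Rightarrow> bool" where
  "has_chart_derivative M A i F D p \<longleftrightarrow>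
     ((F \<circ> cpar M i) has_derivative D) (at (cmap M i p) within cmap M i ` (cdom M i \<inter> A))"

lemma has_chart_derivative_linear_map: "has_chart_derivative M A i F D p \<Longrightarrow> linear D"
  unfolding has_chart_derivative_def by (rule has_derivative_linear)

lemma has_chart_derivative_subset:
  "has_chart_derivative M UNIV i F D p \<Longrightarrow> has_chart_derivative M A i F D p"
  unfolding has_chart_derivative_def by (erule has_derivative_subset) auto

lemma has_chart_derivative_const: "has_chart_derivative M A i (\<lambda>_. c) (\<lambda>_. 0) p"
  by (simp add: has_chart_derivative_def o_def)

lemma has_chart_derivative_compose_linear:
  "bounded_linear L \<Longrightarrow> has_chart_derivative M A i F D p \<Longrightarrow>
    has_chart_derivative M A i (\<lambda>q. L (F q)) (\<lambda>X. L (D X)) p"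
  unfolding has_chart_derivative_def o_def by (rule bounded_linear.has_derivative)

lemma has_chart_derivative_add:
  "has_chart_derivative M A i F D p \<Longrightarrow> has_chart_derivative M A i G D' p \<Longrightarrow>
    has_chart_derivative M A i (\<lambda>q. F q + G q) (\<lambda>X. D X + D' X) p"
  unfolding has_chart_derivative_def o_def by (rule has_derivative_add)

lemma has_chart_derivative_diff:
  "has_chart_derivative M A i F D p \<Longrightarrow> has_chart_derivative M A i G D' p \<Longrightarrow>
    has_chart_derivative M A i (\<lambda>q. F q - G q) (\<lambda>X. D X - D' X) p"
  unfolding has_chart_derivative_def o_def by (rule has_derivative_diff)

lemma has_chart_derivative_sum:
  "(\<And>a. a \<in> B \<Longrightarrow> has_chart_derivative M A i (F a) (D a) p) \<Longrightarrow>
    has_chart_derivative M A i (\<lambda>q. \<Sum>a\<in>B. F a q) (\<lambda>X. \<Sum>a\<in>B. D a X) p"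
  unfolding has_chart_derivative_def o_def by (rule has_derivative_sum)

text \<open>A system of linear equations is solved by Cramer's rule, hence by a differentiable function
  of its coefficients.\<close>

lemma differentiable_det:
  fixes G :: "'a::real_normed_vector \<Rightarrow> real ^ 'n ^ 'n"
  assumes "\<And>a b. (\<lambda>x. G x $ a $ b) differentiable (at x within S)"
  shows "(\<lambda>x. det (G x)) differentiable (at x within S)"
proof -
  have prod: "(\<lambda>x. \<Prod>a\<in>I. G x $ a $ \<sigma> a) differentiable (at x within S)" for \<sigma> and I :: "'n set"
    by (induction I rule: infinite_finite_induct) (auto intro: differentiable_mult assms)
  show ?thesis
    unfolding det_def by (intro differentiable_sum ballI differentiable_mult prod differentiable_const finite_permutations) auto
qed

lemma matrix_inv_right: "invertible A \<Longrightarrow> A ** matrix_inv A = mat 1"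
  unfolding invertible_def matrix_inv_def by (rule someI2_ex) auto

lemma differentiable_matrix_inv_mult:
  fixes G :: "'a::real_normed_vector \<Rightarrow> real ^ 'n ^ 'n" and w :: "'a \<Rightarrow> real ^ 'n"
  assumes G: "G differentiable (at x within S)" and w: "w differentiable (at x within S)"
    and inv: "\<And>y. y \<in> S \<Longrightarrow> invertible (G y)" and x: "x \<in> S"
  shows "(\<lambda>y. matrix_inv (G y) *v w y) differentiable (at x within S)"
proof -
  have Gc: "(\<lambda>y. G y $ a $ b) differentiable (at x within S)" for a b
    using differentiableI[OF bounded_linear.has_derivative[OF bounded_linear_vec_nth
        bounded_linear.has_derivative[OF bounded_linear_vec_nth]]] G
    unfolding differentiable_def[of G] by blast
  have wc: "(\<lambda>y. w y $ a) differentiable (at x within S)" for a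
    using differentiableI[OF bounded_linear.has_derivative[OF bounded_linear_vec_nth]] w
    unfolding differentiable_def[of w] by blast
  define C where "C = (\<lambda>k y. det (\<chi> a b. if b = k then w y $ a else G y $ a $ b) / det (G y))"
  have "C k differentiable (at x within S)" for k
    unfolding C_def
  proof (intro differentiable_divide differentiable_det)
    show "(\<lambda>y. (\<chi> a b. if b = k then w y $ a else G y $ a $ b) $ a $ b) differentiable (at x within S)" for a b
      by (cases "b = k") (simp_all add: Gc wc)
    show "det (G x) \<noteq> 0"
      using inv[OF x] by (simp add: invertible_det_nz)
  qed (rule Gc)
  moreover have eq: "matrix_inv (G y) *v w y = (\<chi> k. C k y)" if "y \<in> S" for y
  proof -
    have "G y *v (matrix_inv (G y) *v w y) = w y"
      by (simp add: matrix_vector_mul_assoc matrix_inv_right[OF inv[OF that]])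
    then show ?thesis
      using inv[OF that] by (simp add: cramer C_def invertible_det_nz)
  qed
  ultimately obtain C' where C': "\<And>k. (C k has_derivative C' k) (at x within S)"
    unfolding differentiable_def by metis
  have 1: "((\<lambda>y. \<Sum>k\<in>UNIV. C k y *\<^sub>R axis k 1) has_derivative (\<lambda>h. \<Sum>k\<in>UNIV. C' k h *\<^sub>R axis k 1)) (at x within S)"
    by (intro has_derivative_sum has_derivative_scaleR_left C')
  have 2: "matrix_inv (G y) *v w y = (\<Sum>k\<in>UNIV. C k y *\<^sub>R axis k 1)" if "y \<in> S" for y
    using basis_expansion[of "matrix_inv (G y) *v w y"] by (simp add: eq[OF that] scalar_mult_eq_scaleR)
  show ?thesis
    by (rule differentiableI[OF has_derivative_transform[OF x 2 1]])
qed

lemma linear_expansion: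
  fixes F :: "real ^ 'n \<Rightarrow> 'b::real_vector"
  assumes "linear F"
  shows "F X = (\<Sum>a\<in>UNIV. X $ a *\<^sub>R F (axis a 1))"
proof -
  have "F (\<Sum>a\<in>UNIV. X $ a *\<^sub>R axis a 1) = (\<Sum>a\<in>UNIV. X $ a *\<^sub>R F (axis a 1))"
    by (simp add: linear_sum[OF assms] linear_cmul[OF assms])
  then show ?thesis
    using basis_expansion[of X] by (simp add: scalar_mult_eq_scaleR)
qed

locale riemannian =
  fixes H :: "(real ^ 'd::finite) set" and M :: "('i, 'm::topological_space, 'd) riem"
  assumes model: "model_space H" and manifold: "riemannian_manifold H M"
begin

lemma chart_around: obtains i where "p \<in> cdom M i"
  using manifold unfolding riemannian_manifold_def smooth_atlas_def by (metis UNIV_I UN_E)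

lemma open_cdom: "open (cdom M i)"
  using manifold unfolding riemannian_manifold_def smooth_atlas_def by metis

lemma chart_homeomorphism: "homeomorphism (cdom M i) (cmap M i ` cdom M i) (cmap M i) (cpar M i)"
  using manifold unfolding riemannian_manifold_def smooth_atlas_def by metis

lemma cpar_cmap [simp]: "p \<in> cdom M i \<Longrightarrow> cpar M i (cmap M i p) = p"
  using chart_homeomorphism[of i] by (simp add: homeomorphism_def)

lemma openin_chart:
  assumes "open V"
  shows "openin (top_of_set H) (cmap M i ` (cdom M i \<inter> V))"
proof -
  have "openin (top_of_set (cmap M i ` cdom M i)) (cmap M i ` (cdom M i \<inter> V))"
    using homeomorphism_imp_open_map[OF chart_homeomorphism] assms by blast
  moreover have "openin (top_of_set H) (cmap M i ` cdom M i)"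
    using manifold unfolding riemannian_manifold_def smooth_atlas_def by metis
  ultimately show ?thesis
    by (rule openin_trans)
qed

lemma openin_chart_image:
  assumes "open V"
  shows "openin (top_of_set (cmap M i ` (cdom M i \<inter> A))) (cmap M i ` (cdom M i \<inter> A \<inter> V))"
proof -
  obtain T where T: "open T" "cmap M i ` (cdom M i \<inter> V) = cmap M i ` cdom M i \<inter> T"
    using homeomorphism_imp_open_map[OF chart_homeomorphism, of i "cdom M i \<inter> V"] assms
    by (auto simp: openin_open)
  have "inj_on (cmap M i) (cdom M i)"
    using cpar_cmap by (metis inj_onI)
  then have "cmap M i ` (cdom M i \<inter> A \<inter> V) = cmap M i ` (cdom M i \<inter> A) \<inter> cmap M i ` (cdom M i \<inter> V)"
    by (auto dest: inj_onD)
  also have "\<dots> = cmap M i ` (cdom M i \<inter> A) \<inter> T"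
    using T(2) by blast
  finally show ?thesis
    using T(1) by (auto simp: openin_open)
qed

lemma has_chart_derivative_transform:
  assumes "has_chart_derivative M A i F D p" "open V" "p \<in> V" "p \<in> cdom M i" "p \<in> A"
    and "\<And>q. q \<in> V \<Longrightarrow> q \<in> cdom M i \<Longrightarrow> q \<in> A \<Longrightarrow> F q = G q"
  shows "has_chart_derivative M A i G D p"
proof -
  let ?T = "cmap M i ` (cdom M i \<inter> A \<inter> V)"
  have p: "cmap M i p \<in> ?T"
    using assms by blast
  have "((F \<circ> cpar M i) has_derivative D) (at (cmap M i p) within ?T)"
    using assms(1) unfolding has_chart_derivative_def by (rule has_derivative_subset) blast
  then have "((G \<circ> cpar M i) has_derivative D) (at (cmap M i p) within ?T)"
    by (rule has_derivative_transform[OF p, rotated]) (auto simp: assms(6))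
  then show ?thesis
    unfolding has_chart_derivative_def by (rule has_derivative_within_openin[OF openin_chart_image[OF assms(2)] p])
qed

lemma dirder_eq:
  assumes "has_chart_derivative M UNIV i F D p" "p \<in> cdom M i"
  shows "dirder M UNIV i F p = D"
proof
  fix X
  have "frechet_derivative (F \<circ> cpar M i) (at (cmap M i p) within cmap M i ` (cdom M i \<inter> UNIV)) = D"
    using assms unfolding has_chart_derivative_def
    by (intro frechet_derivative_eq_model[OF model openin_chart]) auto
  then show "dirder M UNIV i F p X = D X"
    by (simp add: dirder_def)
qed

lemma has_chart_derivative_dirder:
  assumes "has_chart_derivative M UNIV i F D p" "p \<in> cdom M i"
  shows "has_chart_derivative M UNIV i F (dirder M UNIV i F p) p"
  using assms(1) unfolding dirder_eq[OF assms] .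

lemma dirder_transform:
  assumes "has_chart_derivative M UNIV i F D p" "open V" "p \<in> V" "p \<in> cdom M i"
    and "\<And>q. q \<in> V \<Longrightarrow> q \<in> cdom M i \<Longrightarrow> F q = G q"
  shows "dirder M UNIV i G p = D"
  using dirder_eq has_chart_derivative_transform[of UNIV i F D p V G] assms by auto

text \<open>Smoothness on a neighbourhood \<open>V\<close> of \<open>p\<close> suffices for \<open>dirder\<close>, which is taken on the whole
  chart domain, to be the derivative.\<close>

lemma
  assumes "open V" "smooth_on (cmap M i ` (cdom M i \<inter> V)) (\<lambda>x. F (cpar M i x))"
  shows has_chart_derivative_smooth:
      "p \<in> cdom M i \<Longrightarrow> p \<in> V \<Longrightarrow> has_chart_derivative M UNIV i F (dirder M UNIV i F p) p"
    and dirder_eq_frechet_derivative: "p \<in> cdom M i \<Longrightarrow> p \<in> V \<Longrightarrow>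
      dirder M UNIV i F p = frechet_derivative (\<lambda>x. F (cpar M i x)) (at (cmap M i p) within cmap M i ` (cdom M i \<inter> V))"
    and smooth_on_dirder: "smooth_on (cmap M i ` (cdom M i \<inter> V)) (\<lambda>x. dirder M UNIV i F (cpar M i x) v)"
proof -
  let ?S = "cmap M i ` (cdom M i \<inter> V)" and ?G = "\<lambda>x. F (cpar M i x)"
  note S = openin_chart[OF assms(1), of i]
  have *: "has_chart_derivative M UNIV i F (frechet_derivative ?G (at (cmap M i p) within ?S)) p"
    if "p \<in> cdom M i" "p \<in> V" for p
  proof -
    have p: "cmap M i p \<in> ?S"
      using that by blast
    have "?S = cmap M i ` (cdom M i \<inter> UNIV \<inter> V)"
      by simp
    then show ?thesis
      unfolding has_chart_derivative_def o_def
      using has_derivative_within_openin[OF openin_chart_image[OF assms(1), of i UNIV]] p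
        smooth_on_frechet_derivative(1)[OF model S assms(2) p] by simp
  qed
  show eq: "dirder M UNIV i F p = frechet_derivative ?G (at (cmap M i p) within ?S)"
    if "p \<in> cdom M i" "p \<in> V" for p
    using dirder_eq[OF *] that by blast
  show "has_chart_derivative M UNIV i F (dirder M UNIV i F p) p" if "p \<in> cdom M i" "p \<in> V" for p
    unfolding eq[OF that] by (rule *[OF that])
  show "smooth_on ?S (\<lambda>x. dirder M UNIV i F (cpar M i x) v)"
    by (rule smooth_on_cong[OF smooth_on_frechet_derivative(2)[OF model S assms(2), of v]]) (auto simp: eq)
qed

lemma dirder_symmetric:
  fixes F :: "'m \<Rightarrow> 'b::euclidean_space"
  assumes "open V" "smooth_on (cmap M i ` (cdom M i \<inter> V)) (\<lambda>x. F (cpar M i x))" "p \<in> cdom M i" "p \<in> V"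
  shows "dirder M UNIV i (\<lambda>q. dirder M UNIV i F q Y) p X = dirder M UNIV i (\<lambda>q. dirder M UNIV i F q X) p Y"
proof -
  let ?S = "cmap M i ` (cdom M i \<inter> V)" and ?G = "\<lambda>x. F (cpar M i x)"
  note S = openin_chart[OF assms(1), of i]
  note G = smooth_on_frechet_derivative[OF model S assms(2)]
  have p: "cmap M i p \<in> ?S"
    using assms by blast
  have "dirder M UNIV i (\<lambda>q. dirder M UNIV i F q Y) p =
      frechet_derivative (\<lambda>x. frechet_derivative ?G (at x within ?S) Y) (at (cmap M i p) within ?S)" for Y
  proof -
    have "((\<lambda>x. dirder M UNIV i F (cpar M i x) Y) has_derivative
       frechet_derivative (\<lambda>x. frechet_derivative ?G (at x within ?S) Y) (at (cmap M i p) within ?S)) (at (cmap M i p) within ?S)"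
      by (rule has_derivative_transform[OF p _ smooth_on_frechet_derivative(1)[OF model S G(2) p]])
        (auto simp: dirder_eq_frechet_derivative[OF assms(1,2)])
    then have "frechet_derivative (\<lambda>x. dirder M UNIV i F (cpar M i x) Y) (at (cmap M i p) within ?S) =
      frechet_derivative (\<lambda>x. frechet_derivative ?G (at x within ?S) Y) (at (cmap M i p) within ?S)"
      by (rule frechet_derivative_eq_model[OF model S p])
    then show ?thesis
      using dirder_eq_frechet_derivative[OF assms(1) smooth_on_dirder[OF assms(1,2)] assms(3,4), of Y] by simp
  qed
  then show ?thesis
    using smooth_on_second_derivative_symmetric[OF model S assms(2) p] by simp
qed

end


subsection \<open>Chain rule and change of charts\<close>

text \<open>Besides the chain rule for maps between manifolds, this contains the transformation of
  derivatives under a change of charts (the map is the identity).\<close>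

lemma has_chart_derivative_chain:
  assumes "riemannian H M" "riemannian H' N" "continuous_on UNIV f"
    and p: "p \<in> cdom M i" "f p \<in> cdom N k"
    and D: "has_chart_derivative M UNIV i (\<lambda>q. cmap N k (f q)) D p"
    and D': "has_chart_derivative N UNIV k G D' (f p)"
  shows "has_chart_derivative M UNIV i (\<lambda>q. G (f q)) (\<lambda>X. D' (D X)) p"
proof -
  interpret M: riemannian H M by fact
  interpret N: riemannian H' N by fact
  let ?V = "f -` cdom N k"
  have V: "open ?V"
    using assms(3) N.open_cdom by (simp add: continuous_on_open_vimage)
  let ?T = "cmap M i ` (cdom M i \<inter> UNIV \<inter> ?V)"
  have pT: "cmap M i p \<in> ?T"
    using p by blast
  have 1: "(((\<lambda>q. cmap N k (f q)) \<circ> cpar M i) has_derivative D) (at (cmap M i p) within ?T)"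
    using D unfolding has_chart_derivative_def by (rule has_derivative_subset) blast
  have 2: "((G \<circ> cpar N k) has_derivative D') (at (((\<lambda>q. cmap N k (f q)) \<circ> cpar M i) (cmap M i p))
      within ((\<lambda>q. cmap N k (f q)) \<circ> cpar M i) ` ?T)"
  proof -
    have "((\<lambda>q. cmap N k (f q)) \<circ> cpar M i) ` ?T \<subseteq> cmap N k ` (cdom N k \<inter> UNIV)"
      by auto
    then show ?thesis
      using has_derivative_subset[OF D'[unfolded has_chart_derivative_def]] p by simp
  qed
  have "((\<lambda>x. (G \<circ> cpar N k) (((\<lambda>q. cmap N k (f q)) \<circ> cpar M i) x)) has_derivative (\<lambda>X. D' (D X)))
      (at (cmap M i p) within ?T)"
    by (rule has_derivative_in_compose[OF 1 2])
  then have "(((\<lambda>q. G (f q)) \<circ> cpar M i) has_derivative (\<lambda>X. D' (D X))) (at (cmap M i p) within ?T)"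
    by (rule has_derivative_transform[OF pT, rotated]) auto
  then show ?thesis
    unfolding has_chart_derivative_def
    by (rule has_derivative_within_openin[OF M.openin_chart_image[OF V] pT])
qed

context riemannian
begin

lemma has_chart_derivative_jac:
  assumes "p \<in> cdom M i" "p \<in> cdom M j"
  shows "has_chart_derivative M UNIV i (cmap M j) (jac M i j p) p"
proof -
  have "smooth_on (cmap M i ` (cdom M i \<inter> cdom M j)) (\<lambda>x. cmap M j (cpar M i x))"
    using manifold unfolding riemannian_manifold_def smooth_atlas_def o_def by metis
  from has_chart_derivative_smooth[OF open_cdom this assms] show ?thesis
    by (simp add: jac_def[abs_def])
qed

lemma linear_jac: "p \<in> cdom M i \<Longrightarrow> p \<in> cdom M j \<Longrightarrow> linear (jac M i j p)"
  by (rule has_chart_derivative_linear_map[OF has_chart_derivative_jac])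

lemma has_chart_derivative_change_chart:
  assumes "p \<in> cdom M i" "p \<in> cdom M j" "has_chart_derivative M UNIV j F D p"
  shows "has_chart_derivative M UNIV i F (\<lambda>X. D (jac M i j p X)) p"
  using has_chart_derivative_chain[of H M H M "\<lambda>q. q" p i j] has_chart_derivative_jac[OF assms(1,2)] assms
    riemannian_axioms by simp

lemma dirder_change_chart:
  assumes "p \<in> cdom M i" "p \<in> cdom M j" "has_chart_derivative M UNIV j F D p"
  shows "dirder M UNIV i F p X = dirder M UNIV j F p (jac M i j p X)"
  using dirder_eq[OF has_chart_derivative_change_chart[OF assms] assms(1)] dirder_eq[OF assms(3,2)] by simp


subsection \<open>The metric and its connection\<close>

lemma gip_jac: "p \<in> cdom M i \<Longrightarrow> p \<in> cdom M j \<Longrightarrow> gip M j p (jac M i j p X) (jac M i j p Y) = gip M i p X Y"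
  using manifold unfolding riemannian_manifold_def by blast

lemma gip_pos: "p \<in> cdom M i \<Longrightarrow> X \<noteq> 0 \<Longrightarrow> gip M i p X X > 0"
  using manifold unfolding riemannian_manifold_def by blast

lemma gip_add: "gip M i p (X + Y) Z = gip M i p X Z + gip M i p Y Z"
    "gip M i p Z (X + Y) = gip M i p Z X + gip M i p Z Y"
  by (simp_all add: gip_def inner_simps matrix_vector_right_distrib)

lemma gip_scale: "gip M i p (c *\<^sub>R X) Z = c * gip M i p X Z"
    "gip M i p Z (c *\<^sub>R X) = c * gip M i p Z X"
  by (simp_all add: gip_def scalar_mult_eq_scaleR[symmetric] vec.scale)
     (simp_all add: scalar_mult_eq_scaleR)

lemma linear_gip: "linear (gip M i p X)" "linear (\<lambda>X. gip M i p X Y)"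
  by (simp_all add: linear_iff gip_add gip_scale)

lemma gip_minus: "gip M i p (- X) Z = - gip M i p X Z" "gip M i p Z (- X) = - gip M i p Z X"
  using linear_neg[OF linear_gip(1)] linear_neg[OF linear_gip(2)] by auto

lemma gip_diff: "gip M i p (X - Y) Z = gip M i p X Z - gip M i p Y Z"
    "gip M i p Z (X - Y) = gip M i p Z X - gip M i p Z Y"
  using linear_diff[OF linear_gip(1)] linear_diff[OF linear_gip(2)] by auto

lemma gip_sum: "gip M i p (\<Sum>a\<in>A. F a) Z = (\<Sum>a\<in>A. gip M i p (F a) Z)"
    "gip M i p Z (\<Sum>a\<in>A. F a) = (\<Sum>a\<in>A. gip M i p Z (F a))"
  using linear_sum[OF linear_gip(1)] linear_sum[OF linear_gip(2)] by (auto simp: o_def)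

lemma inner_gmat:
  assumes "p \<in> cdom M i"
  shows "X \<bullet> (gmat M i p *v Y) = (gmat M i p *v X) \<bullet> Y"
proof -
  have "transpose (gmat M i p) = gmat M i p"
    using assms manifold unfolding riemannian_manifold_def by blast
  then show ?thesis
    by (metis dot_lmul_matrix transpose_matrix_vector)
qed

lemma gip_commute: "p \<in> cdom M i \<Longrightarrow> gip M i p X Y = gip M i p Y X"
  by (metis gip_def inner_gmat inner_commute)

lemma gip_nondegenerate:
  assumes "p \<in> cdom M i" "\<And>Y. gip M i p X Y = 0"
  shows "X = 0"
  using assms gip_pos[of p i X] by force

lemma jac_inj: "p \<in> cdom M i \<Longrightarrow> p \<in> cdom M j \<Longrightarrow> jac M i j p X = 0 \<Longrightarrow> X = 0"
  using gip_jac[of p i j X X] gip_pos[of p i X] by (force simp: gip_def)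

lemma invertible_gmat:
  assumes "p \<in> cdom M i"
  shows "invertible (gmat M i p)"
proof -
  have "x = 0" if "gmat M i p *v x = 0" for x
    using gip_pos[OF assms, of x] that by (force simp: gip_def)
  then show ?thesis
    by (metis invertible_left_inverse matrix_left_invertible_ker)
qed

lemma gmat_mult_matrix_inv: "p \<in> cdom M i \<Longrightarrow> gmat M i p *v (matrix_inv (gmat M i p) *v w) = w"
  by (simp add: matrix_vector_mul_assoc matrix_inv_right[OF invertible_gmat])

lemma smooth_gmat: "smooth_on (cmap M i ` (cdom M i \<inter> UNIV)) (\<lambda>x. gmat M i (cpar M i x))"
  using manifold unfolding riemannian_manifold_def o_def by simp

text \<open>The derivative \<open>X(g(Y, Z))\<close> for vector fields \<open>Y\<close> and \<open>Z\<close> with constant components.\<close>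

definition dgip :: "'i \<Rightarrow> 'm \<Rightarrow> real ^ 'd \<Rightarrow> real ^ 'd \<Rightarrow> real ^ 'd \<Rightarrow> real" where
  "dgip i p X Y Z = Y \<bullet> (dirder M UNIV i (gmat M i) p X *v Z)"

lemma has_chart_derivative_gmat:
  "p \<in> cdom M i \<Longrightarrow> has_chart_derivative M UNIV i (gmat M i) (dirder M UNIV i (gmat M i) p) p"
  using has_chart_derivative_smooth[OF open_UNIV smooth_gmat] by blast

lemma dirder_gmat_entry:
  assumes "p \<in> cdom M i"
  shows "dirder M UNIV i (\<lambda>q. gmat M i q $ b $ c) p X = dirder M UNIV i (gmat M i) p X $ b $ c"
proof -
  have "bounded_linear (\<lambda>A :: real ^ 'd ^ 'd. A $ b $ c)"
    using bounded_linear_compose[OF bounded_linear_vec_nth bounded_linear_vec_nth] .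
  from has_chart_derivative_compose_linear[OF this has_chart_derivative_gmat[OF assms]]
  show ?thesis
    by (simp add: dirder_eq assms)
qed

lemma dgip_commute:
  assumes "p \<in> cdom M i"
  shows "dgip i p X Y Z = dgip i p X Z Y"
proof -
  have "transpose (gmat M i q) = gmat M i q" if "q \<in> cdom M i" for q
    using that manifold unfolding riemannian_manifold_def by blast
  then have sym: "gmat M i q $ b $ c = gmat M i q $ c $ b" if "q \<in> cdom M i" for q b c
    using that by (simp add: transpose_def vec_eq_iff)
  have *: "has_chart_derivative M UNIV i (\<lambda>q. gmat M i q $ b $ c) (\<lambda>X. dirder M UNIV i (gmat M i) p X $ c $ b) p" for b c
    using has_chart_derivative_transform[OF has_chart_derivative_compose_linear[OF
        bounded_linear_compose[OF bounded_linear_vec_nth bounded_linear_vec_nth] has_chart_derivative_gmat[OF assms]]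
        open_UNIV UNIV_I assms UNIV_I sym] .
  have "dirder M UNIV i (gmat M i) p X $ b $ c = dirder M UNIV i (gmat M i) p X $ c $ b" for b c
    using dirder_gmat_entry[OF assms, of b c X] dirder_eq[OF *[of b c] assms] by simp
  then have "transpose (dirder M UNIV i (gmat M i) p X) = dirder M UNIV i (gmat M i) p X"
    by (simp add: transpose_def vec_eq_iff)
  then have "Y \<bullet> (dirder M UNIV i (gmat M i) p X *v Z) = (dirder M UNIV i (gmat M i) p X *v Y) \<bullet> Z"
    using dot_lmul_matrix[of Y "dirder M UNIV i (gmat M i) p X" Z]
      transpose_matrix_vector[of "dirder M UNIV i (gmat M i) p X" Y] by simp
  then show ?thesis
    by (simp add: dgip_def inner_commute)
qed

lemma dgip_linear: "p \<in> cdom M i \<Longrightarrow> linear (\<lambda>X. dgip i p X Y Z)" "linear (dgip i p X Y)" "linear (\<lambda>Y. dgip i p X Y Z)"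
  using has_chart_derivative_linear_map[OF has_chart_derivative_gmat, of p i]
  by (auto simp: linear_iff dgip_def matrix_vector_right_distrib matrix_vector_mult_add_rdistrib inner_simps
      scaleR_matrix_vector_assoc[symmetric] matrix_vector_mult_scaleR)

text \<open>Lowering the index of the Christoffel symbols gives the Koszul formula for coordinate vector
  fields.\<close>

lemma gip_christoffel:
  assumes p: "p \<in> cdom M i"
  shows "gip M i p (christoffel M i p X Y) Z = (dgip i p X Y Z + dgip i p Y X Z - dgip i p Z X Y) / 2"
proof -
  let ?d = "dgip i p"
  define w where "w = (\<chi> l. (?d X Y (axis l 1) + ?d Y X (axis l 1) - ?d (axis l 1) X Y) / 2)"
  let ?dg = "\<lambda>a b c. dirder M UNIV i (gmat M i) p (axis a 1) $ b $ c"
  have lin: "linear (dirder M UNIV i (gmat M i) p)"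
    using has_chart_derivative_linear_map[OF has_chart_derivative_gmat[OF p]] .
  have dexp: "?d X Y Z = (\<Sum>a\<in>UNIV. \<Sum>b\<in>UNIV. \<Sum>c\<in>UNIV. ?dg a b c * X $ a * Y $ b * Z $ c)" for X Y Z
  proof -
    have "dirder M UNIV i (gmat M i) p X = (\<Sum>a\<in>UNIV. X $ a *\<^sub>R dirder M UNIV i (gmat M i) p (axis a 1))"
      by (rule linear_expansion[OF lin])
    then have "?d X Y Z = (\<Sum>b\<in>UNIV. \<Sum>c\<in>UNIV. \<Sum>a\<in>UNIV. ?dg a b c * X $ a * Y $ b * Z $ c)"
      by (simp add: dgip_def inner_vec_def matrix_vector_mult_def sum_distrib_left sum_distrib_right sum_component
          algebra_simps)
    also have "\<dots> = (\<Sum>b\<in>UNIV. \<Sum>a\<in>UNIV. \<Sum>c\<in>UNIV. ?dg a b c * X $ a * Y $ b * Z $ c)"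
      by (intro sum.cong refl sum.swap)
    also have "\<dots> = (\<Sum>a\<in>UNIV. \<Sum>b\<in>UNIV. \<Sum>c\<in>UNIV. ?dg a b c * X $ a * Y $ b * Z $ c)"
      by (rule sum.swap)
    finally show ?thesis .
  qed
  have w: "w $ l = (\<Sum>a\<in>UNIV. \<Sum>b\<in>UNIV. (1/2) * (?dg a b l + ?dg b a l - ?dg l a b) * X $ a * Y $ b)" for l
  proof -
    have s: "(\<Sum>c\<in>UNIV. F c * axis l 1 $ c) = F l" for F :: "'d \<Rightarrow> real"
      using sum.delta[of "UNIV :: 'd set" l F] by (simp add: axis_def if_distrib eq_commute cong: if_cong)
    have s': "(\<Sum>c\<in>UNIV. F c * axis l 1 $ c * r) = F l * r" for F :: "'d \<Rightarrow> real" and r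
      using s[of "\<lambda>c. F c * r"] by (simp add: ac_simps)
    have 1: "?d X Y (axis l 1) = (\<Sum>a\<in>UNIV. \<Sum>b\<in>UNIV. ?dg a b l * X $ a * Y $ b)"
      unfolding dexp s ..
    have 2: "?d Y X (axis l 1) = (\<Sum>a\<in>UNIV. \<Sum>b\<in>UNIV. ?dg b a l * X $ a * Y $ b)"
      unfolding dexp s by (subst sum.swap) (simp add: ac_simps)
    have 3: "?d (axis l 1) X Y = (\<Sum>a\<in>UNIV. \<Sum>b\<in>UNIV. ?dg l a b * X $ a * Y $ b)"
    proof -
      have "?d (axis l 1) X Y = (\<Sum>a\<in>UNIV. (\<Sum>b\<in>UNIV. \<Sum>c\<in>UNIV. ?dg a b c * X $ b * Y $ c) * axis l 1 $ a)"
        unfolding dexp by (simp add: sum_distrib_right sum_distrib_left ac_simps)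
      then show ?thesis
        unfolding s .
    qed
    have summand: "(1/2) * (r + s - t) * x * y = (r * x * y + s * x * y - t * x * y) / 2" for r s t x y :: real
      by (simp add: field_simps)
    show ?thesis
      unfolding summand sum_divide_distrib[symmetric] sum.distrib sum_subtractf by (simp add: w_def 1 2 3)
  qed
  have "christoffel M i p X Y = matrix_inv (gmat M i p) *v w"
  proof (rule vec_eq_iff[THEN iffD2], rule)
    fix c
    have "(matrix_inv (gmat M i p) *v w) $ c = (\<Sum>l\<in>UNIV. \<Sum>a\<in>UNIV. \<Sum>b\<in>UNIV.
        (1/2) * (matrix_inv (gmat M i p) $ c $ l * (?dg a b l + ?dg b a l - ?dg l a b)) * X $ a * Y $ b)"
      by (simp add: matrix_vector_mult_def w sum_distrib_left mult.assoc mult.left_commute)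
    also have "\<dots> = (\<Sum>a\<in>UNIV. \<Sum>l\<in>UNIV. \<Sum>b\<in>UNIV.
        (1/2) * (matrix_inv (gmat M i p) $ c $ l * (?dg a b l + ?dg b a l - ?dg l a b)) * X $ a * Y $ b)"
      by (rule sum.swap)
    also have "\<dots> = (\<Sum>a\<in>UNIV. \<Sum>b\<in>UNIV. \<Sum>l\<in>UNIV.
        (1/2) * (matrix_inv (gmat M i p) $ c $ l * (?dg a b l + ?dg b a l - ?dg l a b)) * X $ a * Y $ b)"
      by (intro sum.cong refl sum.swap)
    also have "\<dots> = christoffel M i p X Y $ c"
      by (simp add: christoffel_def Let_def dirder_gmat_entry[OF p] sum_distrib_left sum_distrib_right)
    finally show "christoffel M i p X Y $ c = (matrix_inv (gmat M i p) *v w) $ c" ..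
  qed
  then have "gip M i p (christoffel M i p X Y) Z = w \<bullet> Z"
    by (simp add: gip_def inner_gmat[OF p] gmat_mult_matrix_inv[OF p])
  also have "\<dots> = (\<Sum>l\<in>UNIV. Z $ l * ((?d X Y (axis l 1) + ?d Y X (axis l 1) - ?d (axis l 1) X Y) / 2))"
    by (simp add: inner_vec_def w_def mult.commute)
  also have "\<dots> = ((\<Sum>l\<in>UNIV. Z $ l * ?d X Y (axis l 1)) + (\<Sum>l\<in>UNIV. Z $ l * ?d Y X (axis l 1))
      - (\<Sum>l\<in>UNIV. Z $ l * ?d (axis l 1) X Y)) / 2"
    unfolding sum.distrib[symmetric] sum_subtractf[symmetric] sum_divide_distrib
    by (simp add: algebra_simps diff_divide_distrib add_divide_distrib)
  also have "\<dots> = (?d X Y Z + ?d Y X Z - ?d Z X Y) / 2"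
  proof -
    have "F Z = (\<Sum>l\<in>UNIV. Z $ l * F (axis l 1))" if "linear F" for F :: "real ^ 'd \<Rightarrow> real"
      using linear_expansion[OF that, of Z] by (simp only: real_scaleR_def)
    from this[OF dgip_linear(2)] this[OF dgip_linear(2)] this[OF dgip_linear(1)[OF p]] show ?thesis
      by simp
  qed
  finally show ?thesis .
qed

lemma linear_christoffel:
  assumes p: "p \<in> cdom M i"
  shows "linear (christoffel M i p X)" "linear (\<lambda>X. christoffel M i p X Y)"
proof -
  have lin: "linear (dgip i p X Y)" "linear (\<lambda>Y. dgip i p X Y Z)" "linear (\<lambda>X. dgip i p X Y Z)" for X Y Z
    using dgip_linear p by auto
  have eqI: "V = W" if "\<And>Z. gip M i p V Z = gip M i p W Z" for V W
    using gip_nondegenerate[OF p, of "V - W"] that by (simp add: gip_diff)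
  show "linear (christoffel M i p X)" "linear (\<lambda>X. christoffel M i p X Y)"
    by (auto intro!: linearI eqI simp: gip_christoffel[OF p] gip_add gip_scale
        linear_add[OF lin(1)] linear_add[OF lin(2)] linear_add[OF lin(3)]
        linear_cmul[OF lin(1)] linear_cmul[OF lin(2)] linear_cmul[OF lin(3)] field_simps)
qed

lemma christoffel_commute:
  assumes p: "p \<in> cdom M i"
  shows "christoffel M i p X Y = christoffel M i p Y X"
proof -
  have "gip M i p (christoffel M i p X Y - christoffel M i p Y X) Z = 0" for Z
    by (simp add: gip_diff gip_christoffel[OF p] dgip_commute[OF p, of Z X Y])
  then show ?thesis
    using gip_nondegenerate[OF p] by (metis right_minus_eq)
qed

lemma dgip_eq_christoffel:
  assumes p: "p \<in> cdom M i"
  shows "dgip i p X Y Z = gip M i p (christoffel M i p X Y) Z + gip M i p Y (christoffel M i p X Z)"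
  using gip_christoffel[OF p, of X Y Z] gip_christoffel[OF p, of X Z Y] dgip_commute[OF p]
  by (simp add: gip_commute[OF p, of Y] field_simps)

lemma nabla_eq:
  assumes "has_chart_derivative M UNIV i Z D p" "p \<in> cdom M i"
  shows "nabla M UNIV i Z p X = D X + christoffel M i p X (Z p)"
  using dirder_eq[OF assms] by (simp add: nabla_def)

lemma nabla_const: "p \<in> cdom M i \<Longrightarrow> nabla M UNIV i (\<lambda>_. Z) p X = christoffel M i p X Z"
  using nabla_eq[OF has_chart_derivative_const] by simp

text \<open>The connection is metric, for vector fields along any subset \<open>A\<close>.\<close>

lemma has_chart_derivative_gip:
  assumes p: "p \<in> cdom M i"
    and Y: "has_chart_derivative M A i Y Y' p" and Z: "has_chart_derivative M A i Z Z' p"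
  shows "has_chart_derivative M A i (\<lambda>q. gip M i q (Y q) (Z q))
    (\<lambda>X. gip M i p (Y' X + christoffel M i p X (Y p)) (Z p) + gip M i p (Y p) (Z' X + christoffel M i p X (Z p))) p"
proof -
  have mv: "bounded_bilinear (\<lambda>(A :: real ^ 'd ^ 'd) x. A *v x)"
    by (rule bilinear_conv_bounded_bilinear[THEN iffD1])
       (auto simp: bilinear_def linear_iff matrix_vector_right_distrib matrix_vector_mult_add_rdistrib
          scaleR_matrix_vector_assoc[symmetric] matrix_vector_mult_scaleR)
  have G: "has_chart_derivative M A i (gmat M i) (dirder M UNIV i (gmat M i) p) p"
    by (rule has_chart_derivative_subset[OF has_chart_derivative_gmat[OF p]])
  have "has_chart_derivative M A i (\<lambda>q. Y q \<bullet> (gmat M i q *v Z q))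
      (\<lambda>X. Y p \<bullet> (gmat M i p *v Z' X + dirder M UNIV i (gmat M i) p X *v Z p) + Y' X \<bullet> (gmat M i p *v Z p)) p"
    using bounded_bilinear.FDERIV[OF bounded_bilinear_inner Y[unfolded has_chart_derivative_def]
        bounded_bilinear.FDERIV[OF mv G[unfolded has_chart_derivative_def] Z[unfolded has_chart_derivative_def]]]
    unfolding has_chart_derivative_def o_def by (simp add: p)
  also have "(\<lambda>X. Y p \<bullet> (gmat M i p *v Z' X + dirder M UNIV i (gmat M i) p X *v Z p) + Y' X \<bullet> (gmat M i p *v Z p)) =
      (\<lambda>X. gip M i p (Y p) (Z' X) + dgip i p X (Y p) (Z p) + gip M i p (Y' X) (Z p))"
    by (simp add: gip_def dgip_def inner_simps)
  finally show ?thesis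
    by (simp add: gip_def[symmetric] dgip_eq_christoffel[OF p] gip_add add_ac)
qed

end

context riemannian
begin

subsection \<open>Curvature\<close>

text \<open>By the Koszul formula the components of \<open>\<nabla>\<^sub>Y Z\<close> solve a linear system whose matrix is
  the metric and whose right-hand side \<open>w\<close> is smooth.\<close>

lemma has_chart_derivative_christoffel:
  assumes p: "p \<in> cdom M i"
  shows "has_chart_derivative M UNIV i (\<lambda>q. christoffel M i q Y Z) (dirder M UNIV i (\<lambda>q. christoffel M i q Y Z) p) p"
proof -
  let ?S = "cmap M i ` (cdom M i \<inter> UNIV)" and ?x = "cmap M i p"
  define w where "w = (\<lambda>q. \<Sum>l\<in>UNIV. ((dgip i q Y Z (axis l 1) + dgip i q Z Y (axis l 1) - dgip i q (axis l 1) Y Z) / 2) *\<^sub>R axis l (1::real))"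
  have wl: "w q $ l = (dgip i q Y Z (axis l 1) + dgip i q Z Y (axis l 1) - dgip i q (axis l 1) Y Z) / 2" for q l
  proof -
    have "w q = (\<chi> l. (dgip i q Y Z (axis l 1) + dgip i q Z Y (axis l 1) - dgip i q (axis l 1) Y Z) / 2)"
      using basis_expansion[of "\<chi> l. (dgip i q Y Z (axis l 1) + dgip i q Z Y (axis l 1) - dgip i q (axis l 1) Y Z) / 2"]
      by (simp add: w_def scalar_mult_eq_scaleR)
    then show ?thesis
      by simp
  qed
  have eq: "christoffel M i q Y Z = matrix_inv (gmat M i q) *v w q" if q: "q \<in> cdom M i" for q
  proof -
    have "(gmat M i q *v christoffel M i q Y Z) $ l = w q $ l" for l
      using gip_christoffel[OF q, of Y Z "axis l 1"]
      by (simp add: wl gip_def inner_gmat[OF q] inner_axis)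
    then have "gmat M i q *v (christoffel M i q Y Z - matrix_inv (gmat M i q) *v w q) = 0"
      by (simp add: matrix_vector_mult_diff_distrib gmat_mult_matrix_inv[OF q] vec_eq_iff)
    then have "gip M i q Y' (christoffel M i q Y Z - matrix_inv (gmat M i q) *v w q) = 0" for Y'
      by (simp add: gip_def)
    then show ?thesis
      using gip_nondegenerate[OF q, of "christoffel M i q Y Z - matrix_inv (gmat M i q) *v w q"] gip_commute[OF q]
      by simp
  qed
  have d: "has_chart_derivative M UNIV i (\<lambda>q. dgip i q X1 X2 X3) (dirder M UNIV i (\<lambda>q. dgip i q X1 X2 X3) p) p" for X1 X2 X3
  proof -
    have "bounded_linear (\<lambda>A :: real ^ 'd ^ 'd. X2 \<bullet> (A *v X3))"
      by (rule linear_conv_bounded_linear[THEN iffD1])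
         (auto simp: linear_iff matrix_vector_mult_add_rdistrib inner_simps scaleR_matrix_vector_assoc[symmetric])
    from has_chart_derivative_compose_linear[OF this
        has_chart_derivative_smooth[OF open_UNIV smooth_on_dirder[OF open_UNIV smooth_gmat] p UNIV_I]]
    show ?thesis
      unfolding dgip_def by (rule has_chart_derivative_dirder[OF _ p])
  qed
  have "\<exists>D. has_chart_derivative M UNIV i w D p"
  proof -
    have lin: "bounded_linear (\<lambda>r :: real. (r / 2) *\<^sub>R axis l (1::real))" for l :: 'd
      by (rule linear_conv_bounded_linear[THEN iffD1])
        (auto simp: linear_iff add_divide_distrib scaleR_add_left)
    show ?thesis
      unfolding w_def
      by (rule exI, rule has_chart_derivative_sum, rule has_chart_derivative_compose_linear[OF lin
        has_chart_derivative_diff[OF has_chart_derivative_add[OF d d] d]])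
  qed
  then have "(\<lambda>x. w (cpar M i x)) differentiable (at ?x within ?S)"
    unfolding has_chart_derivative_def o_def differentiable_def .
  moreover have "(\<lambda>x. gmat M i (cpar M i x)) differentiable (at ?x within ?S)"
    using has_chart_derivative_gmat[OF p] unfolding has_chart_derivative_def o_def by (rule differentiableI)
  moreover have "invertible (gmat M i (cpar M i y))" if "y \<in> ?S" for y
    using that by (auto intro: invertible_gmat)
  ultimately have "(\<lambda>x. matrix_inv (gmat M i (cpar M i x)) *v w (cpar M i x)) differentiable (at ?x within ?S)"
    using p by (intro differentiable_matrix_inv_mult) auto
  then obtain D where "has_chart_derivative M UNIV i (\<lambda>q. matrix_inv (gmat M i q) *v w q) D p"
    unfolding has_chart_derivative_def o_def differentiable_def by blast
  then have "has_chart_derivative M UNIV i (\<lambda>q. christoffel M i q Y Z) D p"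
    by (rule has_chart_derivative_transform[OF _ open_UNIV UNIV_I p UNIV_I]) (simp add: eq)
  then show ?thesis
    by (rule has_chart_derivative_dirder[OF _ p])
qed

text \<open>The inner connection in \<open>curvature\<close> is given by the Christoffel symbols on the chart domain
  only, hence the detour through locality of derivatives.\<close>

lemma curvature_eq:
  assumes p: "p \<in> cdom M i"
  shows "curvature M i p X Y Z =
    (dirder M UNIV i (\<lambda>q. christoffel M i q Y Z) p X + christoffel M i p X (christoffel M i p Y Z)) -
    (dirder M UNIV i (\<lambda>q. christoffel M i q X Z) p Y + christoffel M i p Y (christoffel M i p X Z))"
proof -
  have *: "has_chart_derivative M UNIV i (\<lambda>q. nabla M UNIV i (\<lambda>_. Z) q Y) (dirder M UNIV i (\<lambda>q. christoffel M i q Y Z) p) p" for Y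
    by (rule has_chart_derivative_transform[OF has_chart_derivative_christoffel[OF p] open_UNIV UNIV_I p UNIV_I])
       (simp add: nabla_const)
  show ?thesis
    unfolding curvature_def nabla_eq[OF * p] by (simp add: nabla_const[OF p])
qed

lemma linear_curvature:
  assumes p: "p \<in> cdom M i"
  shows "linear (curvature M i p X Y)"
proof -
  note c = has_chart_derivative_christoffel[OF p]
  have "dirder M UNIV i (\<lambda>q. christoffel M i q Y (Z + Z')) p X =
     dirder M UNIV i (\<lambda>q. christoffel M i q Y Z) p X + dirder M UNIV i (\<lambda>q. christoffel M i q Y Z') p X" for X Y Z Z'
  proof -
    have "has_chart_derivative M UNIV i (\<lambda>q. christoffel M i q Y (Z + Z'))
      (\<lambda>X. dirder M UNIV i (\<lambda>q. christoffel M i q Y Z) p X + dirder M UNIV i (\<lambda>q. christoffel M i q Y Z') p X) p"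
      by (rule has_chart_derivative_transform[OF has_chart_derivative_add[OF c c] open_UNIV UNIV_I p UNIV_I])
         (simp add: linear_add[OF linear_christoffel(1)])
    from dirder_eq[OF this p] show ?thesis
      by simp
  qed
  moreover have "dirder M UNIV i (\<lambda>q. christoffel M i q Y (r *\<^sub>R Z)) p X =
     r *\<^sub>R dirder M UNIV i (\<lambda>q. christoffel M i q Y Z) p X" for r X Y Z
  proof -
    have "has_chart_derivative M UNIV i (\<lambda>q. christoffel M i q Y (r *\<^sub>R Z))
      (\<lambda>X. r *\<^sub>R dirder M UNIV i (\<lambda>q. christoffel M i q Y Z) p X) p"
      by (rule has_chart_derivative_transform[OF has_chart_derivative_compose_linear[OF bounded_linear_scaleR_right c]
            open_UNIV UNIV_I p UNIV_I]) (simp add: linear_cmul[OF linear_christoffel(1)])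
    from dirder_eq[OF this p] show ?thesis
      by simp
  qed
  ultimately show ?thesis
    by (intro linearI) (simp_all add: curvature_eq[OF p] linear_add[OF linear_christoffel(1)[OF p]]
        linear_cmul[OF linear_christoffel(1)[OF p]] scaleR_diff_right scaleR_add_right)
qed

text \<open>The curvature endomorphisms are skew: since the connection is metric, the second derivatives
  of \<open>h(Z, W)\<close>, for \<open>Z\<close> and \<open>W\<close> with constant components, are symmetric only if the curvature terms
  cancel.\<close>

lemma curvature_skew:
  assumes p: "p \<in> cdom M i"
  shows "gip M i p (curvature M i p X Y Z) W = - gip M i p (curvature M i p X Y W) Z"
proof -
  let ?G = "\<lambda>q X Y. christoffel M i q X Y"
  let ?F = "\<lambda>q. gip M i q Z W"
  define d where "d = (\<lambda>Y Z. dirder M UNIV i (\<lambda>q. ?G q Y Z) p)"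
  have lin: "bounded_linear (\<lambda>A :: real ^ 'd ^ 'd. Z \<bullet> (A *v W))"
    by (rule linear_conv_bounded_linear[THEN iffD1])
       (auto simp: linear_iff matrix_vector_mult_add_rdistrib inner_simps scaleR_matrix_vector_assoc[symmetric])
  have smooth: "smooth_on (cmap M i ` (cdom M i \<inter> UNIV)) (\<lambda>x. ?F (cpar M i x))"
    using smooth_on_linear[OF lin smooth_gmat] by (simp add: gip_def)
  have first: "dirder M UNIV i ?F q X = gip M i q (?G q X Z) W + gip M i q Z (?G q X W)" if "q \<in> cdom M i" for q X
    using dirder_eq[OF has_chart_derivative_gip[OF that has_chart_derivative_const has_chart_derivative_const] that]
    by simp
  have second: "dirder M UNIV i (\<lambda>q. dirder M UNIV i ?F q Y) p X =
      gip M i p (d Y Z X + ?G p X (?G p Y Z)) W + gip M i p (?G p Y Z) (?G p X W) +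
      (gip M i p (?G p X Z) (?G p Y W) + gip M i p Z (d Y W X + ?G p X (?G p Y W)))" for X Y
  proof -
    note c = has_chart_derivative_christoffel[OF p] and k = has_chart_derivative_const
    have "has_chart_derivative M UNIV i (\<lambda>q. gip M i q (?G q Y Z) W + gip M i q Z (?G q Y W))
      (\<lambda>X. gip M i p (d Y Z X + ?G p X (?G p Y Z)) W + gip M i p (?G p Y Z) (?G p X W) +
      (gip M i p (?G p X Z) (?G p Y W) + gip M i p Z (d Y W X + ?G p X (?G p Y W)))) p"
      using has_chart_derivative_add[OF has_chart_derivative_gip[OF p c k] has_chart_derivative_gip[OF p k c]]
      by (simp add: d_def)
    from dirder_transform[OF this open_UNIV UNIV_I p, of "\<lambda>q. dirder M UNIV i ?F q Y"] show ?thesis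
      by (simp add: first)
  qed
  have "dirder M UNIV i (\<lambda>q. dirder M UNIV i ?F q Y) p X = dirder M UNIV i (\<lambda>q. dirder M UNIV i ?F q X) p Y"
    by (rule dirder_symmetric[OF open_UNIV smooth p UNIV_I])
  then have "gip M i p (curvature M i p X Y Z) W + gip M i p Z (curvature M i p X Y W) = 0"
    unfolding second curvature_eq[OF p] by (simp add: d_def gip_add gip_diff)
  then show ?thesis
    using gip_commute[OF p] by (metis add_eq_0_iff2)
qed


subsection \<open>Orthonormal bases\<close>

text \<open>Orthonormality says that the matrix \<open>P\<close> with rows \<open>e a\<close> satisfies \<open>P g P\<^sup>T = 1\<close>; being
  square, \<open>P\<^sup>T\<close> is then also a left inverse, \<open>P\<^sup>T P g = 1\<close>.\<close>

lemma orthonormal_expansion: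
  assumes p: "p \<in> cdom M i" and e: "orthonormal M i p e"
  shows "X = (\<Sum>a\<in>UNIV. gip M i p X (e a) *\<^sub>R e a)"
proof -
  define P where "P = (\<chi> a. e a)"
  have "(P ** gmat M i p) ** transpose P = mat 1"
  proof (rule vec_eq_iff[THEN iffD2], rule, rule vec_eq_iff[THEN iffD2], rule)
    fix a b
    have "((P ** gmat M i p) ** transpose P) $ a $ b = (P ** gmat M i p *v e b) $ a"
      by (simp add: matrix_matrix_mult_def matrix_vector_mult_def transpose_def P_def)
    also have "\<dots> = e a \<bullet> (gmat M i p *v e b)"
      by (simp add: matrix_vector_mul_assoc[symmetric]) (simp add: P_def matrix_vector_mul_component)
    finally show "((P ** gmat M i p) ** transpose P) $ a $ b = (mat 1 :: real ^ 'd ^ 'd) $ a $ b"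
      using e by (simp add: orthonormal_def gip_def mat_def)
  qed
  then have "transpose P ** (P ** gmat M i p) = mat 1"
    using matrix_left_right_inverse by blast
  then have "X = transpose P *v (P *v (gmat M i p *v X))"
    by (simp add: matrix_vector_mul_assoc matrix_mul_assoc)
  also have "\<dots> = (\<Sum>a\<in>UNIV. (e a \<bullet> (gmat M i p *v X)) *\<^sub>R e a)"
    by (simp add: vec_eq_iff matrix_vector_mult_def transpose_def P_def inner_vec_def sum_component mult.commute)
  finally show ?thesis
    using gip_commute[OF p, of X] by (simp add: gip_def)
qed

lemma orthonormal_trace:
  fixes B :: "real ^ 'd \<Rightarrow> real ^ 'd \<Rightarrow> 'b::real_vector"
  assumes p: "p \<in> cdom M i" and e: "orthonormal M i p e" and e': "orthonormal M i p e'" and B: "bilinear B"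
  shows "(\<Sum>a\<in>UNIV. B (e a) (e a)) = (\<Sum>a\<in>UNIV. B (e' a) (e' a))"
proof -
  let ?g = "\<lambda>a b. gip M i p (e a) (e' b)"
  have expand: "B (e a) (e a) = (\<Sum>b\<in>UNIV. \<Sum>c\<in>UNIV. (?g a b * ?g a c) *\<^sub>R B (e' b) (e' c))" for a
  proof -
    have "B (e a) (e a) = B (\<Sum>b\<in>UNIV. ?g a b *\<^sub>R e' b) (\<Sum>c\<in>UNIV. ?g a c *\<^sub>R e' c)"
      by (rule arg_cong2[OF orthonormal_expansion[OF p e'] orthonormal_expansion[OF p e']])
    also have "\<dots> = (\<Sum>b\<in>UNIV. \<Sum>c\<in>UNIV. (?g a b * ?g a c) *\<^sub>R B (e' b) (e' c))"
      unfolding bilinear_sum[OF B] sum.cartesian_product[symmetric]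
      by (simp add: bilinear_lmul[OF B] bilinear_rmul[OF B] mult.commute)
    finally show ?thesis .
  qed
  have delta: "(\<Sum>a\<in>UNIV. ?g a b * ?g a c) = (if b = c then 1 else 0)" for b c
  proof -
    have "gip M i p (e' b) (e' c) = gip M i p (\<Sum>a\<in>UNIV. gip M i p (e' b) (e a) *\<^sub>R e a) (e' c)"
      by (rule arg_cong[OF orthonormal_expansion[OF p e], of "\<lambda>X. gip M i p X (e' c)"])
    also have "\<dots> = (\<Sum>a\<in>UNIV. ?g a b * ?g a c)"
      by (simp add: gip_sum gip_scale gip_commute[OF p, of "e' b" "e a" for a])
    finally show ?thesis
      using e' by (simp add: orthonormal_def)
  qed
  have "(\<Sum>a\<in>UNIV. B (e a) (e a)) = (\<Sum>b\<in>UNIV. \<Sum>a\<in>UNIV. \<Sum>c\<in>UNIV. (?g a b * ?g a c) *\<^sub>R B (e' b) (e' c))"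
    unfolding expand by (rule sum.swap)
  also have "\<dots> = (\<Sum>b\<in>UNIV. \<Sum>c\<in>UNIV. \<Sum>a\<in>UNIV. (?g a b * ?g a c) *\<^sub>R B (e' b) (e' c))"
    by (intro sum.cong refl sum.swap)
  also have "\<dots> = (\<Sum>b\<in>UNIV. \<Sum>c\<in>UNIV. (if b = c then 1 else 0) *\<^sub>R B (e' b) (e' c))"
    by (simp add: scaleR_sum_left[symmetric] delta)
  also have "\<dots> = (\<Sum>b\<in>UNIV. B (e' b) (e' b))"
    by (rule sum.cong) (auto simp: if_distrib[of "\<lambda>r. r *\<^sub>R _"] cong: if_cong)
  finally show ?thesis .
qed

lemma orthonormal_basis_chart: "orthonormal_basis M p E \<Longrightarrow> p \<in> cdom M i \<Longrightarrow> orthonormal M i p (\<lambda>a. E a i)"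
  unfolding orthonormal_basis_def by blast

lemma orthonormal_basis_jac:
  "orthonormal_basis M p E \<Longrightarrow> p \<in> cdom M i \<Longrightarrow> p \<in> cdom M j \<Longrightarrow> E a j = jac M i j p (E a i)"
  unfolding orthonormal_basis_def by blast

end


section \<open>The second fundamental form of a smooth map\<close>

locale smooth_mapping = M: riemannian H M + N: riemannian H' N
  for H :: "(real ^ 'd::finite) set" and M :: "('i, 'm::topological_space, 'd) riem"
    and H' :: "(real ^ 'n::finite) set" and N :: "('k, 'y::topological_space, 'n) riem" +
  fixes f :: "'m \<Rightarrow> 'y"
  assumes smooth: "smooth_map M N f"
begin

lemma continuous_f: "continuous_on UNIV f"
  using smooth by (simp add: smooth_map_def)

lemma open_vimage_chart: "open (f -` cdom N k)"
  using continuous_f N.open_cdom by (simp add: continuous_on_open_vimage)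

lemma smooth_chart: "smooth_on (cmap M i ` (cdom M i \<inter> f -` cdom N k)) (\<lambda>x. cmap N k (f (cpar M i x)))"
  using smooth by (simp add: smooth_map_def)

lemma has_chart_derivative_df:
  assumes "p \<in> cdom M i" "f p \<in> cdom N k"
  shows "has_chart_derivative M UNIV i (\<lambda>q. cmap N k (f q)) (df M N f i k p) p"
proof -
  have eq: "df M N f i k p = dirder M UNIV i (\<lambda>q. cmap N k (f q)) p"
    by (rule ext) (simp add: df_def)
  show ?thesis
    unfolding eq by (rule M.has_chart_derivative_smooth[OF open_vimage_chart smooth_chart assms(1)]) (simp add: assms)
qed

lemma linear_df: "p \<in> cdom M i \<Longrightarrow> f p \<in> cdom N k \<Longrightarrow> linear (df M N f i k p)"
  by (rule has_chart_derivative_linear_map[OF has_chart_derivative_df])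

lemma smooth_df: "smooth_on (cmap M i ` (cdom M i \<inter> f -` cdom N k)) (\<lambda>x. df M N f i k (cpar M i x) v)"
  using M.smooth_on_dirder[OF open_vimage_chart smooth_chart] by (simp add: df_def)

lemma df_change_source:
  assumes "p \<in> cdom M i" "p \<in> cdom M j" "f p \<in> cdom N k"
  shows "df M N f i k p X = df M N f j k p (jac M i j p X)"
  using M.dirder_change_chart[OF assms(1,2) has_chart_derivative_df[OF assms(2,3)]] by (simp add: df_def)

lemma df_change_target:
  assumes "p \<in> cdom M i" "f p \<in> cdom N k" "f p \<in> cdom N l"
  shows "df M N f i l p X = jac N k l (f p) (df M N f i k p X)"
proof -
  have "has_chart_derivative M UNIV i (\<lambda>q. cmap N l (f q)) (\<lambda>X. jac N k l (f p) (df M N f i k p X)) p"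
    by (rule has_chart_derivative_chain[OF M.riemannian_axioms N.riemannian_axioms continuous_f assms(1,2)
          has_chart_derivative_df[OF assms(1,2)] N.has_chart_derivative_jac[OF assms(2,3)]])
  from M.dirder_eq[OF this assms(1)] show ?thesis
    by (simp add: df_def)
qed

lemma has_chart_derivative_df_const:
  assumes "p \<in> cdom M i" "f p \<in> cdom N k"
  shows "has_chart_derivative M UNIV i (\<lambda>q. df M N f i k q Y) (dirder M UNIV i (\<lambda>q. df M N f i k q Y) p) p"
  by (rule M.has_chart_derivative_smooth[OF open_vimage_chart smooth_df assms(1)]) (simp add: assms)

lemma nabla_df_eq:
  assumes "p \<in> cdom M i"
  shows "nabla_df M N f i k p X Y = dirder M UNIV i (\<lambda>q. df M N f i k q Y) p X
     + christoffel N k (f p) (df M N f i k p X) (df M N f i k p Y) - df M N f i k p (christoffel M i p X Y)"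
  using M.nabla_const[OF assms] by (simp add: nabla_df_def)

text \<open>Symmetry of second derivatives and of the Christoffel symbols.\<close>

lemma nabla_df_symmetric:
  assumes "p \<in> cdom M i" "f p \<in> cdom N k"
  shows "nabla_df M N f i k p X Y = nabla_df M N f i k p Y X"
proof -
  have "dirder M UNIV i (\<lambda>q. df M N f i k q Y) p X = dirder M UNIV i (\<lambda>q. df M N f i k q X) p Y"
    unfolding df_def by (rule M.dirder_symmetric[OF open_vimage_chart smooth_chart assms(1)]) (simp add: assms)
  then show ?thesis
    by (simp add: nabla_df_eq[OF assms(1)] M.christoffel_commute[OF assms(1), of X]
        N.christoffel_commute[OF assms(2), of "df M N f i k p X"])
qed

lemma linear_nabla_df:
  assumes p: "p \<in> cdom M i" "f p \<in> cdom N k"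
  shows "linear (\<lambda>X. nabla_df M N f i k p X Y)" "linear (nabla_df M N f i k p X)"
proof -
  note l1 = has_chart_derivative_linear_map[OF has_chart_derivative_df_const[OF p]]
    and l2 = N.linear_christoffel(2)[OF p(2)] and l3 = linear_df[OF p] and l4 = M.linear_christoffel(2)[OF p(1)]
  show "linear (\<lambda>X. nabla_df M N f i k p X Y)" for Y
    by (rule linearI)
      (simp_all add: nabla_df_eq[OF p(1)] linear_add[OF l1] linear_add[OF l2] linear_add[OF l3] linear_add[OF l4]
        linear_cmul[OF l1] linear_cmul[OF l2] linear_cmul[OF l3] linear_cmul[OF l4] scaleR_diff_right scaleR_add_right)
  moreover have "nabla_df M N f i k p X = (\<lambda>Y. nabla_df M N f i k p Y X)"
    by (rule ext) (rule nabla_df_symmetric[OF p])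
  ultimately show "linear (nabla_df M N f i k p X)"
    by simp
qed

text \<open>The product rule for \<open>df\<close> applied to a vector field, in the pull-back connection.\<close>

lemma has_chart_derivative_df_field:
  assumes p: "p \<in> cdom M i" "f p \<in> cdom N k" and Z: "has_chart_derivative M UNIV i Z Z' p"
  shows "has_chart_derivative M UNIV i (\<lambda>q. df M N f i k q (Z q))
    (\<lambda>X. nabla_df M N f i k p X (Z p) + df M N f i k p (Z' X + christoffel M i p X (Z p))
      - christoffel N k (f p) (df M N f i k p X) (df M N f i k p (Z p))) p"
proof -
  let ?d = "\<lambda>a. dirder M UNIV i (\<lambda>q. df M N f i k q (axis a 1)) p"
  have D: "has_chart_derivative M UNIV i (\<lambda>q. \<Sum>a\<in>UNIV. Z q $ a *\<^sub>R df M N f i k q (axis a 1))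
      (\<lambda>X. \<Sum>a\<in>UNIV. Z p $ a *\<^sub>R ?d a X + Z' X $ a *\<^sub>R df M N f i k p (axis a 1)) p"
  proof (rule has_chart_derivative_sum)
    fix a
    show "has_chart_derivative M UNIV i (\<lambda>q. Z q $ a *\<^sub>R df M N f i k q (axis a 1))
      (\<lambda>X. Z p $ a *\<^sub>R ?d a X + Z' X $ a *\<^sub>R df M N f i k p (axis a 1)) p"
      using has_derivative_scaleR[OF bounded_linear.has_derivative[OF bounded_linear_vec_nth Z[unfolded has_chart_derivative_def]]
          has_chart_derivative_df_const[OF p, unfolded has_chart_derivative_def]] p(1)
      unfolding has_chart_derivative_def o_def by simp
  qed
  have "has_chart_derivative M UNIV i (\<lambda>q. df M N f i k q (Z q))
      (\<lambda>X. \<Sum>a\<in>UNIV. Z p $ a *\<^sub>R ?d a X + Z' X $ a *\<^sub>R df M N f i k p (axis a 1)) p"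
    by (rule M.has_chart_derivative_transform[OF D open_vimage_chart _ p(1) UNIV_I, of k])
       (use p(2) in \<open>auto simp: linear_expansion[OF linear_df, of _ _ _ "Z _", symmetric]\<close>)
  moreover have "(\<Sum>a\<in>UNIV. Z p $ a *\<^sub>R ?d a X + Z' X $ a *\<^sub>R df M N f i k p (axis a 1)) =
      nabla_df M N f i k p X (Z p) + df M N f i k p (Z' X + christoffel M i p X (Z p))
      - christoffel N k (f p) (df M N f i k p X) (df M N f i k p (Z p))" for X
  proof -
    have 1: "(\<Sum>a\<in>UNIV. Z' X $ a *\<^sub>R df M N f i k p (axis a 1)) = df M N f i k p (Z' X)"
      by (rule linear_expansion[OF linear_df[OF p], symmetric])
    have "has_chart_derivative M UNIV i (\<lambda>q. \<Sum>a\<in>UNIV. Z p $ a *\<^sub>R df M N f i k q (axis a 1))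
        (\<lambda>X. \<Sum>a\<in>UNIV. Z p $ a *\<^sub>R ?d a X) p"
      by (intro has_chart_derivative_sum has_chart_derivative_compose_linear[OF bounded_linear_scaleR_right]
          has_chart_derivative_df_const p)
    then have "dirder M UNIV i (\<lambda>q. df M N f i k q (Z p)) p = (\<lambda>X. \<Sum>a\<in>UNIV. Z p $ a *\<^sub>R ?d a X)"
      by (rule M.dirder_transform[OF _ open_vimage_chart _ p(1), of _ _ k])
         (use p(2) in \<open>auto simp: linear_expansion[OF linear_df, of _ _ _ "Z p", symmetric]\<close>)
    then have 2: "(\<Sum>a\<in>UNIV. Z p $ a *\<^sub>R ?d a X) = dirder M UNIV i (\<lambda>q. df M N f i k q (Z p)) p X"
      by simp
    show ?thesis
      by (simp add: sum.distrib 1 2 nabla_df_eq[OF p(1)] linear_add[OF linear_df[OF p]])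
  qed
  ultimately show ?thesis
    by simp
qed

end


section \<open>The boundary of a surface and its normal\<close>

lemma vec2_eq: "X = X $ 1 *\<^sub>R axis 1 1 + X $ 2 *\<^sub>R axis 2 (1::real)" for X :: "real ^ 2"
  by (simp add: vec_eq_iff forall_2 axis_def)

locale surface = riemannian half_plane M
  for M :: "('i, 'm::topological_space, 2) riem"
begin

lemma cmap_nonneg: "p \<in> cdom M i \<Longrightarrow> cmap M i p $ 2 \<ge> 0"
  using openin_imp_subset[OF openin_chart[OF open_UNIV, of i]] by (auto simp: half_plane_def)

text \<open>The second coordinate \<open>x\<^sub>2\<close> of the chart \<open>j\<close> is nonnegative and vanishes at \<open>p\<close>, so it
  cannot decrease along a ray of the half-plane.\<close>

lemma jac_inward:
  assumes i: "p \<in> cdom M i" and j: "p \<in> cdom M j" and zero: "cmap M j p $ 2 = 0"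
    and e: "e > 0" and v: "\<And>t. 0 \<le> t \<Longrightarrow> t < e \<Longrightarrow> cmap M i p + t *\<^sub>R v \<in> half_plane"
  shows "jac M i j p v $ 2 \<ge> 0"
proof (rule ccontr)
  assume neg: "\<not> jac M i j p v $ 2 \<ge> 0"
  let ?x = "cmap M i p" and ?T = "cmap M i ` (cdom M i \<inter> cdom M j)"
  define g where "g t = cmap M j (cpar M i (?x + t *\<^sub>R v)) $ 2" for t
  have T: "openin (top_of_set half_plane) ?T" "?x \<in> ?T"
    using openin_chart[OF open_cdom] i j by auto
  obtain r where r: "r > 0" "\<And>y. y \<in> half_plane \<Longrightarrow> dist y ?x < r \<Longrightarrow> y \<in> ?T"
    using openin_ball_subset[OF T] by metis
  define d where "d = min e (r / (norm v + 1))"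
  have v1: "norm v + 1 > 0"
    by (smt (verit) norm_ge_zero)
  have d: "d > 0"
    using e r(1) v1 by (simp add: d_def)
  have inT: "?x + t *\<^sub>R v \<in> ?T" if "t \<in> {0..<d}" for t
  proof (rule r(2))
    show "?x + t *\<^sub>R v \<in> half_plane"
      using v that by (auto simp: d_def)
    have "t * norm v \<le> t * (norm v + 1)"
      using that by (simp add: mult_left_mono)
    also have "\<dots> < r"
      using that v1 by (simp add: d_def pos_less_divide_eq)
    finally show "dist (?x + t *\<^sub>R v) ?x < r"
      using that by (simp add: dist_norm)
  qed
  have "((cmap M j \<circ> cpar M i) has_derivative jac M i j p) (at ?x within ?T)"
    using has_chart_derivative_jac[OF i j] unfolding has_chart_derivative_def by (rule has_derivative_subset) auto
  moreover have "?x + 0 *\<^sub>R v = ?x"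
    by simp
  ultimately have 1: "((cmap M j \<circ> cpar M i) has_derivative jac M i j p)
      (at (?x + 0 *\<^sub>R v) within (\<lambda>t. ?x + t *\<^sub>R v) ` {0..<d})"
    using inT by (metis (no_types, lifting) has_derivative_subset image_subset_iff)
  have 2: "((\<lambda>t. ?x + t *\<^sub>R v) has_derivative (\<lambda>t. t *\<^sub>R v)) (at 0 within {0..<d})"
    by (auto intro!: derivative_eq_intros)
  have "(g has_derivative (\<lambda>t. jac M i j p (t *\<^sub>R v) $ 2)) (at 0 within {0..<d})"
    using bounded_linear.has_derivative[OF bounded_linear_vec_nth has_derivative_in_compose[OF 2 1], of 2]
    by (simp add: g_def[abs_def])
  then have "(g has_real_derivative jac M i j p v $ 2) (at 0 within {0..<d})"
    by (simp add: has_field_derivative_def linear_cmul[OF linear_jac[OF i j]] mult_commute_abs)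
  then obtain h where h: "h > 0" "\<And>t. t > 0 \<Longrightarrow> 0 + t \<in> {0..<d} \<Longrightarrow> t < h \<Longrightarrow> g (0 + t) < g 0"
    using has_real_derivative_neg_dec_right[of g "jac M i j p v $ 2" 0 "{0..<d}"] neg by (metis not_le)
  define t where "t = min h d / 2"
  have t: "t > 0" "t < h" "t < d"
    using h(1) d by (auto simp: t_def)
  have "g t < g 0"
    using h(2)[of t] t by simp
  moreover have "g 0 = 0"
    using i zero by (simp add: g_def)
  moreover have "g t \<ge> 0"
  proof -
    obtain q where "q \<in> cdom M i" "q \<in> cdom M j" "?x + t *\<^sub>R v = cmap M i q"
      using inT[of t] t by auto
    then show ?thesis
      using cmap_nonneg by (simp add: g_def)
  qed
  ultimately show False
    by simp
qed

text \<open>If \<open>p\<close> were an interior point of the half-plane in the chart \<open>i\<close>, all directions would be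
  admissible in \<open>jac_inward\<close>, and the Jacobian would not be invertible.\<close>

lemma boundary_cmap:
  assumes "p \<in> boundary M" "p \<in> cdom M i"
  shows "cmap M i p $ 2 = 0"
proof (rule ccontr)
  assume "cmap M i p $ 2 \<noteq> 0"
  then have pos: "cmap M i p $ 2 > 0"
    using cmap_nonneg[OF assms(2)] by simp
  obtain j where j: "p \<in> cdom M j" "cmap M j p $ 2 = 0"
    using assms(1) by (auto simp: boundary_def)
  have nonneg: "jac M i j p v $ 2 \<ge> 0" for v
  proof (rule jac_inward[OF assms(2) j])
    show "cmap M i p $ 2 / (\<bar>v $ 2\<bar> + 1) > 0"
      using pos by simp
    show "cmap M i p + t *\<^sub>R v \<in> half_plane" if "0 \<le> t" "t < cmap M i p $ 2 / (\<bar>v $ 2\<bar> + 1)" for t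
    proof -
      have "t * \<bar>v $ 2\<bar> \<le> t * (\<bar>v $ 2\<bar> + 1)"
        using that(1) by (simp add: mult_left_mono)
      also have "\<dots> < cmap M i p $ 2"
        using that(2) by (simp add: pos_less_divide_eq)
      finally have "t * \<bar>v $ 2\<bar> < cmap M i p $ 2" .
      moreover have "t * (- v $ 2) \<le> t * \<bar>v $ 2\<bar>"
        using that(1) by (intro mult_left_mono) auto
      ultimately show ?thesis
        by (simp add: half_plane_def)
    qed
  qed
  note lin = linear_jac[OF assms(2) j(1)]
  have zero: "jac M i j p v $ 2 = 0" for v
    using nonneg[of v] nonneg[of "- v"] by (simp add: linear_neg[OF lin])
  let ?a = "jac M i j p (axis 1 1) $ 1" and ?b = "jac M i j p (axis 2 1) $ 1"
  have "jac M i j p (?b *\<^sub>R axis 1 1 - ?a *\<^sub>R axis 2 1) = 0"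
    by (simp add: linear_diff[OF lin] linear_cmul[OF lin] vec_eq_iff forall_2 zero)
  then have *: "?b *\<^sub>R axis 1 1 - ?a *\<^sub>R axis 2 1 = (0 :: real ^ 2)"
    by (rule jac_inj[OF assms(2) j(1)])
  then have "?a = 0"
    by (simp add: vec_eq_iff forall_2 axis_def)
  then have "jac M i j p (axis 1 1) = 0"
    by (simp add: vec_eq_iff forall_2 zero)
  then have "axis 1 (1::real) = (0 :: real ^ 2)"
    by (rule jac_inj[OF assms(2) j(1)])
  then show False
    by (simp add: axis_eq_0_iff)
qed

lemma jac_boundary:
  assumes p: "p \<in> boundary M" and i: "p \<in> cdom M i" and j: "p \<in> cdom M j"
  shows "v $ 2 \<ge> 0 \<Longrightarrow> jac M i j p v $ 2 \<ge> 0" and "v $ 2 = 0 \<Longrightarrow> jac M i j p v $ 2 = 0"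
proof -
  show *: "jac M i j p v $ 2 \<ge> 0" if "v $ 2 \<ge> 0" for v
    by (rule jac_inward[OF i j boundary_cmap[OF p j], of 1])
      (use that boundary_cmap[OF p i] in \<open>auto simp: half_plane_def\<close>)
  show "jac M i j p v $ 2 = 0" if "v $ 2 = 0"
    using *[of v] *[of "- v"] that by (simp add: linear_neg[OF linear_jac[OF i j]])
qed


subsection \<open>The inner unit normal\<close>

text \<open>Orthogonal to the first coordinate vector field and pointing inwards; unlike
  \<open>inner_normal\<close>, which is a definite description, it is visibly smooth.\<close>

definition normal_field :: "'i \<Rightarrow> 'm \<Rightarrow> real ^ 2" where
  "normal_field i p = gmat M i p $ 1 $ 1 *\<^sub>R axis 2 1 - gmat M i p $ 1 $ 2 *\<^sub>R axis 1 1"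

lemma gip_2: "gip M i p X Y = X $ 1 * (gmat M i p $ 1 $ 1 * Y $ 1 + gmat M i p $ 1 $ 2 * Y $ 2)
    + X $ 2 * (gmat M i p $ 2 $ 1 * Y $ 1 + gmat M i p $ 2 $ 2 * Y $ 2)"
  by (simp add: gip_def inner_vec_def matrix_vector_mult_def sum_2)

lemma normal_field_pos: "p \<in> cdom M i \<Longrightarrow> gmat M i p $ 1 $ 1 > 0"
  using gip_pos[of p i "axis 1 1"] axis_eq_0_iff[of "1 :: 2" "1 :: real"] by (simp add: gip_2) (simp add: axis_def)

lemma gip_normal_field_pos:
  assumes "p \<in> cdom M i"
  shows "gip M i p (normal_field i p) (normal_field i p) > 0"
proof (rule gip_pos[OF assms])
  show "normal_field i p \<noteq> 0"
    using normal_field_pos[OF assms] by (auto simp: normal_field_def vec_eq_iff forall_2 axis_def)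
qed

lemma gip_normal_field_tangent:
  assumes "p \<in> cdom M i" "X $ 2 = 0"
  shows "gip M i p (normal_field i p) X = 0"
  using gip_commute[OF assms(1), of "normal_field i p" X] assms(2)
  by (simp add: gip_2[of i p X] normal_field_def axis_def)

definition is_inner_normal :: "'i \<Rightarrow> 'm \<Rightarrow> real ^ 2 \<Rightarrow> bool" where
  "is_inner_normal i p n \<longleftrightarrow> gip M i p n n = 1 \<and> (\<forall>X. X $ 2 = 0 \<longrightarrow> gip M i p n X = 0) \<and> n $ 2 > 0"

lemma is_inner_normal_unique:
  assumes p: "p \<in> cdom M i" and n: "is_inner_normal i p n" 
  shows "n = inverse (sqrt (gip M i p (normal_field i p) (normal_field i p))) *\<^sub>R normal_field i p"
proof -
  let ?a = "gmat M i p $ 1 $ 1" and ?b = "gmat M i p $ 1 $ 2"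
  define c where "c = n $ 2 / ?a"
  note a = normal_field_pos[OF p]
  have "gip M i p (axis 1 1) n = 0"
    using n gip_commute[OF p, of n "axis 1 1"] by (simp add: is_inner_normal_def axis_def)
  then have "?a * n $ 1 + ?b * n $ 2 = 0"
    by (simp add: gip_2 axis_def)
  then have nc: "n = c *\<^sub>R normal_field i p"
    using a by (simp add: c_def normal_field_def vec_eq_iff forall_2 axis_def field_simps)
  have c: "c > 0"
    using n a by (simp add: c_def is_inner_normal_def)
  have "c\<^sup>2 * gip M i p (normal_field i p) (normal_field i p) = 1"
    using n unfolding is_inner_normal_def nc by (simp add: gip_scale power2_eq_square mult.assoc)
  then have "sqrt (c\<^sup>2 * gip M i p (normal_field i p) (normal_field i p)) = 1"
    by simp
  then have "c * sqrt (gip M i p (normal_field i p) (normal_field i p)) = 1"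
    using c by (simp add: real_sqrt_mult)
  then have "c = inverse (sqrt (gip M i p (normal_field i p) (normal_field i p)))"
    by (metis inverse_unique inverse_inverse_eq)
  then show ?thesis
    using nc by simp
qed

lemma is_inner_normal_normal_field:
  assumes p: "p \<in> cdom M i"
  shows "is_inner_normal i p (inverse (sqrt (gip M i p (normal_field i p) (normal_field i p))) *\<^sub>R normal_field i p)"
proof -
  let ?g = "gip M i p (normal_field i p) (normal_field i p)"
  have g: "?g > 0"
    by (rule gip_normal_field_pos[OF p])
  then have "inverse (sqrt ?g) * (inverse (sqrt ?g) * ?g) = 1"
    by (simp add: field_simps)
  moreover have "normal_field i p $ 2 > 0"
    using normal_field_pos[OF p] by (simp add: normal_field_def axis_def)
  ultimately show ?thesis
    using g gip_normal_field_tangent[OF p] by (simp add: is_inner_normal_def gip_scale)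
qed

lemma inner_normal_eq:
  assumes p: "p \<in> cdom M i"
  shows "inner_normal M i p = inverse (sqrt (gip M i p (normal_field i p) (normal_field i p))) *\<^sub>R normal_field i p"
  unfolding inner_normal_def is_inner_normal_def[symmetric]
  by (rule the_equality[where P = "is_inner_normal i p", OF is_inner_normal_normal_field[OF p] is_inner_normal_unique[OF p]])

lemma inner_normal: "p \<in> cdom M i \<Longrightarrow> is_inner_normal i p (inner_normal M i p)"
  using inner_normal_eq is_inner_normal_normal_field by simp

text \<open>A change of charts is an isometry of tangent spaces that, at the boundary, preserves the
  tangent line and the inward side.\<close>

lemma inner_normal_jac:
  assumes p: "p \<in> boundary M" and i: "p \<in> cdom M i" and j: "p \<in> cdom M j"
  shows "inner_normal M j p = jac M i j p (inner_normal M i p)"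
proof -
  let ?n = "inner_normal M i p" and ?v = "jac M i j p (axis 1 1)"
  note n = inner_normal[OF i, unfolded is_inner_normal_def]
  have v: "?v $ 2 = 0"
    by (rule jac_boundary(2)[OF p i j]) (simp add: axis_def)
  have "?v \<noteq> 0"
    using jac_inj[OF i j, of "axis 1 1"] by (auto simp: axis_eq_0_iff)
  then have v1: "?v $ 1 \<noteq> 0"
    using v by (auto simp: vec_eq_iff forall_2)
  have tangent: "gip M j p (jac M i j p ?n) X = 0" if "X $ 2 = 0" for X
  proof -
    have "X = (X $ 1 / ?v $ 1) *\<^sub>R ?v"
      using that v v1 by (simp add: vec_eq_iff forall_2)
    moreover have "gip M j p (jac M i j p ?n) ?v = 0"
      using n by (simp add: gip_jac[OF i j] axis_def)
    ultimately show ?thesis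
      by (metis gip_scale(2) mult_zero_right)
  qed
  have unit: "gip M j p (jac M i j p ?n) (jac M i j p ?n) = 1"
    using n by (simp add: gip_jac[OF i j])
  moreover have "jac M i j p ?n $ 2 > 0"
    using jac_boundary(1)[OF p i j, of ?n] n tangent[of "jac M i j p ?n"] unit by force
  ultimately have "is_inner_normal j p (jac M i j p ?n)"
    using tangent by (simp add: is_inner_normal_def)
  then show ?thesis
    using is_inner_normal_unique[OF j] inner_normal_eq[OF j] by simp
qed

lemma has_chart_derivative_inner_normal:
  assumes p: "p \<in> cdom M i"
  obtains D where "has_chart_derivative M UNIV i (inner_normal M i) D p"
proof -
  let ?x = "cmap M i p" and ?S = "cmap M i ` (cdom M i \<inter> UNIV)"
  have "bounded_linear (\<lambda>A :: real ^ 2 ^ 2. A $ 1 $ 1 *\<^sub>R axis 2 1 - A $ 1 $ 2 *\<^sub>R axis 1 (1::real))"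
    by (rule linear_conv_bounded_linear[THEN iffD1]) (auto simp: linear_iff algebra_simps)
  from has_chart_derivative_compose_linear[OF this has_chart_derivative_gmat[OF p]]
  obtain D where D: "has_chart_derivative M UNIV i (normal_field i) D p"
    unfolding normal_field_def[abs_def] by blast
  obtain D' where D': "has_chart_derivative M UNIV i (\<lambda>q. gip M i q (normal_field i q) (normal_field i q)) D' p"
    using has_chart_derivative_gip[OF p D D] by blast
  have pos: "((\<lambda>q. gip M i q (normal_field i q) (normal_field i q)) \<circ> cpar M i) ?x > 0"
    using gip_normal_field_pos[OF p] p by simp
  have "sqrt (((\<lambda>q. gip M i q (normal_field i q) (normal_field i q)) \<circ> cpar M i) ?x) \<noteq> 0"
    using pos by simp
  from has_derivative_scaleR[OF Deriv.has_derivative_inverse[OF this has_derivative_real_sqrt[OF pos D'[unfolded has_chart_derivative_def]]]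
      D[unfolded has_chart_derivative_def]]
  obtain D'' where "has_chart_derivative M UNIV i
      (\<lambda>q. inverse (sqrt (gip M i q (normal_field i q) (normal_field i q))) *\<^sub>R normal_field i q) D'' p"
    unfolding has_chart_derivative_def o_def by blast
  then have "has_chart_derivative M UNIV i (inner_normal M i) D'' p"
    by (rule has_chart_derivative_transform[OF _ open_UNIV UNIV_I p UNIV_I]) (simp add: inner_normal_eq)
  then show ?thesis
    by (rule that)
qed

text \<open>As being a boundary point does not depend on the chart, the boundary is a piece of the line
  \<open>x\<^sub>2 = 0\<close> in each chart; it can be explored along this line.\<close>

lemma boundary_line:
  assumes "open V" "p \<in> V" "p \<in> cdom M i" "p \<in> boundary M"
  obtains r where "r > 0" "\<And>t. \<bar>t\<bar> < r \<Longrightarrow> cmap M i p + t *\<^sub>R axis 1 1 \<in> cmap M i ` (cdom M i \<inter> boundary M \<inter> V)"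
proof -
  let ?x = "cmap M i p"
  have x: "?x $ 2 = 0"
    by (rule boundary_cmap[OF assms(4,3)])
  have "?x \<in> cmap M i ` (cdom M i \<inter> V)"
    using assms by blast
  then obtain r where r: "r > 0" "\<And>y. y \<in> half_plane \<Longrightarrow> dist y ?x < r \<Longrightarrow> y \<in> cmap M i ` (cdom M i \<inter> V)"
    using openin_ball_subset[OF openin_chart[OF assms(1)]] by metis
  have "?x + t *\<^sub>R axis 1 1 \<in> cmap M i ` (cdom M i \<inter> boundary M \<inter> V)" if "\<bar>t\<bar> < r" for t
  proof -
    have "?x + t *\<^sub>R axis 1 1 \<in> cmap M i ` (cdom M i \<inter> V)"
    proof (rule r(2))
      show "?x + t *\<^sub>R axis 1 1 \<in> half_plane"
        by (simp add: half_plane_def x axis_def)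
      show "dist (?x + t *\<^sub>R axis 1 1) ?x < r"
        using that by (simp add: dist_norm)
    qed
    then obtain q where q: "q \<in> cdom M i" "q \<in> V" "?x + t *\<^sub>R axis 1 1 = cmap M i q"
      by auto
    have "cmap M i q $ 2 = (?x + t *\<^sub>R axis 1 1) $ 2"
      using q(3) by simp
    also have "\<dots> = 0"
      by (simp add: x axis_def)
    finally have "cmap M i q $ 2 = 0" .
    then show ?thesis
      using q by (auto simp: boundary_def)
  qed
  then show ?thesis
    using r(1) that by blast
qed

text \<open>The Weingarten map uses some derivative within the boundary. Such a derivative is not unique,
  but its values on tangent vectors are, being derivatives along the boundary line.\<close>

lemma boundary_derivative_unique:
  assumes p: "p \<in> cdom M i" "p \<in> boundary M"
    and D: "has_chart_derivative M (boundary M) i F D p" "has_chart_derivative M (boundary M) i F D' p" and X: "X $ 2 = 0"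
  shows "D X = D' X"
proof -
  let ?x = "cmap M i p"
  obtain r where r: "r > 0" "\<And>t. \<bar>t\<bar> < r \<Longrightarrow> ?x + t *\<^sub>R axis 1 1 \<in> cmap M i ` (cdom M i \<inter> boundary M \<inter> UNIV)"
    using boundary_line[OF open_UNIV UNIV_I p] by metis
  have *: "((\<lambda>t. (F \<circ> cpar M i) (?x + t *\<^sub>R axis 1 1)) has_derivative (\<lambda>t. D (t *\<^sub>R axis 1 1))) (at 0)"
    if D: "has_chart_derivative M (boundary M) i F D p" for D
  proof -
    have "((F \<circ> cpar M i) has_derivative D) (at (?x + 0 *\<^sub>R axis 1 1) within (\<lambda>t. ?x + t *\<^sub>R axis 1 1) ` {-r<..<r})"
      using D unfolding has_chart_derivative_def by (simp, elim has_derivative_subset) (use r(2) in auto)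
    moreover have "((\<lambda>t. ?x + t *\<^sub>R axis 1 1) has_derivative (\<lambda>t. t *\<^sub>R axis 1 1)) (at 0 within {-r<..<r})"
      by (auto intro!: derivative_eq_intros)
    ultimately have "((\<lambda>t. (F \<circ> cpar M i) (?x + t *\<^sub>R axis 1 1)) has_derivative (\<lambda>t. D (t *\<^sub>R axis 1 1))) (at 0 within {-r<..<r})"
      by (rule has_derivative_in_compose[rotated])
    moreover have "at (0::real) within {-r<..<r} = at 0"
      using r(1) by (intro at_within_open) auto
    ultimately show ?thesis
      by simp
  qed
  have "(\<lambda>t. D (t *\<^sub>R axis 1 1)) = (\<lambda>t. D' (t *\<^sub>R axis 1 1))"
    using has_derivative_unique[OF *[OF D(1)] *[OF D(2)]] .
  moreover have "X = X $ 1 *\<^sub>R axis 1 1"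
    using vec2_eq[of X] X by simp
  ultimately show ?thesis
    by metis
qed

lemma inner_normal_derivative:
  assumes p: "p \<in> cdom M i" "p \<in> boundary M" and umbilical: "principal_curvature M \<kappa>"
    and D: "has_chart_derivative M UNIV i (inner_normal M i) D p" and X: "X $ 2 = 0"
  shows "D X + christoffel M i p X (inner_normal M i p) = - \<kappa> *\<^sub>R X"
proof -
  have D': "has_chart_derivative M (boundary M) i (inner_normal M i) D p"
    by (rule has_chart_derivative_subset[OF D])
  have "has_chart_derivative M (boundary M) i (inner_normal M i) (dirder M (boundary M) i (inner_normal M i) p) p"
    using D' unfolding has_chart_derivative_def dirder_def[abs_def]
    by (metis differentiableI frechet_derivative_works)
  then have "dirder M (boundary M) i (inner_normal M i) p X = D X"
    using boundary_derivative_unique[OF p _ D' X] by blast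
  moreover have "weingarten M i p X = \<kappa> *\<^sub>R X"
    using umbilical p X unfolding principal_curvature_def by blast
  moreover have "dirder M (boundary M) i (inner_normal M i) p X + christoffel M i p X (inner_normal M i p) = - weingarten M i p X"
    by (simp add: weingarten_def nabla_def)
  ultimately show ?thesis
    by simp
qed

end


section \<open>Clifford multiplication on a spin surface\<close>

lemmas spinor_component_simps = gamma_def spin_rep_def vec_eq_iff forall_2 matrix_vector_mult_def sum_2 complex_eq_iff

lemma linear_gamma: "linear (\<lambda>s. gamma a *v s)"
  using exhaust_2[of a] by (auto simp: linear_iff spinor_component_simps algebra_simps)

lemma gamma_anticommute:
  fixes x1 x2 y1 y2 :: real
  shows "x1 *\<^sub>R (gamma 1 *v (y1 *\<^sub>R (gamma 1 *v s) + y2 *\<^sub>R (gamma 2 *v s))) +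
      x2 *\<^sub>R (gamma 2 *v (y1 *\<^sub>R (gamma 1 *v s) + y2 *\<^sub>R (gamma 2 *v s))) +
     (y1 *\<^sub>R (gamma 1 *v (x1 *\<^sub>R (gamma 1 *v s) + x2 *\<^sub>R (gamma 2 *v s))) +
      y2 *\<^sub>R (gamma 2 *v (x1 *\<^sub>R (gamma 1 *v s) + x2 *\<^sub>R (gamma 2 *v s)))) =
     (- 2 * (x1 * y1 + x2 * y2)) *\<^sub>R s"
  by (simp add: spinor_component_simps algebra_simps)

lemma gamma_smult: "gamma a *v (c *s s) = c *s (gamma a *v s)"
  using exhaust_2[of a] by (auto simp: spinor_component_simps algebra_simps)

lemma linear_spin_rep: "linear (spin_rep z)"
  by (auto simp: linear_iff spinor_component_simps algebra_simps)

text \<open>The equivariance \<open>spin_rep_rotation\<close> of Clifford multiplication, as a commutation rule.\<close>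

lemma spin_rep_gamma:
  assumes "cmod z = 1"
  shows "spin_rep z (gamma 1 *v s) = Re (z\<^sup>2) *\<^sub>R (gamma 1 *v spin_rep z s) + Im (z\<^sup>2) *\<^sub>R (gamma 2 *v spin_rep z s)"
    "spin_rep z (gamma 2 *v s) = - Im (z\<^sup>2) *\<^sub>R (gamma 1 *v spin_rep z s) + Re (z\<^sup>2) *\<^sub>R (gamma 2 *v spin_rep z s)"
proof -
  have inv: "inverse z = cnj z"
    using assms by (metis inverse_unique complex_norm_square of_real_1 power_one)
  have "spin_rep (cnj z) (spin_rep z s) = (Re z * Re z + Im z * Im z) *\<^sub>R s"
    by (simp add: spinor_component_simps algebra_simps)
  also have "Re z * Re z + Im z * Im z = 1"
    using assms by (simp add: cmod_def power2_eq_square)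
  finally have "spin_rep (inverse z) (spin_rep z s) = s"
    by (simp add: inv)
  then show "spin_rep z (gamma 1 *v s) = Re (z\<^sup>2) *\<^sub>R (gamma 1 *v spin_rep z s) + Im (z\<^sup>2) *\<^sub>R (gamma 2 *v spin_rep z s)"
    "spin_rep z (gamma 2 *v s) = - Im (z\<^sup>2) *\<^sub>R (gamma 1 *v spin_rep z s) + Re (z\<^sup>2) *\<^sub>R (gamma 2 *v spin_rep z s)"
    using spin_rep_rotation[OF assms, of "spin_rep z s"] by simp_all
qed

lemma cinner_simps:
  "cinner (s + s') t = cinner s t + cinner s' t" "cinner t (s + s') = cinner t s + cinner t s'"
  "cinner (r *\<^sub>R s) t = of_real r * cinner s t" "cinner t (r *\<^sub>R s) = of_real r * cinner t s"
  "cinner (- s) t = - cinner s t" "cinner t (- s) = - cinner t s"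
  by (simp_all add: cinner_def sum_2 algebra_simps scaleR_conv_of_real[where 'a = complex])

locale spin_surface = surface M
  for M :: "('i, 'm::topological_space, 2) riem" +
  fixes S :: "('i, 'm, 'p::topological_space) spin"
  assumes spin: "spin_structure M S"
begin

lemma gauge_around: obtains U \<sigma> where "p \<in> U" "spin_gauge M S U \<sigma>"
  using spin unfolding spin_structure_def by meson

lemma sproj_sact: "cmod z = 1 \<Longrightarrow> sproj S (sact S u z) = sproj S u"
  using spin unfolding spin_structure_def by simp

lemma sact_transitive:
  assumes "sproj S u = sproj S v"
  obtains z where "cmod z = 1" "v = sact S u z"
proof -
  have "\<exists>!z. z \<in> sphere 0 1 \<and> v = sact S u z"
    using spin assms unfolding spin_structure_def by blast
  then show ?thesis
    using that by auto
qed

lemma sframe_basis: "orthonormal_basis M (sproj S u) (sframe S u)"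
  using spin unfolding spin_structure_def by blast

lemma sframe_orthonormal: "sproj S u \<in> cdom M i \<Longrightarrow> orthonormal M i (sproj S u) (\<lambda>a. sframe S u a i)"
  by (rule orthonormal_basis_chart[OF sframe_basis])

lemma sframe_sact:
  assumes "cmod z = 1" "sproj S u \<in> cdom M i"
  shows "sframe S (sact S u z) 1 i = Re (z\<^sup>2) *\<^sub>R sframe S u 1 i + Im (z\<^sup>2) *\<^sub>R sframe S u 2 i"
    "sframe S (sact S u z) 2 i = - Im (z\<^sup>2) *\<^sub>R sframe S u 1 i + Re (z\<^sup>2) *\<^sub>R sframe S u 2 i"
proof -
  have "z \<in> sphere 0 1"
    using assms(1) by simp
  then show "sframe S (sact S u z) 1 i = Re (z\<^sup>2) *\<^sub>R sframe S u 1 i + Im (z\<^sup>2) *\<^sub>R sframe S u 2 i"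
    "sframe S (sact S u z) 2 i = - Im (z\<^sup>2) *\<^sub>R sframe S u 1 i + Re (z\<^sup>2) *\<^sub>R sframe S u 2 i"
    using spin assms(2) unfolding spin_structure_def by blast+
qed

lemma clifford_eq:
  "clifford M S i u X s = gip M i (sproj S u) X (sframe S u 1 i) *\<^sub>R (gamma 1 *v s) +
     gip M i (sproj S u) X (sframe S u 2 i) *\<^sub>R (gamma 2 *v s)"
  by (simp add: clifford_def sum_2)

lemma linear_clifford: "linear (clifford M S i u X)" "linear (\<lambda>X. clifford M S i u X s)"
  by (auto simp: linear_iff clifford_eq gip_add gip_scale linear_add[OF linear_gamma] linear_cmul[OF linear_gamma]
      algebra_simps)

lemma clifford_smult: "clifford M S i u X (c *s s) = c *s clifford M S i u X s"
  by (simp add: clifford_eq gamma_smult) (simp add: vec_eq_iff algebra_simps)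

lemma clifford_sframe:
  assumes "sproj S u \<in> cdom M i"
  shows "clifford M S i u (sframe S u a i) s = gamma a *v s"
  using sframe_orthonormal[OF assms] exhaust_2[of a] by (auto simp: orthonormal_def clifford_eq)

lemma clifford_jac:
  assumes "sproj S u \<in> cdom M i" "sproj S u \<in> cdom M j"
  shows "clifford M S j u (jac M i j (sproj S u) X) s = clifford M S i u X s"
proof -
  have "sframe S u a j = jac M i j (sproj S u) (sframe S u a i)" for a
    by (rule orthonormal_basis_jac[OF sframe_basis assms])
  then show ?thesis
    by (simp add: clifford_eq gip_jac[OF assms])
qed

lemma clifford_sact:
  assumes z: "cmod z = 1" and u: "sproj S u \<in> cdom M i"
  shows "clifford M S i (sact S u z) X (spin_rep (inverse z) s) = spin_rep (inverse z) (clifford M S i u X s)"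
proof -
  have "inverse z = cnj z"
    using z by (metis inverse_unique complex_norm_square of_real_1 power_one)
  moreover have "cmod (cnj z) = 1"
    using z by simp
  moreover have "Re ((cnj z)\<^sup>2) = Re (z\<^sup>2)" "Im ((cnj z)\<^sup>2) = - Im (z\<^sup>2)"
    by (simp_all flip: complex_cnj_power)
  ultimately show ?thesis
    by (simp add: clifford_eq sproj_sact[OF z] sframe_sact[OF z u] gip_add gip_scale gip_minus gip_diff linear_add[OF linear_spin_rep]
        linear_cmul[OF linear_spin_rep] spin_rep_gamma del: complex_cnj_power)
      (simp add: algebra_simps)
qed

lemma clifford_anticommute:
  assumes u: "sproj S u \<in> cdom M i"
  shows "clifford M S i u X (clifford M S i u Y s) + clifford M S i u Y (clifford M S i u X s) =
    (- 2 * gip M i (sproj S u) X Y) *\<^sub>R s"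
proof -
  have "gip M i (sproj S u) X Y = gip M i (sproj S u) (\<Sum>a\<in>UNIV. gip M i (sproj S u) X (sframe S u a i) *\<^sub>R sframe S u a i) Y"
    by (rule arg_cong[OF orthonormal_expansion[OF u sframe_orthonormal[OF u]], of "\<lambda>X. gip M i (sproj S u) X Y"])
  also have "\<dots> =
      gip M i (sproj S u) X (sframe S u 1 i) * gip M i (sproj S u) Y (sframe S u 1 i) +
      gip M i (sproj S u) X (sframe S u 2 i) * gip M i (sproj S u) Y (sframe S u 2 i)"
    by (simp add: gip_add gip_scale sum_2 gip_commute[OF u, of "sframe S u a i" Y for a])
  finally have eq: "gip M i (sproj S u) X Y =
      gip M i (sproj S u) X (sframe S u 1 i) * gip M i (sproj S u) Y (sframe S u 1 i) +
      gip M i (sproj S u) X (sframe S u 2 i) * gip M i (sproj S u) Y (sframe S u 2 i)" .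
  show ?thesis
    unfolding clifford_eq eq by (rule gamma_anticommute)
qed

lemma clifford_square:
  assumes "sproj S u \<in> cdom M i"
  shows "clifford M S i u X (clifford M S i u X s) = - (gip M i (sproj S u) X X *\<^sub>R s)"
proof -
  have "2 *\<^sub>R clifford M S i u X (clifford M S i u X s) = 2 *\<^sub>R (- (gip M i (sproj S u) X X *\<^sub>R s))"
    using clifford_anticommute[OF assms, of X X s] by (simp add: scaleR_2)
  then show ?thesis
    by (simp only: scaleR_cancel_left) simp
qed

lemma cinner_clifford: "cinner (clifford M S i u X s) t = - cinner s (clifford M S i u X t)"
  by (simp add: clifford_eq cinner_simps gamma_skew algebra_simps)

end


section \<open>Spinors along a map\<close>

lemma bilinear_tens: "bilinear tens"
  by (auto simp: bilinear_def linear_iff tens_def vec_eq_iff algebra_simps)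

lemma tens_nth: "tens s Y $ c = Y $ c *\<^sub>R s"
  by (simp add: tens_def)

lemma tens_map_sum_tens:
  assumes A: "linear A" and B: "linear B"
  shows "tens_map A B (\<Sum>j\<in>J. tens (s j) (Y j)) = (\<Sum>j\<in>J. tens (A (s j)) (B (Y j)))"
proof -
  have "tens_map A B (\<Sum>j\<in>J. tens (s j) (Y j)) = (\<Sum>a\<in>UNIV. \<Sum>j\<in>J. tens (A (s j)) (Y j $ a *\<^sub>R B (axis a 1)))"
    by (simp add: tens_map_def tens_nth linear_sum[OF A] linear_cmul[OF A] bilinear_lmul[OF bilinear_tens]
        bilinear_rmul[OF bilinear_tens] linear_sum[OF bilinear_tens[unfolded bilinear_def, THEN conjunct2, rule_format]])
  also have "\<dots> = (\<Sum>j\<in>J. tens (A (s j)) (\<Sum>a\<in>UNIV. Y j $ a *\<^sub>R B (axis a 1)))"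
    by (subst sum.swap) (simp add: linear_sum[OF bilinear_tens[unfolded bilinear_def, THEN conjunct1, rule_format]])
  finally show ?thesis
    by (simp flip: linear_expansion[OF B])
qed

lemma tens_map_id: "tens_map A (\<lambda>Y. Y) \<phi> = (\<chi> c. A (\<phi> $ c))"
proof -
  have "(\<Sum>a\<in>UNIV. axis a 1 $ c *\<^sub>R A (\<phi> $ a)) = A (\<phi> $ c)" for c
  proof -
    have "(\<Sum>a\<in>UNIV. axis a 1 $ c *\<^sub>R A (\<phi> $ a)) = (\<Sum>a\<in>UNIV. if c = a then A (\<phi> $ a) else 0)"
      by (rule sum.cong) (auto simp: axis_def)
    then show ?thesis
      by simp
  qed
  then show ?thesis
    by (simp add: tens_map_def tens_def vec_eq_iff sum_component)
qed

lemma tens_inner_sum_tens: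
  "tens_inner N k y (\<Sum>a\<in>A. tens (s a) (Y a)) (\<Sum>b\<in>B. tens (t b) (Z b)) =
    (\<Sum>a\<in>A. \<Sum>b\<in>B. of_real (gip N k y (Y a) (Z b)) * cinner (s a) (t b))"
proof -
  have cinner_sum: "cinner (\<Sum>a\<in>A. v a) (\<Sum>b\<in>B. w b) = (\<Sum>a\<in>A. \<Sum>b\<in>B. cinner (v a) (w b))" for v w
    by (simp add: cinner_def sum_2 sum_distrib_left sum_distrib_right sum.distrib sum_component)
       (simp add: sum.swap[of _ A B])
  let ?G = "gmat N k y"
  have "tens_inner N k y (\<Sum>a\<in>A. tens (s a) (Y a)) (\<Sum>b\<in>B. tens (t b) (Z b)) =
     (\<Sum>c\<in>UNIV. \<Sum>d\<in>UNIV. \<Sum>a\<in>A. \<Sum>b\<in>B. of_real (Y a $ c * ?G $ c $ d * Z b $ d) * cinner (s a) (t b))"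
    by (simp add: tens_inner_def tens_nth cinner_sum cinner_simps sum_distrib_left algebra_simps)
  also have "\<dots> = (\<Sum>c\<in>UNIV. \<Sum>a\<in>A. \<Sum>d\<in>UNIV. \<Sum>b\<in>B. of_real (Y a $ c * ?G $ c $ d * Z b $ d) * cinner (s a) (t b))"
    by (intro sum.cong refl sum.swap)
  also have "\<dots> = (\<Sum>a\<in>A. \<Sum>c\<in>UNIV. \<Sum>d\<in>UNIV. \<Sum>b\<in>B. of_real (Y a $ c * ?G $ c $ d * Z b $ d) * cinner (s a) (t b))"
    by (rule sum.swap)
  also have "\<dots> = (\<Sum>a\<in>A. \<Sum>c\<in>UNIV. \<Sum>b\<in>B. \<Sum>d\<in>UNIV. of_real (Y a $ c * ?G $ c $ d * Z b $ d) * cinner (s a) (t b))"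
    by (intro sum.cong refl sum.swap)
  also have "\<dots> = (\<Sum>a\<in>A. \<Sum>b\<in>B. \<Sum>c\<in>UNIV. \<Sum>d\<in>UNIV. of_real (Y a $ c * ?G $ c $ d * Z b $ d) * cinner (s a) (t b))"
    by (intro sum.cong refl sum.swap)
  also have "\<dots> = (\<Sum>a\<in>A. \<Sum>b\<in>B. of_real (gip N k y (Y a) (Z b)) * cinner (s a) (t b))"
    by (simp add: gip_def inner_vec_def matrix_vector_mult_def sum_distrib_left sum_distrib_right mult.assoc)
  finally show ?thesis .
qed

locale spinor_along = smooth_mapping half_plane M H' N f + spin_surface M S
  for M :: "('i, 'm::topological_space, 2) riem" and H' :: "(real ^ 'n::finite) set"
    and N :: "('k, 'y::topological_space, 'n) riem" and f :: "'m \<Rightarrow> 'y"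
    and S :: "('i, 'm, 'p::topological_space) spin" +
  fixes \<psi> :: "'p \<Rightarrow> complex ^ 2" and E :: "'m \<Rightarrow> 2 \<Rightarrow> 'i \<Rightarrow> real ^ 2"
  assumes spinor: "spinor_field M S \<psi>" and basis: "\<And>p. orthonormal_basis M p (E p)"
begin

abbreviation \<Phi> where "\<Phi> \<equiv> spinor_along_map M S N f \<psi> E"

text \<open>The summand is bilinear in the two occurrences of \<open>e\<^sub>j\<close> and invariant under changes of
  charts, so the sum is a trace; any orthonormal basis, in any chart, may be used. In particular
  the basis \<open>E\<close>, which need not vary continuously, can be replaced by the frame of a gauge.\<close>

lemma spinor_along_map_eq:
  assumes i: "sproj S u \<in> cdom M i" and k: "f (sproj S u) \<in> cdom N k" and e: "orthonormal M i (sproj S u) e"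
  shows "\<Phi> u k = (\<Sum>j\<in>UNIV. tens (clifford M S i u (e j) (\<psi> u)) (df M N f i k (sproj S u) (e j)))"
proof -
  let ?p = "sproj S u"
  define i' where "i' = (SOME i. ?p \<in> cdom M i)"
  have i': "?p \<in> cdom M i'"
    unfolding i'_def using i by (rule someI)
  have jac: "E ?p j i = jac M i' i ?p (E ?p j i')" for j
    by (rule M.orthonormal_basis_jac[OF basis i' i])
  have "\<Phi> u k = (\<Sum>j\<in>UNIV. tens (clifford M S i' u (E ?p j i') (\<psi> u)) (df M N f i' k ?p (E ?p j i')))"
    by (simp add: spinor_along_map_def Let_def i'_def)
  also have "\<dots> = (\<Sum>j\<in>UNIV. tens (clifford M S i u (E ?p j i) (\<psi> u)) (df M N f i k ?p (E ?p j i)))"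
    unfolding jac clifford_jac[OF i' i] df_change_source[OF i' i k] ..
  also have "\<dots> = (\<Sum>j\<in>UNIV. tens (clifford M S i u (e j) (\<psi> u)) (df M N f i k ?p (e j)))"
  proof -
    have "bilinear (\<lambda>X Y. tens (clifford M S i u X (\<psi> u)) (df M N f i k ?p Y))"
      unfolding bilinear_def linear_iff
      by (simp add: linear_add[OF linear_clifford(2)] linear_cmul[OF linear_clifford(2)] linear_add[OF linear_df[OF i k]]
          linear_cmul[OF linear_df[OF i k]] bilinear_ladd[OF bilinear_tens] bilinear_radd[OF bilinear_tens]
          bilinear_lmul[OF bilinear_tens] bilinear_rmul[OF bilinear_tens])
    from M.orthonormal_trace[OF i M.orthonormal_basis_chart[OF basis i] e this] show ?thesis .
  qed
  finally show ?thesis .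
qed

lemma spinor_along_map_gauge:
  assumes "spin_gauge M S U \<sigma>" "q \<in> U" "q \<in> cdom M i" "f q \<in> cdom N k"
  shows "\<Phi> (\<sigma> q) k = (\<Sum>a\<in>UNIV. tens (gamma a *v \<psi> (\<sigma> q)) (df M N f i k q (sframe S (\<sigma> q) a i)))"
proof -
  have q: "sproj S (\<sigma> q) = q"
    using assms(1,2) by (simp add: spin_gauge_def)
  show ?thesis
    using spinor_along_map_eq[of "\<sigma> q" i k "\<lambda>a. sframe S (\<sigma> q) a i"] sframe_orthonormal[of "\<sigma> q" i] assms(3,4)
    by (simp add: q clifford_sframe)
qed

lemma twisted_spinor_field_spinor_along_map: "twisted_spinor_field M S N f \<Phi>"
  unfolding twisted_spinor_field_def
proof (intro conjI allI ballI impI)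
  fix u k and z :: complex
  assume "z \<in> sphere 0 1" and k: "f (sproj S u) \<in> cdom N k"
  then have z: "cmod z = 1"
    by simp
  obtain i where i: "sproj S u \<in> cdom M i"
    using M.chart_around by blast
  have psi: "\<psi> (sact S u z) = spin_rep (inverse z) (\<psi> u)"
    using spinor z by (simp add: spinor_field_def)
  note e = sframe_orthonormal[OF i]
  have "\<Phi> (sact S u z) k = (\<Sum>j\<in>UNIV. tens (spin_rep (inverse z) (clifford M S i u (sframe S u j i) (\<psi> u)))
      (df M N f i k (sproj S u) (sframe S u j i)))"
    using spinor_along_map_eq[of "sact S u z" i k "\<lambda>a. sframe S u a i"] i k e
    by (simp add: sproj_sact[OF z] psi clifford_sact[OF z i])
  also have "\<dots> = tens_map (spin_rep (inverse z)) (\<lambda>Y. Y) (\<Phi> u k)"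
    unfolding spinor_along_map_eq[OF i k e] by (simp add: tens_map_sum_tens[OF linear_spin_rep linear_ident])
  finally show "\<Phi> (sact S u z) k = tens_map (spin_rep (inverse z)) (\<lambda>Y. Y) (\<Phi> u k)" .
next
  fix u k l
  assume kl: "f (sproj S u) \<in> cdom N k \<inter> cdom N l"
  then have k: "f (sproj S u) \<in> cdom N k" and l: "f (sproj S u) \<in> cdom N l"
    by auto
  obtain i where i: "sproj S u \<in> cdom M i"
    using M.chart_around by blast
  note e = sframe_orthonormal[OF i]
  show "\<Phi> u l = tens_map (\<lambda>s. s) (jac N k l (f (sproj S u))) (\<Phi> u k)"
    unfolding spinor_along_map_eq[OF i k e] spinor_along_map_eq[OF i l e] df_change_target[OF i k l]
    by (simp add: tens_map_sum_tens[OF linear_ident N.linear_jac[OF k l]])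
next
  fix U \<sigma> i k
  assume \<sigma>: "spin_gauge M S U \<sigma>"
  let ?T = "cmap M i ` (cdom M i \<inter> U \<inter> f -` cdom N k)"
  have "smooth_on (cmap M i ` (cdom M i \<inter> U)) (\<lambda>x. \<psi> (\<sigma> (cpar M i x)))"
    using spinor \<sigma> unfolding spinor_field_def by blast
  then have "smooth_on ?T (\<lambda>x. \<psi> (\<sigma> (cpar M i x)))"
    by (rule smooth_on_subset) auto
  then have psi: "smooth_on ?T (\<lambda>x. gamma a *v \<psi> (\<sigma> (cpar M i x)))" for a
    by (rule smooth_on_linear[OF linear_conv_bounded_linear[THEN iffD1, OF linear_gamma]])
  have "smooth_on (cmap M i ` (cdom M i \<inter> U)) (\<lambda>x. sframe S (\<sigma> (cpar M i x)) a i)" for a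
    using \<sigma> unfolding spin_gauge_def by blast
  then have "smooth_on ?T (\<lambda>x. sframe S (\<sigma> (cpar M i x)) a i)" for a
    by (rule smooth_on_subset) auto
  then have frame: "smooth_on ?T (\<lambda>x. sframe S (\<sigma> (cpar M i x)) a i $ b)" for a b
    by (rule smooth_on_linear[OF bounded_linear_vec_nth])
  have df: "smooth_on ?T (\<lambda>x. df M N f i k (cpar M i x) v)" for v
    by (rule smooth_on_subset[OF smooth_df]) auto
  \<comment> \<open>\<open>df\<close> is known to be smooth on constant vectors only, so the frame is expanded in coordinate
    vectors.\<close>
  have "smooth_on ?T (\<lambda>x. \<Sum>a\<in>UNIV. tens (gamma a *v \<psi> (\<sigma> (cpar M i x)))
      (\<Sum>b\<in>UNIV. sframe S (\<sigma> (cpar M i x)) a i $ b *\<^sub>R df M N f i k (cpar M i x) (axis b 1)))"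
    by (intro smooth_on_sum smooth_on_bilinear[OF bilinear_conv_bounded_bilinear[THEN iffD1, OF bilinear_tens]]
        smooth_on_bilinear[OF bounded_bilinear_scaleR] psi frame df)
  then show "smooth_on ?T (\<lambda>x. \<Phi> (\<sigma> (cpar M i x)) k)"
  proof (rule smooth_on_cong)
    fix x
    assume "x \<in> ?T"
    then obtain q where q: "q \<in> cdom M i" "q \<in> U" "f q \<in> cdom N k" "x = cmap M i q"
      by auto
    show "(\<Sum>a\<in>UNIV. tens (gamma a *v \<psi> (\<sigma> (cpar M i x)))
        (\<Sum>b\<in>UNIV. sframe S (\<sigma> (cpar M i x)) a i $ b *\<^sub>R df M N f i k (cpar M i x) (axis b 1))) = \<Phi> (\<sigma> (cpar M i x)) k"
      using q spinor_along_map_gauge[OF \<sigma> q(2,1,3)]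
      by (simp flip: linear_expansion[OF linear_df[OF q(1,3)]])
  qed
qed

end


section \<open>The Dirac equation\<close>

text \<open>The algebra behind the compatibility of the spin connection with Clifford multiplication:
  the commutator of the connection term with \<open>e\<^sub>a \<cdot>\<close> is Clifford multiplication with
  \<open>- \<Sum>\<^sub>b \<omega>\<^sub>b\<^sub>a e\<^sub>b\<close>. It enters only in the contraction with the coefficients \<open>y\<close>, which
  will be the components of \<open>df(e\<^sub>a)\<close>.\<close>

lemma spin_connection_commutator:
  fixes \<omega> :: "2 \<Rightarrow> 2 \<Rightarrow> real" and y :: "2 \<Rightarrow> real"
  assumes "\<And>a b. \<omega> a b = - \<omega> b a"
  shows "(1/4) *\<^sub>R (\<Sum>a\<in>UNIV. \<Sum>b\<in>UNIV. \<omega> a b *\<^sub>R (gamma a *v (gamma b *v (\<Sum>c\<in>UNIV. y c *\<^sub>R (gamma c *v s))))) =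
    (\<Sum>c\<in>UNIV. y c *\<^sub>R (gamma c *v ((1/4) *\<^sub>R (\<Sum>a\<in>UNIV. \<Sum>b\<in>UNIV. \<omega> a b *\<^sub>R (gamma a *v (gamma b *v s))))))
    - (\<Sum>a\<in>UNIV. (\<Sum>b\<in>UNIV. \<omega> a b * y b) *\<^sub>R (gamma a *v s))"
proof -
  have "\<omega> 1 1 = 0" "\<omega> 2 2 = 0" "\<omega> 2 1 = - \<omega> 1 2"
    using assms[of 1 1] assms[of 2 2] assms[of 2 1] by auto
  then show ?thesis
    by (simp add: spinor_component_simps algebra_simps)
qed

text \<open>In dimension two the sum of the \<open>e\<^sub>j \<cdot> v \<cdot> e\<^sub>j\<close> vanishes, which kills the contribution of
  the Killing equation. By symmetry \<open>\<Sum>\<^sub>j\<^sub>a B\<^sub>j\<^sub>a e\<^sub>j \<cdot> e\<^sub>a\<close> is minus the trace of \<open>B\<close>.\<close>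

lemma gamma_contraction:
  fixes y :: "2 \<Rightarrow> real" and B :: "2 \<Rightarrow> 2 \<Rightarrow> real"
  assumes "B 1 2 = B 2 1" "B 1 1 + B 2 2 = 0"
  shows "(\<Sum>j\<in>UNIV. gamma j *v (\<Sum>a\<in>UNIV. y a *\<^sub>R (gamma a *v (c *s (gamma j *v s))) + B j a *\<^sub>R (gamma a *v s))) = 0"
proof -
  have "B 2 2 = - B 1 1"
    using assms(2) by simp
  then show ?thesis
    using assms(1) by (simp add: spinor_component_simps algebra_simps)
qed

locale spinor_gauge = spin_surface M S
  for M :: "('i, 'm::topological_space, 2) riem" and S :: "('i, 'm, 'p::topological_space) spin" +
  fixes \<psi> :: "'p \<Rightarrow> complex ^ 2" and U :: "'m set" and \<sigma> :: "'m \<Rightarrow> 'p" and i :: 'i and p :: 'm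
  assumes spinor: "spinor_field M S \<psi>"
    and gauge: "spin_gauge M S U \<sigma>" and pU: "p \<in> U" and pi: "p \<in> cdom M i"
begin

abbreviation (input) e where "e a q \<equiv> sframe S (\<sigma> q) a i"

lemma sproj_gauge: "q \<in> U \<Longrightarrow> sproj S (\<sigma> q) = q"
  using gauge by (simp add: spin_gauge_def)

lemma open_gauge: "open U"
  using gauge by (simp add: spin_gauge_def)

lemma has_chart_derivative_frame: "has_chart_derivative M UNIV i (e a) (dirder M UNIV i (e a) p) p"
proof (rule has_chart_derivative_smooth[OF open_gauge _ pi pU])
  show "smooth_on (cmap M i ` (cdom M i \<inter> U)) (\<lambda>x. e a (cpar M i x))"
    using gauge unfolding spin_gauge_def by blast
qed

lemma has_chart_derivative_spinor: "has_chart_derivative M UNIV i (\<lambda>q. \<psi> (\<sigma> q)) (dirder M UNIV i (\<lambda>q. \<psi> (\<sigma> q)) p) p"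
proof (rule has_chart_derivative_smooth[OF open_gauge _ pi pU])
  show "smooth_on (cmap M i ` (cdom M i \<inter> U)) (\<lambda>x. \<psi> (\<sigma> (cpar M i x)))"
    using spinor gauge unfolding spinor_field_def by blast
qed

lemma frame_orthonormal: "orthonormal M i p (\<lambda>a. e a p)"
  using sframe_orthonormal[of "\<sigma> p" i] sproj_gauge[OF pU] pi by simp

text \<open>The connection form \<open>g(\<nabla>\<^sub>X e\<^sub>a, e\<^sub>b)\<close> of the frame.\<close>

definition \<omega> where "\<omega> X a b = gip M i p (nabla M UNIV i (e a) p X) (e b p)"

lemma nabla_frame: "nabla M UNIV i (e a) p X = (\<Sum>b\<in>UNIV. \<omega> X a b *\<^sub>R e b p)"
  unfolding \<omega>_def by (rule orthonormal_expansion[OF pi frame_orthonormal])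

text \<open>The frame is orthonormal and the connection is metric.\<close>

lemma connection_skew: "\<omega> X a b = - \<omega> X b a"
proof -
  note d = has_chart_derivative_frame
  have "gip M i q (e a q) (e b q) = (if a = b then 1 else 0)" if "q \<in> U" "q \<in> cdom M i" for q
    using sframe_orthonormal[of "\<sigma> q" i] sproj_gauge[OF that(1)] that(2) by (simp add: orthonormal_def)
  then have "has_chart_derivative M UNIV i (\<lambda>q. gip M i q (e a q) (e b q)) (\<lambda>_. 0) p"
    by (intro has_chart_derivative_transform[OF has_chart_derivative_const open_gauge pU pi UNIV_I]) simp
  from dirder_eq[OF this pi] dirder_eq[OF has_chart_derivative_gip[OF pi d d] pi, of a b]
  have "gip M i p (nabla M UNIV i (e a) p X) (e b p) + gip M i p (e a p) (nabla M UNIV i (e b) p X) = 0"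
    unfolding nabla_eq[OF d pi] by metis
  then show ?thesis
    by (simp add: \<omega>_def gip_commute[OF pi, of "e a p"])
qed

end

locale spinor_along_gauge = spinor_along M H' N f S \<psi> E + spinor_gauge M S \<psi> U \<sigma> i p
  for M :: "('i, 'm::topological_space, 2) riem" and H' :: "(real ^ 'n::finite) set"
    and N :: "('k, 'y::topological_space, 'n) riem" and f :: "'m \<Rightarrow> 'y"
    and S :: "('i, 'm, 'p::topological_space) spin" and \<psi> E U \<sigma> i p +
  fixes k
  assumes pk: "f p \<in> cdom N k"
begin

lemma has_chart_derivative_spinor_along_map:
  "has_chart_derivative M UNIV i (\<lambda>q. \<Phi> (\<sigma> q) k $ c)
    (\<lambda>X. \<Sum>a\<in>UNIV. df M N f i k p (e a p) $ c *\<^sub>R (gamma a *v dirder M UNIV i (\<lambda>q. \<psi> (\<sigma> q)) p X) +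
      (nabla_df M N f i k p X (e a p) + df M N f i k p (nabla M UNIV i (e a) p X)
        - christoffel N k (f p) (df M N f i k p X) (df M N f i k p (e a p))) $ c *\<^sub>R (gamma a *v \<psi> (\<sigma> p))) p"
proof -
  have D: "has_chart_derivative M UNIV i (\<lambda>q. df M N f i k q (e a q) $ c *\<^sub>R (gamma a *v \<psi> (\<sigma> q)))
    (\<lambda>X. df M N f i k p (e a p) $ c *\<^sub>R (gamma a *v dirder M UNIV i (\<lambda>q. \<psi> (\<sigma> q)) p X) +
      (nabla_df M N f i k p X (e a p) + df M N f i k p (nabla M UNIV i (e a) p X)
        - christoffel N k (f p) (df M N f i k p X) (df M N f i k p (e a p))) $ c *\<^sub>R (gamma a *v \<psi> (\<sigma> p))) p" for a
  proof -
    note 1 = has_chart_derivative_compose_linear[OF bounded_linear_vec_nth[of c]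
        has_chart_derivative_df_field[OF pi pk has_chart_derivative_frame[of a]]]
    note 2 = has_chart_derivative_compose_linear[OF linear_conv_bounded_linear[THEN iffD1, OF linear_gamma[of a]]
        has_chart_derivative_spinor]
    from has_derivative_scaleR[OF 1[unfolded has_chart_derivative_def] 2[unfolded has_chart_derivative_def]]
    show ?thesis
      unfolding has_chart_derivative_def o_def M.nabla_eq[OF has_chart_derivative_frame pi] by (simp add: pi)
  qed
  have V: "open (U \<inter> f -` cdom N k)" "p \<in> U \<inter> f -` cdom N k"
    using open_gauge open_vimage_chart pU pk by blast+
  show ?thesis
    by (rule M.has_chart_derivative_transform[OF has_chart_derivative_sum[OF D] V pi UNIV_I])
       (auto simp: spinor_along_map_gauge[OF gauge] tens_nth)
qed

text \<open>The product rule for \<open>\<nabla>\<^sub>X (e\<^sub>a \<cdot> \<psi> \<otimes> df(e\<^sub>a))\<close>, summed over the frame: the derivatives of the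
  frame in the two factors cancel.\<close>

lemma twisted_nabla_spinor_along_map:
  "twisted_nabla M S N f i k \<sigma> \<Phi> p X $ c =
    (\<Sum>a\<in>UNIV. df M N f i k p (e a p) $ c *\<^sub>R (gamma a *v spin_nabla M S i \<sigma> \<psi> p X) +
      nabla_df M N f i k p X (e a p) $ c *\<^sub>R (gamma a *v \<psi> (\<sigma> p)))"
proof -
  let ?s = "\<psi> (\<sigma> p)" and ?ds = "dirder M UNIV i (\<lambda>q. \<psi> (\<sigma> q)) p X"
  let ?y = "\<lambda>a. df M N f i k p (e a p) $ c" and ?B = "\<lambda>a. nabla_df M N f i k p X (e a p) $ c"
  let ?G = "\<lambda>a. christoffel N k (f p) (df M N f i k p X) (df M N f i k p (e a p)) $ c"
  let ?C = "\<lambda>s. (1/4) *\<^sub>R (\<Sum>a\<in>UNIV. \<Sum>b\<in>UNIV. \<omega> X a b *\<^sub>R (gamma a *v (gamma b *v s)))"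
  have \<Phi>: "\<Phi> (\<sigma> p) k $ c = (\<Sum>a\<in>UNIV. ?y a *\<^sub>R (gamma a *v ?s))"
    by (simp add: spinor_along_map_gauge[OF gauge pU pi pk] tens_nth)
  have dfn: "df M N f i k p (nabla M UNIV i (e a) p X) $ c = (\<Sum>b\<in>UNIV. \<omega> X a b * ?y b)" for a
    unfolding nabla_frame by (simp add: linear_sum[OF linear_df[OF pi pk]] linear_cmul[OF linear_df[OF pi pk]])
  have "spin_nabla M S i \<sigma> (\<lambda>u. \<Phi> u k $ c) p X =
      (\<Sum>a\<in>UNIV. ?y a *\<^sub>R (gamma a *v ?ds) + (?B a + (\<Sum>b\<in>UNIV. \<omega> X a b * ?y b) - ?G a) *\<^sub>R (gamma a *v ?s))
      + ?C (\<Sum>a\<in>UNIV. ?y a *\<^sub>R (gamma a *v ?s))"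
    using M.dirder_eq[OF has_chart_derivative_spinor_along_map pi]
    by (simp add: spin_nabla_def \<omega>_def[symmetric] o_def \<Phi> dfn)
  also have "?C (\<Sum>a\<in>UNIV. ?y a *\<^sub>R (gamma a *v ?s)) =
      (\<Sum>a\<in>UNIV. ?y a *\<^sub>R (gamma a *v ?C ?s)) - (\<Sum>a\<in>UNIV. (\<Sum>b\<in>UNIV. \<omega> X a b * ?y b) *\<^sub>R (gamma a *v ?s))"
    by (rule spin_connection_commutator[OF connection_skew])
  finally have 1: "spin_nabla M S i \<sigma> (\<lambda>u. \<Phi> u k $ c) p X =
      (\<Sum>a\<in>UNIV. ?y a *\<^sub>R (gamma a *v (?ds + ?C ?s)) + (?B a - ?G a) *\<^sub>R (gamma a *v ?s))"
    by (simp add: linear_add[OF linear_gamma] sum.distrib sum_subtractf scaleR_add_left scaleR_diff_left scaleR_add_right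
)
  have 2: "tens_map (\<lambda>s. s) (christoffel N k (f p) (df M N f i k p X)) (\<Phi> (\<sigma> p) k) $ c =
      (\<Sum>a\<in>UNIV. ?G a *\<^sub>R (gamma a *v ?s))"
    by (simp add: spinor_along_map_gauge[OF gauge pU pi pk] tens_map_sum_tens[OF linear_ident N.linear_christoffel(1)[OF pk]]
        tens_nth)
  have 3: "spin_nabla M S i \<sigma> \<psi> p X = ?ds + ?C ?s"
    by (simp add: spin_nabla_def \<omega>_def o_def)
  show ?thesis
    unfolding twisted_nabla_def vector_add_component vec_lambda_beta 1 2 3
    by (simp add: sum.distrib sum_subtractf scaleR_diff_left)
qed

lemma twisted_dirac_spinor_along_map:
  assumes killing: "killing_spinor M S \<alpha> \<psi>" and harmonic: "harmonic_map M N f" and e': "orthonormal M i p e'"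
  shows "twisted_dirac M S N f i k \<sigma> \<Phi> p e' = 0"
proof (rule vec_eq_iff[THEN iffD2], rule)
  fix c
  let ?s = "\<psi> (\<sigma> p)"
  let ?y = "\<lambda>a. df M N f i k p (e a p) $ c" and ?B = "\<lambda>X a. nabla_df M N f i k p X (e a p) $ c"
  let ?T = "\<lambda>X Z. clifford M S i (\<sigma> p) X (\<Sum>a\<in>UNIV. ?y a *\<^sub>R (gamma a *v (\<alpha> *s clifford M S i (\<sigma> p) Z ?s)) + ?B Z a *\<^sub>R (gamma a *v ?s))"
  have p: "sproj S (\<sigma> p) \<in> cdom M i"
    using sproj_gauge[OF pU] pi by simp
  have kil: "spin_nabla M S i \<sigma> \<psi> p X = \<alpha> *s clifford M S i (\<sigma> p) X ?s" for X
    using killing gauge pU pi unfolding killing_spinor_def by blast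
  have "twisted_dirac M S N f i k \<sigma> \<Phi> p e' $ c = (\<Sum>j\<in>UNIV. ?T (e' j) (e' j))"
    by (simp add: twisted_dirac_def tens_map_id sum_component twisted_nabla_spinor_along_map kil)
  \<comment> \<open>The expression is a trace, so the basis may be taken to be the frame of the gauge.\<close>
  also have "\<dots> = (\<Sum>j\<in>UNIV. ?T (e j p) (e j p))"
  proof -
    note l = linear_clifford linear_gamma linear_nabla_df(1)[OF pi pk]
    have "bilinear ?T"
      unfolding bilinear_def
    proof (intro conjI allI linearI)
      fix Z X X' and r :: real
      show "?T (X + X') Z = ?T X Z + ?T X' Z" "?T (r *\<^sub>R X) Z = r *\<^sub>R ?T X Z"
        by (rule linear_add[OF linear_clifford(2)] linear_cmul[OF linear_clifford(2)])+
    next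
      fix Z X X' and r :: real
      have "(\<Sum>a\<in>UNIV. ?y a *\<^sub>R (gamma a *v (\<alpha> *s clifford M S i (\<sigma> p) (X + X') ?s)) + ?B (X + X') a *\<^sub>R (gamma a *v ?s)) =
        (\<Sum>a\<in>UNIV. ?y a *\<^sub>R (gamma a *v (\<alpha> *s clifford M S i (\<sigma> p) X ?s)) + ?B X a *\<^sub>R (gamma a *v ?s)) +
        (\<Sum>a\<in>UNIV. ?y a *\<^sub>R (gamma a *v (\<alpha> *s clifford M S i (\<sigma> p) X' ?s)) + ?B X' a *\<^sub>R (gamma a *v ?s))"
        by (simp add: linear_add[OF l(2)] linear_add[OF l(3)] linear_add[OF l(4)] vector_add_ldistrib scaleR_add_left
            scaleR_add_right sum.distrib)
      then show "?T Z (X + X') = ?T Z X + ?T Z X'"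
        by (simp add: linear_add[OF linear_clifford(1)])
      have "(\<Sum>a\<in>UNIV. ?y a *\<^sub>R (gamma a *v (\<alpha> *s clifford M S i (\<sigma> p) (r *\<^sub>R X) ?s)) + ?B (r *\<^sub>R X) a *\<^sub>R (gamma a *v ?s)) =
        r *\<^sub>R (\<Sum>a\<in>UNIV. ?y a *\<^sub>R (gamma a *v (\<alpha> *s clifford M S i (\<sigma> p) X ?s)) + ?B X a *\<^sub>R (gamma a *v ?s))"
      proof -
        have "\<alpha> *s (r *\<^sub>R t) = r *\<^sub>R (\<alpha> *s t)" for t :: "complex ^ 2"
          by (simp add: vec_eq_iff)
        then show ?thesis
          by (simp add: linear_cmul[OF l(2)] linear_cmul[OF l(3)] linear_cmul[OF l(4)] scaleR_sum_right scaleR_add_right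
              mult.commute)
      qed
      then show "?T Z (r *\<^sub>R X) = r *\<^sub>R ?T Z X"
        by (simp add: linear_cmul[OF linear_clifford(1)])
    qed
    from M.orthonormal_trace[OF pi e' frame_orthonormal this] show ?thesis .
  qed
  also have "\<dots> = (\<Sum>j\<in>UNIV. gamma j *v (\<Sum>a\<in>UNIV. ?y a *\<^sub>R (gamma a *v (\<alpha> *s (gamma j *v ?s))) + ?B (e j p) a *\<^sub>R (gamma a *v ?s)))"
    by (simp add: clifford_sframe[OF p])
  also have "\<dots> = 0"
  proof (rule gamma_contraction)
    show "?B (e 1 p) 2 = ?B (e 2 p) 1"
      by (simp add: nabla_df_symmetric[OF pi pk, of "e 1 p"])
    have "tension M N f i k p (\<lambda>a. e a p) = 0"
      using harmonic pi pk frame_orthonormal unfolding harmonic_map_def by blast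
    then show "?B (e 1 p) 1 + ?B (e 2 p) 2 = 0"
      by (simp add: tension_def sum_2 vec_eq_iff)
  qed
  finally show "twisted_dirac M S N f i k \<sigma> \<Phi> p e' $ c = 0 $ c"
    by simp
qed

end


section \<open>The curvature term\<close>

context spinor_along
begin

text \<open>The curvature endomorphisms are skew, so only the part of
  \<open>\<langle>e\<^sub>j \<cdot> e\<^sub>a \<cdot> \<psi>, e\<^sub>b \<cdot> \<psi>\<rangle>\<close> that is antisymmetric in \<open>a\<close> and \<open>b\<close> contributes. In
  dimension two, \<open>j\<close> is one of two different indices \<open>a\<close> and \<open>b\<close>. For \<open>a = j\<close> the product is
  \<open>- \<langle>\<psi>, e\<^sub>b \<cdot> \<psi>\<rangle>\<close>, and so it is for \<open>b = j\<close> with \<open>a\<close> in place of \<open>b\<close>.\<close>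

lemma V_field_spinor_along_map:
  assumes i: "sproj S u \<in> cdom M i" and k: "f (sproj S u) \<in> cdom N k" and e: "orthonormal M i (sproj S u) e"
  shows "V_field M S N f i k \<Phi> u e = 0"
proof -
  let ?p = "sproj S u"
  let ?c = "\<lambda>j. clifford M S i u (e j)" and ?y = "\<lambda>j. df M N f i k ?p (e j)"
  let ?R = "curvature N k (f ?p)"
  have zero: "(\<Sum>j\<in>UNIV. tens_inner N k (f ?p) (tens_map (?c j) (?R (?y j) Y) (\<Phi> u k)) (\<Phi> u k)) = 0" for Y
  proof -
    define h where "h = (\<lambda>j a b. complex_of_real (gip N k (f ?p) (?R (?y j) Y (?y a)) (?y b)))"
    have skew: "h j a b = - h j b a" for j a b
      using N.curvature_skew[OF k, of "?y j" Y "?y a" "?y b"] by (simp add: h_def)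
    have diag: "h j a a = 0" for j a
      using skew[of j a a] by simp
    have h21: "h j 2 1 = - h j 1 2" for j
      by (rule skew)
    have sq: "?c j (?c j s) = - s" for j s
      using clifford_square[OF i, of "e j" s] e by (simp add: orthonormal_def)
    have "cinner (?c 1 (?c 1 (\<psi> u))) (?c 2 (\<psi> u)) = cinner (?c 1 (?c 2 (\<psi> u))) (?c 1 (\<psi> u))"
      by (simp add: cinner_clifford[of i u "e 1" "?c 2 (\<psi> u)"] sq cinner_simps cinner_clifford[of i u "e 2" "\<psi> u"])
    moreover have "cinner (?c 2 (?c 1 (\<psi> u))) (?c 2 (\<psi> u)) = cinner (?c 2 (?c 2 (\<psi> u))) (?c 1 (\<psi> u))"
      by (simp add: cinner_clifford[of i u "e 2" "?c 1 (\<psi> u)"] sq cinner_simps cinner_clifford[of i u "e 1" "\<psi> u"])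
    ultimately have antisym: "cinner (?c j (?c 1 (\<psi> u))) (?c 2 (\<psi> u)) = cinner (?c j (?c 2 (\<psi> u))) (?c 1 (\<psi> u))" for j
      using exhaust_2[of j] by auto
    have "(\<Sum>j\<in>UNIV. tens_inner N k (f ?p) (tens_map (?c j) (?R (?y j) Y) (\<Phi> u k)) (\<Phi> u k)) =
      (\<Sum>j\<in>UNIV. \<Sum>a\<in>UNIV. \<Sum>b\<in>UNIV. h j a b * cinner (?c j (?c a (\<psi> u))) (?c b (\<psi> u)))"
      unfolding spinor_along_map_eq[OF i k e] tens_map_sum_tens[OF linear_clifford(1) N.linear_curvature[OF k]]
        tens_inner_sum_tens h_def ..
    also have "\<dots> = (\<Sum>j\<in>UNIV. h j 1 2 * (cinner (?c j (?c 1 (\<psi> u))) (?c 2 (\<psi> u)) - cinner (?c j (?c 2 (\<psi> u))) (?c 1 (\<psi> u))))"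
    proof (rule sum.cong[OF refl])
      fix j
      show "(\<Sum>a\<in>UNIV. \<Sum>b\<in>UNIV. h j a b * cinner (?c j (?c a (\<psi> u))) (?c b (\<psi> u))) =
          h j 1 2 * (cinner (?c j (?c 1 (\<psi> u))) (?c 2 (\<psi> u)) - cinner (?c j (?c 2 (\<psi> u))) (?c 1 (\<psi> u)))"
        by (simp add: sum_2 diag h21 algebra_simps)
    qed
    also have "\<dots> = 0"
      by (simp add: antisym)
    finally show ?thesis .
  qed
  have "V_field M S N f i k \<Phi> u e = (THE V. \<forall>Y. complex_of_real (gip N k (f ?p) V Y) = 0)"
    unfolding V_field_def Let_def zero ..
  also have "\<dots> = 0"
  proof (rule the_equality)
    show "\<forall>Y. complex_of_real (gip N k (f ?p) 0 Y) = 0"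
      by (simp add: gip_def)
    show "V = 0" if "\<forall>Y. complex_of_real (gip N k (f ?p) V Y) = 0" for V
      using that by (intro N.gip_nondegenerate[OF k]) simp
  qed
  finally show ?thesis .
qed

lemma dirac_harmonic_spinor_along_map:
  assumes killing: "killing_spinor M S \<alpha> \<psi>" and harmonic: "harmonic_map M N f"
  shows "dirac_harmonic_map M S N f \<Phi>"
  unfolding dirac_harmonic_map_def
proof (intro conjI allI impI ballI)
  show "smooth_map M N f"
    by (rule smooth)
  show "twisted_spinor_field M S N f \<Phi>"
    by (rule twisted_spinor_field_spinor_along_map)
  show "twisted_dirac M S N f i k \<sigma> \<Phi> p e = 0"
    if "spin_gauge M S U \<sigma>" "p \<in> cdom M i \<inter> U \<inter> f -` cdom N k" "orthonormal M i p e" for U \<sigma> i k p e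
  proof -
    interpret spinor_along_gauge M H' N f S \<psi> E U \<sigma> i p k
      by unfold_locales (use that spinor in auto)
    show ?thesis
      by (rule twisted_dirac_spinor_along_map[OF killing harmonic that(3)])
  qed
  show "tension M N f i k (sproj S u) e = (1/2) *\<^sub>R V_field M S N f i k \<Phi> u e"
    if "sproj S u \<in> cdom M i \<and> f (sproj S u) \<in> cdom N k \<and> orthonormal M i (sproj S u) e" for u i k e
    using that harmonic V_field_spinor_along_map[of u i k e] unfolding harmonic_map_def by simp
qed

end


section \<open>The boundary condition\<close>

text \<open>Here \<open>n\<close>, \<open>x\<close>, \<open>dn\<close>, \<open>ds\<close> are the frame components of the normal, of a tangent vector \<open>X\<close>
  of the boundary, of \<open>\<nabla>\<^sub>X \<nu> = - \<kappa> X\<close>, and the derivative of a Killing spinor. The terms with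
  the connection coefficients \<open>\<omega>\<close> cancel, \<open>\<kappa> = 2i\<alpha>\<close> matches the derivative of \<open>\<nu>\<close> with that of
  \<open>|\<psi>|\<^sup>2\<close>, and \<open>\<nu> \<cdot> X\<close> is skew-Hermitian because \<open>\<nu>\<close> and \<open>X\<close> are orthogonal.\<close>

lemma mit_defect_derivative_algebra:
  fixes \<omega> :: "2 \<Rightarrow> 2 \<Rightarrow> real" and n x dn :: "2 \<Rightarrow> real"
  assumes \<omega>: "\<And>a b. \<omega> a b = - \<omega> b a" and \<alpha>: "Re \<alpha> = 0" and \<kappa>: "complex_of_real \<kappa> = 2 * \<i> * \<alpha>"
    and orth: "n 1 * x 1 + n 2 * x 2 = 0"
    and dn: "\<And>a. dn a = - \<kappa> * x a + (\<Sum>b\<in>UNIV. \<omega> a b * n b)"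
    and ds: "ds + (1/4) *\<^sub>R (\<Sum>a\<in>UNIV. \<Sum>b\<in>UNIV. \<omega> a b *\<^sub>R (gamma a *v (gamma b *v s))) =
      \<alpha> *s (\<Sum>a\<in>UNIV. x a *\<^sub>R (gamma a *v s))"
  shows "Re (cinner ds s) + Re (cinner s ds) =
    (\<Sum>a\<in>UNIV. dn a * Re (cinner (\<i> *s (gamma a *v s)) s) +
      n a * (Re (cinner (\<i> *s (gamma a *v ds)) s) + Re (cinner (\<i> *s (gamma a *v s)) ds)))"
proof -
  define \<beta> w where "\<beta> = Im \<alpha>" and "w = \<omega> 1 2"
  have \<omega>s: "\<omega> 1 1 = 0" "\<omega> 2 2 = 0" "\<omega> 2 1 = - w" "\<omega> 1 2 = w"
    using \<omega>[of 1 1] \<omega>[of 2 2] \<omega>[of 2 1] by (auto simp: w_def)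
  have \<alpha>': "\<alpha> = \<i> * of_real \<beta>"
    using \<alpha> by (simp add: complex_eq_iff \<beta>_def)
  have \<kappa>': "\<kappa> = - 2 * \<beta>"
    using \<kappa> by (simp add: \<alpha>' complex_eq_iff)
  have ds': "ds = \<alpha> *s (\<Sum>a\<in>UNIV. x a *\<^sub>R (gamma a *v s)) -
      (1/4) *\<^sub>R (\<Sum>a\<in>UNIV. \<Sum>b\<in>UNIV. \<omega> a b *\<^sub>R (gamma a *v (gamma b *v s)))"
    using ds by (simp add: algebra_simps)
  have "Re (cinner ds s) + Re (cinner s ds) -
    (\<Sum>a\<in>UNIV. dn a * Re (cinner (\<i> *s (gamma a *v s)) s) +
      n a * (Re (cinner (\<i> *s (gamma a *v ds)) s) + Re (cinner (\<i> *s (gamma a *v s)) ds))) =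
    - 2 * \<beta> * (n 1 * x 1 + n 2 * x 2) * Re (cinner s s)"
    unfolding ds' dn
    by (simp add: \<omega>s \<alpha>' \<kappa>' gamma_def matrix_vector_mult_def sum_2 cinner_def algebra_simps)
  then show ?thesis
    by (simp add: orth)
qed

lemma cinner_spin_rep:
  assumes "cmod z = 1"
  shows "cinner (spin_rep z s) (spin_rep z t) = cinner s t"
proof -
  have "cinner (spin_rep z s) (spin_rep z t) = of_real (Re z * Re z + Im z * Im z) * cinner s t"
    by (simp add: cinner_def spinor_component_simps algebra_simps)
  also have "Re z * Re z + Im z * Im z = 1"
    using assms by (simp add: cmod_def power2_eq_square)
  finally show ?thesis
    by simp
qed

lemma cinner_smult: "cinner (c *s s) t = c * cinner s t" "cinner t (c *s s) = cnj c * cinner t s"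
  by (simp_all add: cinner_def sum_2 algebra_simps)

lemma cinner_self_eq_0:
  assumes "Re (cinner s s) = 0"
  shows "s = 0"
proof -
  have "(Re (s $ 1))\<^sup>2 + (Im (s $ 1))\<^sup>2 + ((Re (s $ 2))\<^sup>2 + (Im (s $ 2))\<^sup>2) = 0"
    using assms by (simp add: cinner_def sum_2 power2_eq_square)
  then show ?thesis
    by (simp add: add_nonneg_eq_0_iff vec_eq_iff forall_2 complex_eq_iff)
qed

context spin_surface
begin

text \<open>Half the squared norm of \<open>i \<nu> \<cdot> \<psi> - \<psi>\<close>.\<close>

definition mit_defect :: "('p \<Rightarrow> complex ^ 2) \<Rightarrow> 'i \<Rightarrow> 'p \<Rightarrow> real" where
  "mit_defect \<psi> i u = Re (cinner (\<psi> u) (\<psi> u)) -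
     Re (cinner (\<i> *s clifford M S i u (inner_normal M i (sproj S u)) (\<psi> u)) (\<psi> u))"

lemma mit_defect_eq_0_iff:
  assumes u: "sproj S u \<in> cdom M i"
  shows "mit_defect \<psi> i u = 0 \<longleftrightarrow> \<i> *s clifford M S i u (inner_normal M i (sproj S u)) (\<psi> u) = \<psi> u"
proof
  assume "\<i> *s clifford M S i u (inner_normal M i (sproj S u)) (\<psi> u) = \<psi> u"
  then show "mit_defect \<psi> i u = 0"
    by (simp add: mit_defect_def)
next
  assume zero: "mit_defect \<psi> i u = 0"
  let ?s = "\<psi> u" and ?n = "inner_normal M i (sproj S u)"
  let ?t = "clifford M S i u ?n ?s"
  have ss: "cinner ?t ?t = cinner ?s ?s"
    using clifford_square[OF u, of ?n ?s] inner_normal[OF u]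
    by (simp add: cinner_clifford[of i u ?n ?s ?t] is_inner_normal_def cinner_simps)
  have conj: "cinner ?s (\<i> *s ?t) = cinner (\<i> *s ?t) ?s"
    by (simp add: cinner_smult cinner_clifford[of i u ?n ?s ?s])
  have "cinner (\<i> *s ?t - ?s) (\<i> *s ?t - ?s) = cinner ?t ?t - cinner (\<i> *s ?t) ?s - cinner ?s (\<i> *s ?t) + cinner ?s ?s"
    by (simp add: cinner_def sum_2 algebra_simps)
  then have "Re (cinner (\<i> *s ?t - ?s) (\<i> *s ?t - ?s)) = 2 * mit_defect \<psi> i u"
    by (simp add: ss conj mit_defect_def)
  then have "\<i> *s ?t - ?s = 0"
    by (intro cinner_self_eq_0) (simp add: zero)
  then show "\<i> *s ?t = ?s"
    by simp
qed

text \<open>Spin(2) acts unitarily and commutes with the complex scalars, and both Clifford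
  multiplication and the normal are invariant under changes of charts.\<close>

lemma mit_defect_independent:
  assumes \<psi>: "spinor_field M S \<psi>" and b: "sproj S u \<in> boundary M"
    and i: "sproj S u \<in> cdom M i" and j: "sproj S u \<in> cdom M j" and v: "sproj S v = sproj S u"
  shows "mit_defect \<psi> j v = mit_defect \<psi> i u"
proof -
  obtain z where z: "cmod z = 1" "v = sact S u z"
    using sact_transitive[of u v] v by metis
  then have z': "cmod (inverse z) = 1"
    by (simp add: norm_inverse)
  have \<psi>v: "\<psi> v = spin_rep (inverse z) (\<psi> u)"
    using \<psi> z by (simp add: spinor_field_def)
  have smult: "\<i> *s spin_rep w t = spin_rep w (\<i> *s t)" for w t
    by (simp add: spinor_component_simps algebra_simps)
  have "mit_defect \<psi> j v = mit_defect \<psi> j u"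
    using cinner_spin_rep[OF z'] clifford_sact[OF z(1) j]
    unfolding mit_defect_def v \<psi>v unfolding z(2) by (simp add: sproj_sact[OF z(1)] smult)
  also have "\<dots> = mit_defect \<psi> i u"
    by (simp add: mit_defect_def inner_normal_jac[OF b i j] clifford_jac[OF i j])
  finally show ?thesis .
qed

end

context spinor_gauge
begin

text \<open>The curvature assumption controls \<open>\<nabla>\<^sub>X \<nu>\<close> for tangent vectors \<open>X\<close> of the boundary
  only, so nothing is claimed about other derivatives of the defect. The normal is extended off the boundary by its chart expression, so that the
  product rules apply on the whole chart domain.\<close>

lemma has_chart_derivative_mit_defect:
  assumes killing: "killing_spinor M S \<alpha> \<psi>" and \<alpha>: "Re \<alpha> = 0" and \<kappa>: "complex_of_real \<kappa> = 2 * \<i> * \<alpha>"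
    and curv: "principal_curvature M \<kappa>" and b: "p \<in> boundary M"
  obtains D where "has_chart_derivative M UNIV i (\<lambda>q. mit_defect \<psi> i (\<sigma> q)) D p" "\<And>X. X $ 2 = 0 \<Longrightarrow> D X = 0"
proof -
  let ?s = "\<lambda>q. \<psi> (\<sigma> q)" and ?n = "inner_normal M i"
  let ?ds = "dirder M UNIV i ?s p"
  obtain N where N: "has_chart_derivative M UNIV i ?n N p"
    using has_chart_derivative_inner_normal[OF pi] by blast
  define n where "n = (\<lambda>a q. gip M i q (?n q) (e a q))"
  define dn where "dn = (\<lambda>a X. gip M i p (N X + christoffel M i p X (?n p)) (e a p) + gip M i p (?n p) (nabla M UNIV i (e a) p X))"
  have n': "has_chart_derivative M UNIV i (n a) (dn a) p" for a
    unfolding n_def dn_def nabla_eq[OF has_chart_derivative_frame pi]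
    by (rule has_chart_derivative_gip[OF pi N has_chart_derivative_frame])
  have bil: "bounded_bilinear (\<lambda>s t. Re (cinner s t))"
    by (rule bilinear_conv_bounded_bilinear[THEN iffD1])
       (auto simp: bilinear_def linear_iff cinner_simps)
  have lin: "bounded_linear (\<lambda>s. \<i> *s (gamma a *v s))" for a
    by (rule linear_conv_bounded_linear[THEN iffD1])
       (auto simp: linear_iff linear_add[OF linear_gamma] linear_cmul[OF linear_gamma] vec_eq_iff algebra_simps)
  note s' = has_chart_derivative_spinor
  have product: "has_chart_derivative M UNIV i (\<lambda>q. Re (cinner (F q) (G q))) (\<lambda>X. Re (cinner (F p) (G' X)) + Re (cinner (F' X) (G p))) p"
    if "has_chart_derivative M UNIV i F F' p" "has_chart_derivative M UNIV i G G' p" for F F' G G'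
    using bounded_bilinear.FDERIV[OF bil that[unfolded has_chart_derivative_def]]
    unfolding has_chart_derivative_def o_def by (simp add: pi)
  have scale: "has_chart_derivative M UNIV i (\<lambda>q. F q * G q) (\<lambda>X. F p * G' X + F' X * G p) p"
    if "has_chart_derivative M UNIV i F F' p" "has_chart_derivative M UNIV i G G' p" for F G :: "'m \<Rightarrow> real" and F' G'
    using has_derivative_mult[OF that[unfolded has_chart_derivative_def]]
    unfolding has_chart_derivative_def o_def by (simp add: pi)
  define D where "D = (\<lambda>X. Re (cinner (?s p) (?ds X)) + Re (cinner (?ds X) (?s p)) -
    (\<Sum>a\<in>UNIV. n a p * (Re (cinner (\<i> *s (gamma a *v ?s p)) (?ds X)) + Re (cinner (\<i> *s (gamma a *v ?ds X)) (?s p))) +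
      dn a X * Re (cinner (\<i> *s (gamma a *v ?s p)) (?s p))))"
  have "has_chart_derivative M UNIV i (\<lambda>q. Re (cinner (?s q) (?s q)) -
      (\<Sum>a\<in>UNIV. n a q * Re (cinner (\<i> *s (gamma a *v ?s q)) (?s q)))) D p"
    unfolding D_def
    by (intro has_chart_derivative_diff has_chart_derivative_sum scale product s' n' has_chart_derivative_compose_linear[OF lin])
  then have "has_chart_derivative M UNIV i (\<lambda>q. mit_defect \<psi> i (\<sigma> q)) D p"
  proof (rule has_chart_derivative_transform[OF _ open_gauge pU pi UNIV_I])
    fix q
    assume "q \<in> U"
    have "cinner (\<i> *s (x *\<^sub>R s + y *\<^sub>R t)) r = of_real x * cinner (\<i> *s s) r + of_real y * cinner (\<i> *s t) r" for x y s t r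
      by (simp add: cinner_def sum_2 scaleR_conv_of_real[where 'a = complex] algebra_simps)
    then show "Re (cinner (?s q) (?s q)) - (\<Sum>a\<in>UNIV. n a q * Re (cinner (\<i> *s (gamma a *v ?s q)) (?s q))) = mit_defect \<psi> i (\<sigma> q)"
      by (simp add: mit_defect_def sproj_gauge[OF \<open>q \<in> U\<close>] clifford_eq n_def sum_2)
  qed
  moreover have "D X = 0" if X: "X $ 2 = 0" for X
  proof -
    let ?x = "\<lambda>a. gip M i p X (e a p)"
    have normal: "gip M i p (?n p) X = 0"
      using inner_normal[OF pi] X by (simp add: is_inner_normal_def)
    have "gip M i p (?n p) X = gip M i p (?n p) (\<Sum>a\<in>UNIV. ?x a *\<^sub>R e a p)"
      by (rule arg_cong[OF orthonormal_expansion[OF pi frame_orthonormal]])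
    then have orth: "n 1 p * ?x 1 + n 2 p * ?x 2 = 0"
      by (simp add: normal n_def sum_2 gip_add gip_scale mult.commute)
    have dnX: "dn a X = - \<kappa> * ?x a + (\<Sum>b\<in>UNIV. \<omega> X a b * n b p)" for a
      unfolding dn_def inner_normal_derivative[OF pi b curv N X] nabla_frame
      by (simp add: gip_scale gip_minus gip_sum n_def)
    have "spin_nabla M S i \<sigma> \<psi> p X = \<alpha> *s clifford M S i (\<sigma> p) X (?s p)"
      using killing gauge pU pi unfolding killing_spinor_def by blast
    then have dsX: "?ds X + (1/4) *\<^sub>R (\<Sum>a\<in>UNIV. \<Sum>b\<in>UNIV. \<omega> X a b *\<^sub>R (gamma a *v (gamma b *v ?s p))) =
        \<alpha> *s (\<Sum>a\<in>UNIV. ?x a *\<^sub>R (gamma a *v ?s p))"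
      by (simp add: spin_nabla_def \<omega>_def o_def clifford_def sproj_gauge[OF pU])
    from mit_defect_derivative_algebra[OF connection_skew \<alpha> \<kappa> orth dnX dsX]
    show ?thesis
      by (simp add: D_def sum_2 algebra_simps)
  qed
  ultimately show ?thesis
    by (rule that)
qed

end

context spin_surface
begin

text \<open>The defect is constant along the boundary, so the MIT condition spreads from one point.\<close>

lemma mit_spinor_boundary:
  assumes connected: "connected (boundary M)"
    and killing: "killing_spinor M S \<alpha> \<psi>" and \<alpha>: "Re \<alpha> = 0" and \<kappa>: "complex_of_real \<kappa> = 2 * \<i> * \<alpha>"
    and curv: "principal_curvature M \<kappa>"
    and mit: "p0 \<in> boundary M" "mit_spinor_at M S 1 \<psi> p0"
    and u: "sproj S u \<in> boundary M" and i: "sproj S u \<in> cdom M i"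
  shows "\<i> *s clifford M S i u (inner_normal M i (sproj S u)) (\<psi> u) = \<psi> u"
proof -
  have \<psi>: "spinor_field M S \<psi>"
    using killing by (simp add: killing_spinor_def)
  \<comment> \<open>The choices are immaterial on the boundary, which makes \<open>F\<close> a function there.\<close>
  define F where "F = (\<lambda>q. mit_defect \<psi> (SOME i. q \<in> cdom M i) (SOME u. sproj S u = q))"
  have F: "F (sproj S u) = mit_defect \<psi> i u" if "sproj S u \<in> boundary M" "sproj S u \<in> cdom M i" for u i
    unfolding F_def
  proof (rule mit_defect_independent[OF \<psi> that])
    show "sproj S u \<in> cdom M (SOME i. sproj S u \<in> cdom M i)"
      using that(2) by (rule someI)
    show "sproj S (SOME v. sproj S v = sproj S u) = sproj S u"
      by (rule someI) (rule refl)
  qed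
  have "F constant_on boundary M"
  proof (rule locally_constant_imp_constant[OF connected])
    fix p
    assume p: "p \<in> boundary M"
    obtain U \<sigma> where pU: "p \<in> U" and gauge: "spin_gauge M S U \<sigma>"
      using gauge_around by blast
    obtain i where pi: "p \<in> cdom M i"
      using chart_around by blast
    have U: "open U" "\<And>q. q \<in> U \<Longrightarrow> sproj S (\<sigma> q) = q"
      using gauge by (auto simp: spin_gauge_def)
    let ?x = "cmap M i p"
    obtain r where r: "r > 0" "\<And>t. \<bar>t\<bar> < r \<Longrightarrow> ?x + t *\<^sub>R axis 1 1 \<in> cmap M i ` (cdom M i \<inter> boundary M \<inter> U)"
      using boundary_line[OF U(1) pU pi p] by metis
    \<comment> \<open>\<open>F\<close> near \<open>p\<close>, in the coordinate of the boundary line and along the gauge.\<close>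
    define g where "g = (\<lambda>t. mit_defect \<psi> i (\<sigma> (cpar M i (?x + t *\<^sub>R axis 1 1))))"
    have g': "(g has_derivative (\<lambda>_. 0)) (at t within {-r<..<r})" if t: "t \<in> {-r<..<r}" for t
    proof -
      obtain q where q: "q \<in> cdom M i" "q \<in> boundary M" "q \<in> U" "?x + t *\<^sub>R axis 1 1 = cmap M i q"
      proof -
        have "\<bar>t\<bar> < r"
          using t by auto
        from r(2)[OF this] show ?thesis
          using that by blast
      qed
      interpret spinor_gauge M S \<psi> U \<sigma> i q
        by unfold_locales (use \<psi> gauge q in auto)
      obtain D where D: "has_chart_derivative M UNIV i (\<lambda>q. mit_defect \<psi> i (\<sigma> q)) D q" "\<And>X. X $ 2 = 0 \<Longrightarrow> D X = 0"
        using has_chart_derivative_mit_defect[OF killing \<alpha> \<kappa> curv q(2)] by blast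
      have range: "(\<lambda>t. ?x + t *\<^sub>R axis 1 1) ` {-r<..<r} \<subseteq> cmap M i ` (cdom M i \<inter> UNIV)"
      proof (rule image_subsetI)
        fix t
        assume "t \<in> {-r<..<r}"
        then have "\<bar>t\<bar> < r"
          by auto
        from r(2)[OF this] show "?x + t *\<^sub>R axis 1 1 \<in> cmap M i ` (cdom M i \<inter> UNIV)"
          by blast
      qed
      have 1: "(((\<lambda>q. mit_defect \<psi> i (\<sigma> q)) \<circ> cpar M i) has_derivative D)
          (at (?x + t *\<^sub>R axis 1 1) within (\<lambda>t. ?x + t *\<^sub>R axis 1 1) ` {-r<..<r})"
        using D(1) unfolding has_chart_derivative_def q(4) by (rule has_derivative_subset[OF _ range])
      have 2: "((\<lambda>t. ?x + t *\<^sub>R axis 1 1) has_derivative (\<lambda>h. h *\<^sub>R axis 1 1)) (at t within {-r<..<r})"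
        by (auto intro!: derivative_eq_intros)
      have "D (h *\<^sub>R axis 1 1) = 0" for h
        by (rule D(2)) (simp add: axis_def)
      then show ?thesis
        using has_derivative_in_compose[OF 2 1] by (simp add: g_def)
    qed
    have const: "g t = g 0" if t: "t \<in> {-r<..<r}" for t
    proof -
      have "\<exists>c. \<forall>t\<in>{-r<..<r}. g t = c"
        by (rule has_derivative_zero_constant[OF _ g']) auto
      then show ?thesis
        using t r(1) by auto
    qed
    define W where "W = cdom M i \<inter> U \<inter> {q \<in> cdom M i. cmap M i q \<in> ball ?x r}"
    have "open W"
    proof -
      have "continuous_on (cdom M i) (cmap M i)"
        using chart_homeomorphism by (simp add: homeomorphism_def)
      from continuous_open_preimage[OF this open_cdom open_ball]
      have "open {q \<in> cdom M i. cmap M i q \<in> ball ?x r}"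
        by (simp add: vimage_def Collect_conj_eq)
      then show ?thesis
        unfolding W_def using open_cdom U(1) by blast
    qed
    moreover have "p \<in> W"
      using pi pU r(1) by (simp add: W_def)
    moreover have "F q = F p" if q: "q \<in> boundary M" "q \<in> W" for q
    proof -
      have qW: "q \<in> cdom M i" "q \<in> U" "cmap M i q \<in> ball ?x r"
        using q(2) by (auto simp: W_def)
      define t where "t = cmap M i q $ 1 - ?x $ 1"
      have line: "cmap M i q = ?x + t *\<^sub>R axis 1 1"
        using boundary_cmap[OF q(1) qW(1)] boundary_cmap[OF p pi]
        by (simp add: t_def vec_eq_iff forall_2 axis_def)
      have "\<bar>t\<bar> < r"
        using qW(3) by (simp add: line dist_norm)
      then have "g t = g 0"
        by (intro const) auto
      moreover have "g t = F q"
        using F[of "\<sigma> q" i] U(2)[OF qW(2)] q(1) qW(1) by (simp add: g_def line[symmetric])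
      moreover have "g 0 = F p"
        using F[of "\<sigma> p" i] U(2)[OF pU] p pi by (simp add: g_def)
      ultimately show ?thesis
        by simp
    qed
    ultimately show "\<exists>T. openin (top_of_set (boundary M)) T \<and> p \<in> T \<and> (\<forall>q\<in>T. F q = F p)"
      using p openin_open_Int by (intro exI[of _ "boundary M \<inter> W"]) blast
  qed
  then have "F (sproj S u) = F p0"
    using u mit(1) by (auto simp: constant_on_def)
  moreover have "F p0 = 0"
  proof -
    obtain U \<sigma> where "p0 \<in> U" "spin_gauge M S U \<sigma>"
      using gauge_around by blast
    then have \<sigma>: "sproj S (\<sigma> p0) = p0"
      by (simp add: spin_gauge_def)
    obtain j where j: "p0 \<in> cdom M j"
      using chart_around by blast
    then have "mit_defect \<psi> j (\<sigma> p0) = 0"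
      using mit(2) \<sigma> by (subst mit_defect_eq_0_iff) (auto simp: mit_spinor_at_def)
    then show ?thesis
      using F[of "\<sigma> p0" j] \<sigma> mit(1) j by simp
  qed
  ultimately show ?thesis
    using F[OF u i] mit_defect_eq_0_iff[OF i] by simp
qed

end

context spinor_along
begin

text \<open>In the basis of the unit tangent \<open>\<tau>\<close> and the normal \<open>\<nu>\<close> of the boundary, the Neumann
  condition leaves \<open>\<tau> \<cdot> \<psi> \<otimes> df(\<tau>)\<close>, and \<open>\<nu>\<close> anticommutes with \<open>\<tau>\<close>.\<close>

lemma mit_condition_spinor_along_map:
  assumes neumann: "neumann_condition M N f"
    and mit: "\<And>u i. sproj S u \<in> boundary M \<Longrightarrow> sproj S u \<in> cdom M i \<Longrightarrow>
      \<i> *s clifford M S i u (inner_normal M i (sproj S u)) (\<psi> u) = \<psi> u"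
  shows "mit_condition M S N f (-1) \<Phi>"
  unfolding mit_condition_def
proof (intro allI impI)
  fix u i k
  assume *: "sproj S u \<in> boundary M \<inter> cdom M i \<and> f (sproj S u) \<in> cdom N k"
  let ?p = "sproj S u"
  have b: "?p \<in> boundary M" and i: "?p \<in> cdom M i" and k: "f ?p \<in> cdom N k"
    using * by auto
  let ?n = "inner_normal M i ?p"
  define \<tau> where "\<tau> = inverse (sqrt (gip M i ?p (axis 1 1) (axis 1 1))) *\<^sub>R (axis 1 1 :: real ^ 2)"
  have n: "gip M i ?p ?n ?n = 1" "gip M i ?p ?n \<tau> = 0"
    using inner_normal[OF i] by (auto simp: is_inner_normal_def \<tau>_def axis_def)
  have n': "gip M i ?p \<tau> ?n = 0"
    using n(2) M.gip_commute[OF i] by simp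
  have "gip M i ?p (axis 1 1) (axis 1 1) > 0"
    by (rule M.gip_pos[OF i]) (simp add: axis_eq_0_iff)
  then have \<tau>: "gip M i ?p \<tau> \<tau> = 1"
    by (simp add: \<tau>_def M.gip_scale field_simps)
  define e where "e = (\<lambda>a :: 2. if a = 1 then \<tau> else ?n)"
  have e: "orthonormal M i ?p e"
    unfolding orthonormal_def forall_2 by (simp add: e_def n n' \<tau>)
  have dfn: "df M N f i k ?p ?n = 0"
    using neumann b i k unfolding neumann_condition_def by blast
  have \<Phi>: "\<Phi> u k $ c = df M N f i k ?p \<tau> $ c *\<^sub>R clifford M S i u \<tau> (\<psi> u)" for c
    unfolding spinor_along_map_eq[OF i k e] by (simp add: sum_2 e_def dfn tens_nth)
  have "clifford M S i u ?n (clifford M S i u \<tau> (\<psi> u)) = - clifford M S i u \<tau> (clifford M S i u ?n (\<psi> u))"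
    using clifford_anticommute[OF i, of ?n \<tau> "\<psi> u"] n(2) by (simp add: add_eq_0_iff)
  then have "\<i> *s clifford M S i u ?n (clifford M S i u \<tau> (\<psi> u)) = - clifford M S i u \<tau> (\<i> *s clifford M S i u ?n (\<psi> u))"
    by (simp add: clifford_smult vec_eq_iff)
  then have anti: "\<i> *s clifford M S i u ?n (clifford M S i u \<tau> (\<psi> u)) = - clifford M S i u \<tau> (\<psi> u)"
    unfolding mit[OF b i] .
  have "\<i> *s clifford M S i u ?n (r *\<^sub>R clifford M S i u \<tau> (\<psi> u)) = r *\<^sub>R (\<i> *s clifford M S i u ?n (clifford M S i u \<tau> (\<psi> u)))" for r
    by (simp add: linear_cmul[OF linear_clifford(1)] vec_eq_iff)
  then show "tens_map (\<lambda>s. \<i> *s clifford M S i u ?n s) (\<lambda>Y. Y) (\<Phi> u k) = (\<chi> a. (-1) *s (\<Phi> u k $ a))"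
    by (simp add: tens_map_id \<Phi> anti vec_eq_iff[where 'b = 'n])
qed

end


theorem proposition4p2:
  fixes M :: "('i, 'm::{t2_space, second_countable_topology}, 2) riem"
    and S :: "('i, 'm, 'p::topological_space) spin"
    and N :: "('k, 'y::{t2_space, second_countable_topology}, 'n::finite) riem"
    and f :: "'m \<Rightarrow> 'y"
    and \<alpha> :: complex
    and \<kappa> :: real
    and \<psi> :: "'p \<Rightarrow> complex ^ 2"
    and E :: "'m \<Rightarrow> 2 \<Rightarrow> 'i \<Rightarrow> real ^ 2"
  assumes "riemannian_manifold half_plane M"
    and "oriented M"
    and "compact (UNIV :: 'm set)"
    and "connected (boundary M)"
    and "totally_umbilical_boundary M"
    and "spin_structure M S"
    and "riemannian_manifold UNIV N"
    and "harmonic_map M N f"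
    and "neumann_condition M N f"
    and "Re \<alpha> = 0"
    and "killing_spinor M S \<alpha> \<psi>"
    and "complex_of_real \<kappa> = 2 * \<i> * \<alpha>"
    and "principal_curvature M \<kappa>"
    and "\<exists>p\<in>boundary M. mit_spinor_at M S 1 \<psi> p"
    and "\<forall>p. orthonormal_basis M p (E p)"
  shows "dirac_harmonic_map M S N f (spinor_along_map M S N f \<psi> E) \<and>
    neumann_condition M N f \<and>
    mit_condition M S N f (-1) (spinor_along_map M S N f \<psi> E)"
proof -
  interpret spinor_along M UNIV N f S \<psi> E
  proof unfold_locales
    show "model_space half_plane" "model_space UNIV"
      by (rule model_space_half_plane model_space_UNIV)+
    show "smooth_map M N f" "spinor_field M S \<psi>"
      using assms(8,11) by (auto simp: harmonic_map_def killing_spinor_def)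
    show "orthonormal_basis M p (E p)" for p
      using assms(15) by blast
  qed fact+
  obtain p0 where p0: "p0 \<in> boundary M" "mit_spinor_at M S 1 \<psi> p0"
    using assms(14) by blast
  show ?thesis
    using dirac_harmonic_spinor_along_map[OF assms(11,8)] assms(9)
      mit_condition_spinor_along_map[OF assms(9) mit_spinor_boundary[OF assms(4,11,10,12,13) p0]] by blast
qed

end
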